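(* Let $M$ be a complete Riemannian manifold, $A$ an arbitrary set, and $F:M\times A\to[0,+\infty]$ a function such that for every $\alpha\in A$ the function $F_\alpha:M\to[0,+\infty]$, $F_\alpha(x)=F(x,\alpha)$, is lower semicontinuous and proper (not everywhere $+\infty$). Let $x_0\in M$, $\varepsilon>0$ and $\delta>0$. Assume that $$\alpha\in A,\ d(x,x_0)<2\varepsilon,\ F(x,\alpha)>0,\ \zeta\in\partial_PF_\alpha(x)\ \Longrightarrow\ \|\zeta\|\ge\delta.$$ Then, for $\alpha\in A$, the equation $F(z,\alpha)=0$ has a solution $z\in B(x_0,2\varepsilon)$ provided that there is an $x\in B(x_0,\varepsilon)$ satisfying $F(x,\alpha)<\varepsilon\delta$.
   Context: Riemannian manifolds are modelled on a real Hilbert space (finite or infinite dimensional); $d$ is the Riemannian distance and $B(x,r)$ the open ball. Proximal subdifferential: for a lower semicontinuous $g:X\to(-\infty,+\infty]$ on a Hilbert space $X$ and $x$ with $g(x)<+\infty$, $\zeta\in\partial_Pg(x)$ iff there are $\sigma,\eta>0$ with $g(y)\ge g(x)+\langle\zeta,y-x\rangle-\sigma\|y-x\|^2$ for all $y\in B(x,\eta)$. For lower semicontinuous $g:M\to(-\infty,+\infty]$ on a Riemannian manifold, $\partial_Pg(p):=\partial_P(g\circ\exp_p)(0)\subset TM_p$ (empty if $g(p)=+\infty$). *)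

theory Defs
  imports "HOL-Analysis.Analysis"
begin

section \<open>Smooth maps between normed spaces of arbitrary dimension\<close>

text \<open>A \<open>k\<close>-linear map is represented on argument lists of length \<open>k\<close>.\<close>

definition bounded_multilinear ::
    "nat \<Rightarrow> ('a::real_normed_vector list \<Rightarrow> 'b::real_normed_vector) \<Rightarrow> bool" where
  "bounded_multilinear k m \<longleftrightarrow>
     (\<forall>us vs. length us + length vs + 1 = k \<longrightarrow> linear (\<lambda>w. m (us @ w # vs))) \<and>
     (\<exists>C. \<forall>vs. length vs = k \<longrightarrow> norm (m vs) \<le> C * prod_list (map norm vs))"

text \<open>\<open>D k x\<close> is the \<open>k\<close>-th Frechet derivative of \<open>f\<close> at \<open>x\<close>: the last clause says that \<open>D k\<close>,
  as a map into the normed space of bounded \<open>k\<close>-linear maps, is Frechet differentiable at \<open>x\<close>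
  with derivative \<open>h \<mapsto> D (k+1) x (h, \<dots>)\<close>.  Intended for open \<open>S\<close>.\<close>

definition smooth_on ::
    "'a::real_normed_vector set \<Rightarrow> ('a \<Rightarrow> 'b::real_normed_vector) \<Rightarrow> bool" where
  "smooth_on S f \<longleftrightarrow>
     (\<exists>D :: nat \<Rightarrow> 'a \<Rightarrow> 'a list \<Rightarrow> 'b.
        (\<forall>x\<in>S. D 0 x [] = f x) \<and>
        (\<forall>k. \<forall>x\<in>S. bounded_multilinear k (D k x)) \<and>
        (\<forall>k. \<forall>x\<in>S. \<forall>e>0. \<exists>d>0. \<forall>y\<in>S. norm (y - x) < d \<longrightarrow>
           (\<forall>vs. length vs = k \<longrightarrow>
              norm (D k y vs - D k x vs - D (Suc k) x ((y - x) # vs))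
                \<le> e * norm (y - x) * prod_list (map norm vs))))"


section \<open>Riemannian manifolds modelled on a Hilbert space\<close>

text \<open>A chart is a pair of its domain and its coordinate map; the coordinate map is only
  meaningful on the domain.\<close>

type_synonym ('m, 'h) chart = "'m set \<times> ('m \<Rightarrow> 'h)"

abbreviation chart_dom :: "('m, 'h) chart \<Rightarrow> 'm set" where
  "chart_dom c \<equiv> fst c"

abbreviation chart_map :: "('m, 'h) chart \<Rightarrow> 'm \<Rightarrow> 'h" where
  "chart_map c \<equiv> snd c"

definition chart_inv :: "('m, 'h) chart \<Rightarrow> 'h \<Rightarrow> 'm" where
  "chart_inv c = inv_into (chart_dom c) (chart_map c)"

definition chart_img :: "('m, 'h) chart \<Rightarrow> 'h set" where
  "chart_img c = chart_map c ` chart_dom c"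

definition is_chart :: "('m::topological_space, 'h::topological_space) chart \<Rightarrow> bool" where
  "is_chart c \<longleftrightarrow> open (chart_dom c) \<and> open (chart_img c) \<and>
     homeomorphism (chart_dom c) (chart_img c) (chart_map c) (chart_inv c)"

definition transition :: "('m, 'h) chart \<Rightarrow> ('m, 'h) chart \<Rightarrow> 'h \<Rightarrow> 'h" where
  "transition c c' = chart_map c' \<circ> chart_inv c"

definition smooth_atlas ::
    "('m::topological_space, 'h::real_normed_vector) chart set \<Rightarrow> bool" where
  "smooth_atlas \<A> \<longleftrightarrow>
     (\<Union>c\<in>\<A>. chart_dom c) = UNIV \<and>
     (\<forall>c\<in>\<A>. is_chart c) \<and>
     (\<forall>c\<in>\<A>. \<forall>c'\<in>\<A>.
        smooth_on (chart_map c ` (chart_dom c \<inter> chart_dom c')) (transition c c'))"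

text \<open>The underlying set of the manifold is the whole type \<open>'m\<close>, with its type class topology.
  \<open>metric M c x\<close> is the coordinate expression of the Riemannian metric in the chart \<open>c\<close>
  at the coordinate point \<open>x \<in> chart_img c\<close>.\<close>

record (overloaded) ('m, 'h) manifold =
  atlas :: "('m, 'h::real_normed_vector) chart set"
  metric :: "('m, 'h) chart \<Rightarrow> 'h \<Rightarrow> ('h \<Rightarrow>\<^sub>L 'h \<Rightarrow>\<^sub>L real)"

abbreviation bil ::
    "('h::real_normed_vector \<Rightarrow>\<^sub>L 'h \<Rightarrow>\<^sub>L real) \<Rightarrow> 'h \<Rightarrow> 'h \<Rightarrow> real" where
  "bil B u v \<equiv> blinfun_apply (blinfun_apply B u) v"

text \<open>Each inner product of the metric is bounded (by its type) and coercive, that is, it makes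
  the tangent space a Hilbert space with the topology of the model space.  The last clause is the
  transformation law of a covariant 2-tensor.\<close>

definition riemannian_manifold ::
    "('m::t2_space, 'h::{real_inner, complete_space}) manifold \<Rightarrow> bool" where
  "riemannian_manifold M \<longleftrightarrow>
     smooth_atlas (atlas M) \<and>
     (\<forall>c\<in>atlas M.
        smooth_on (chart_img c) (metric M c) \<and>
        (\<forall>x\<in>chart_img c.
           (\<forall>u v. bil (metric M c x) u v = bil (metric M c x) v u) \<and>
           (\<exists>k>0. \<forall>u. k * (norm u)\<^sup>2 \<le> bil (metric M c x) u u))) \<and>
     (\<forall>c\<in>atlas M. \<forall>c'\<in>atlas M. \<forall>p \<in> chart_dom c \<inter> chart_dom c'. \<forall>u v.
        (let T = frechet_derivative (transition c c') (at (chart_map c p))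
         in bil (metric M c (chart_map c p)) u v
            = bil (metric M c' (chart_map c' p)) (T u) (T v)))"

text \<open>The tangent space at \<open>p\<close> is identified with the model space \<open>'h\<close> through one fixed chart
  around \<open>p\<close>; its inner product is \<open>tangent_inner M p\<close>.  By the transformation law another choice
  of chart changes everything below only by a linear isometry of the tangent space.\<close>

definition ref_chart :: "('m, 'h::real_normed_vector) manifold \<Rightarrow> 'm \<Rightarrow> ('m, 'h) chart" where
  "ref_chart M p = (SOME c. c \<in> atlas M \<and> p \<in> chart_dom c)"

definition tangent_inner ::
    "('m, 'h::real_normed_vector) manifold \<Rightarrow> 'm \<Rightarrow> 'h \<Rightarrow> 'h \<Rightarrow> real" where
  "tangent_inner M p u v = bil (metric M (ref_chart M p) (chart_map (ref_chart M p) p)) u v"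

definition tangent_norm :: "('m, 'h::real_normed_vector) manifold \<Rightarrow> 'm \<Rightarrow> 'h \<Rightarrow> real" where
  "tangent_norm M p u = sqrt (tangent_inner M p u u)"


section \<open>Riemannian distance\<close>

definition C1_curve_on ::
    "('m::topological_space, 'h::real_normed_vector) manifold \<Rightarrow> real set \<Rightarrow> (real \<Rightarrow> 'm) \<Rightarrow> bool"
  where
  "C1_curve_on M J \<gamma> \<longleftrightarrow>
     continuous_on J \<gamma> \<and>
     (\<forall>c\<in>atlas M. \<exists>v.
        continuous_on {t\<in>J. \<gamma> t \<in> chart_dom c} v \<and>
        (\<forall>t\<in>J. \<gamma> t \<in> chart_dom c \<longrightarrow>
           ((chart_map c \<circ> \<gamma>) has_vector_derivative v t) (at t within J)))"

definition piecewise_C1_curve ::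
    "('m::topological_space, 'h::real_normed_vector) manifold \<Rightarrow> (real \<Rightarrow> 'm) \<Rightarrow> bool" where
  "piecewise_C1_curve M \<gamma> \<longleftrightarrow>
     continuous_on {0..1} \<gamma> \<and>
     (\<exists>S. finite S \<and>
        (\<forall>a b. 0 \<le> a \<and> a < b \<and> b \<le> 1 \<and> {a<..<b} \<inter> S = {} \<longrightarrow> C1_curve_on M {a..b} \<gamma>))"

definition velocity ::
    "('m, 'h::real_normed_vector) manifold \<Rightarrow> (real \<Rightarrow> 'm) \<Rightarrow> real \<Rightarrow> 'h" where
  "velocity M \<gamma> t = vector_derivative (chart_map (ref_chart M (\<gamma> t)) \<circ> \<gamma>) (at t)"

definition curve_length ::
    "('m, 'h::real_normed_vector) manifold \<Rightarrow> (real \<Rightarrow> 'm) \<Rightarrow> real" where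
  "curve_length M \<gamma> = integral {0..1} (\<lambda>t. tangent_norm M (\<gamma> t) (velocity M \<gamma> t))"

text \<open>The distance between points in different connected components is \<open>\<infinity>\<close>.\<close>

definition rdist ::
    "('m::topological_space, 'h::real_normed_vector) manifold \<Rightarrow> 'm \<Rightarrow> 'm \<Rightarrow> ennreal" where
  "rdist M p q =
     (INF \<gamma> \<in> {\<gamma>. piecewise_C1_curve M \<gamma> \<and> \<gamma> 0 = p \<and> \<gamma> 1 = q}. ennreal (curve_length M \<gamma>))"

definition rball ::
    "('m::topological_space, 'h::real_normed_vector) manifold \<Rightarrow> 'm \<Rightarrow> real \<Rightarrow> 'm set" where
  "rball M p r = {q. rdist M q p < ennreal r}"

definition complete_manifold ::
    "('m::topological_space, 'h::real_normed_vector) manifold \<Rightarrow> bool" where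
  "complete_manifold M \<longleftrightarrow>
     (\<forall>s :: nat \<Rightarrow> 'm.
        (\<forall>e>0. \<exists>N. \<forall>m\<ge>N. \<forall>n\<ge>N. rdist M (s m) (s n) < e) \<longrightarrow>
        (\<exists>p. \<forall>e>0. \<exists>N. \<forall>n\<ge>N. rdist M (s n) p < e))"


section \<open>Geodesics and the exponential map\<close>

text \<open>Christoffel symbol of the Levi-Civita connection in the chart \<open>c\<close> at \<open>x\<close>, given by the
  Koszul formula for constant coordinate vector fields.\<close>

definition christoffel ::
    "('m, 'h::real_normed_vector) manifold \<Rightarrow> ('m, 'h) chart \<Rightarrow> 'h \<Rightarrow> 'h \<Rightarrow> 'h \<Rightarrow> 'h" where
  "christoffel M c x u v =
     (let dg = frechet_derivative (metric M c) (at x)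
      in THE z. \<forall>w. 2 * bil (metric M c x) z w
           = bil (dg u) v w + bil (dg v) u w - bil (dg w) u v)"

definition geodesic_on ::
    "('m::topological_space, 'h::real_normed_vector) manifold \<Rightarrow> real set \<Rightarrow> (real \<Rightarrow> 'm) \<Rightarrow> bool"
  where
  "geodesic_on M J \<gamma> \<longleftrightarrow>
     continuous_on J \<gamma> \<and>
     (\<forall>c\<in>atlas M. \<exists>v. \<forall>t\<in>J. \<gamma> t \<in> chart_dom c \<longrightarrow>
        ((chart_map c \<circ> \<gamma>) has_vector_derivative v t) (at t within J) \<and>
        (v has_vector_derivative - christoffel M c (chart_map c (\<gamma> t)) (v t) (v t))
          (at t within J))"

definition riem_exp ::
    "('m::topological_space, 'h::real_normed_vector) manifold \<Rightarrow> 'm \<Rightarrow> 'h \<Rightarrow> 'm" where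
  "riem_exp M p v =
     (THE q. \<exists>\<gamma>. geodesic_on M {0..1} \<gamma> \<and> \<gamma> 0 = p \<and>
        ((chart_map (ref_chart M p) \<circ> \<gamma>) has_vector_derivative v) (at 0 within {0..1}) \<and>
        \<gamma> 1 = q)"


section \<open>Lower semicontinuity and proximal subdifferentials\<close>

definition lower_semicontinuous :: "('a::topological_space \<Rightarrow> ereal) \<Rightarrow> bool" where
  "lower_semicontinuous f \<longleftrightarrow> (\<forall>x t. t < f x \<longrightarrow> (\<forall>\<^sub>F y in nhds x. t < f y))"

text \<open>\<open>prox_subdiff ip g x\<close> is the proximal subdifferential of \<open>g\<close> at \<open>x\<close> in the Hilbert space
  given by \<open>'h\<close> with the inner product \<open>ip\<close>, which need not be the one of the type class.\<close>

definition prox_subdiff ::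
    "('h::real_vector \<Rightarrow> 'h \<Rightarrow> real) \<Rightarrow> ('h \<Rightarrow> ereal) \<Rightarrow> 'h \<Rightarrow> 'h set" where
  "prox_subdiff ip g x =
     {\<zeta>. g x < \<infinity> \<and>
        (\<exists>\<sigma>>0. \<exists>\<eta>>0. \<forall>y. sqrt (ip (y - x) (y - x)) < \<eta> \<longrightarrow>
           g x + ereal (ip \<zeta> (y - x) - \<sigma> * (sqrt (ip (y - x) (y - x)))\<^sup>2) \<le> g y)}"

definition riem_prox_subdiff ::
    "('m::topological_space, 'h::real_normed_vector) manifold \<Rightarrow> ('m \<Rightarrow> ereal) \<Rightarrow> 'm \<Rightarrow> 'h set" where
  "riem_prox_subdiff M g p =
     (if g p = \<infinity> then {} else prox_subdiff (tangent_inner M p) (g \<circ> riem_exp M p) 0)"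

end

theory Submission
  imports Defs
begin

text \<open>If \<open>F(\<cdot>, \<alpha>)\<close> has no zero in the ball, Ekeland's principle for the Riemannian distance, started at
  \<open>x\<close>, gives a point \<open>y\<close> of the ball at which \<open>F(\<cdot>, \<alpha>)\<close> decreases with slope at most some
  \<open>lam < \<delta>\<close>.  In a chart around \<open>y\<close> the metric is nearly constant, so the same holds, with a slightly
  larger slope, for the coordinate expression in the Hilbert space \<open>TM\<^sub>y\<close>; there a Borwein--Preiss type
  perturbation yields a nearby proximal subgradient of norm less than \<open>\<delta>\<close>.  Since the exponential map
  agrees with a chart up to a quadratic error, that subgradient is one on the manifold, which
  contradicts the assumption.\<close>

section \<open>Riesz representation and variational principles\<close>

text \<open>The bound \<open>F x \<alpha> < \<epsilon> * \<delta>\<close> leaves room for a slope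
  \<open>lam\<close> with \<open>F x \<alpha> / \<epsilon> < lam < \<delta>\<close>. The left
  inequality makes the Ekeland point move by less than \<open>\<epsilon>\<close>, whence the radius
  \<open>2 * \<epsilon>\<close>; the right one absorbs every later loss: from distance to tangent
  norm, in the smoothing, and from \<open>y\<close> to the point \<open>p\<close> that carries the
  subgradient. In infinite dimension infima need not be attained, so minimisers come from
  completeness and small perturbations, never from compactness. The distance is never
  differentiated; it is only bounded above by the length of coordinate segments. The topology of the
  manifold is given independently of \<open>rdist\<close>, so lower semicontinuity can be used along
  \<open>rdist\<close>-limits only after small distance is shown to imply topological nearness.
  \<open>riem_exp\<close> is a definite description, so its values near 0 require local existence
  together with uniqueness among all geodesics, including those that might leave the chart. The zero
  produced at the end is the point \<open>p\<close> itself.\<close>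

text \<open>The minimiser of \<open>bil B u u - 2 * l u\<close> solves the equation. This serves for
  the Christoffel symbols, for the identification of the model space with its dual, and for turning
  a functional into a tangent vector.\<close>

lemma riesz_coercive:
  fixes B :: "'h::{real_inner, complete_space} \<Rightarrow>\<^sub>L 'h \<Rightarrow>\<^sub>L real" and l :: "'h \<Rightarrow>\<^sub>L real"
  assumes sym: "\<And>u v. bil B u v = bil B v u"
    and k: "k > 0" "\<And>u. k * (norm u)\<^sup>2 \<le> bil B u u"
  shows "\<exists>z. \<forall>w. bil B z w = l w"
proof -
  define q where "q u = bil B u u - 2 * l u" for u
  have q_add: "q (u + t *\<^sub>R w) = q u + t\<^sup>2 * bil B w w + 2 * t * (bil B u w - l w)" for u w t
    unfolding q_def using sym[of u w]
    by (simp add: blinfun.add_left blinfun.add_right blinfun.scaleR_left blinfun.scaleR_right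
        power2_eq_square algebra_simps)
  have low: "q u \<ge> - (norm l)\<^sup>2 / k" for u
  proof -
    have "l u \<le> norm l * norm u" using norm_blinfun[of l u] by simp
    moreover have "k * (norm u)\<^sup>2 - 2 * (norm l * norm u) + (norm l)\<^sup>2 / k = (k * norm u - norm l)\<^sup>2 / k"
      using k(1) by (simp add: power2_eq_square field_simps)
    moreover have "(k * norm u - norm l)\<^sup>2 / k \<ge> 0" using k(1) by simp
    ultimately show ?thesis unfolding q_def using k(2)[of u] by linarith
  qed
  define I where "I = (INF u. q u)"
  have bdd: "bdd_below (range q)" using low by (intro bdd_belowI2) auto
  have Ile: "I \<le> q u" for u unfolding I_def using bdd by (intro cINF_lower) auto
  have "\<exists>u. q u < I + 1 / real (Suc n)" for n
    using cInf_lessD[of "range q" "I + 1 / real (Suc n)"] unfolding I_def by fastforce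
  then obtain s where s: "\<And>n. q (s n) < I + 1 / real (Suc n)" by metis
  \<comment> \<open>Parallelogram identity: the value at the midpoint is at least \<open>I\<close>,
    so a minimising sequence is Cauchy.\<close>
  have para: "k / 2 * (norm (a - b))\<^sup>2 \<le> q a + q b - 2 * I" for a b
  proof -
    have 1: "q a = q b + bil B (a - b) (a - b) + 2 * (bil B b (a - b) - l (a - b))"
      using q_add[of b 1 "a - b"] by simp
    have 2: "q (b + (1/2) *\<^sub>R (a - b)) = q b + bil B (a - b) (a - b) / 4 + (bil B b (a - b) - l (a - b))"
      using q_add[of b "1/2" "a - b"] by (simp add: power2_eq_square)

    have 3: "x \<le> qa + qb - 2 * J"
      if "J \<le> y" "x = n / 2" "qa = qb + d + 2 * r" "y = qb + d / 4 + r" "n \<le> d"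
      for x qa qb J y n d r :: real
      using that by linarith
    show ?thesis
      by (rule 3[OF Ile[of "b + (1/2) *\<^sub>R (a - b)"] _ 1 2 k(2)]) simp
  qed
  have "Cauchy s"
  proof (rule metric_CauchyI)
    fix e :: real assume e: "e > 0"
    have "k / 4 * e\<^sup>2 > 0" using k e by simp
    then obtain N where N: "1 / real (Suc N) < k / 4 * e\<^sup>2"
      using nat_approx_posE by blast
    have "dist (s m) (s n) < e" if mn: "m \<ge> N" "n \<ge> N" for m n
    proof -
      have "1 / real (Suc m) \<le> 1 / real (Suc N)" "1 / real (Suc n) \<le> 1 / real (Suc N)"
        using mn by (auto simp: field_simps)
      then have "k / 2 * (norm (s m - s n))\<^sup>2 < k / 2 * e\<^sup>2"
        using para[of "s m" "s n"] s[of m] s[of n] N by linarith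
      then have "(norm (s m - s n))\<^sup>2 < e\<^sup>2" using k by simp
      then show ?thesis using e by (simp add: dist_norm power_less_imp_less_base)
    qed
    then show "\<exists>M. \<forall>m\<ge>M. \<forall>n\<ge>M. dist (s m) (s n) < e" by blast
  qed
  then obtain z where z: "s \<longlonglongrightarrow> z" using Cauchy_convergent_iff convergent_def by blast
  have "(\<lambda>n. q (s n)) \<longlonglongrightarrow> q z"
    unfolding q_def by (intro tendsto_intros z)
  moreover have "(\<lambda>n. I + 1 / real (Suc n)) \<longlonglongrightarrow> I + 0"
    by (intro tendsto_intros LIMSEQ_Suc[OF lim_1_over_n])
  ultimately have "q z \<le> I + 0"
    by (rule LIMSEQ_le) (use s less_imp_le in blast)
  then have qz: "q z \<le> q u" for u using Ile[of u] by simp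
  have "bil B z w = l w" for w
  proof (rule ccontr)
    define c where "c = bil B z w - l w"
    define b where "b = bil B w w"
    assume "bil B z w \<noteq> l w"
    then have c: "c \<noteq> 0" unfolding c_def by simp
    have "0 \<le> k * (norm w)\<^sup>2" using k(1) by simp
    then have b: "b \<ge> 0" using k(2)[of w] unfolding b_def by linarith
    \<comment> \<open>The exact minimiser along \<open>w\<close> would be \<open>- c / b\<close>;
      the added 1 keeps the denominator positive, and the change of \<open>q\<close> is still
      negative.\<close>
    define t where "t = - c / (b + 1)"
    have "0 \<le> t\<^sup>2 * b + 2 * t * c"
      using qz[of "z + t *\<^sub>R w"] q_add[of z t w] unfolding b_def c_def by simp
    also have "\<dots> = - (c\<^sup>2 * (b + 2)) / (b + 1)\<^sup>2"
      using b unfolding t_def by (simp add: power2_eq_square divide_simps) (simp add: algebra_simps)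
    also have "\<dots> < 0"
    proof -
      have "c\<^sup>2 * (b + 2) > 0" using b c by (intro mult_pos_pos) auto
      moreover have "(b + 1)\<^sup>2 > 0" using b by (intro zero_less_power) auto
      ultimately show ?thesis by (simp add: divide_neg_pos)
    qed
    finally show False by simp
  qed
  then show ?thesis by blast
qed

text \<open>A point within \<open>e\<close> of the infimum may lie above \<open>G u\<close>; in that
  case \<open>u\<close> itself is within \<open>e\<close> of the infimum. The Borwein--Preiss
  selection needs both properties at once, since its values must descend.\<close>

lemma approx_minimizer:
  fixes G :: "'a \<Rightarrow> real"
  assumes "u \<in> D" "\<And>v. v \<in> D \<Longrightarrow> m \<le> G v" "e > 0"
  shows "\<exists>w\<in>D. G w \<le> G u \<and> (\<forall>v\<in>D. G w \<le> G v + e)"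
proof -
  have bdd: "bdd_below (G ` D)" using assms(2) by (intro bdd_belowI2) auto
  obtain v where v: "v \<in> D" "G v < Inf (G ` D) + e"
    using cInf_lessD[of "G ` D" "Inf (G ` D) + e"] assms(1,3) by auto
  have low: "Inf (G ` D) \<le> G w" if "w \<in> D" for w using bdd that by (intro cINF_lower) auto
  show ?thesis
  proof (cases "G v \<le> G u")
    case True
    have "G v \<le> G w + e" if "w \<in> D" for w using v(2) low[OF that] by linarith
    then show ?thesis using v(1) True by blast
  next
    case False
    have "G u \<le> G w + e" if "w \<in> D" for w using False v(2) low[OF that] by linarith
    then show ?thesis using assms(1) by blast
  qed
qed

text \<open>Borwein--Preiss: the squared distances added along a sequence of approximate minimisers make the
  sublevel sets shrink to a point.\<close>

lemma quadratic_variational_principle: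
  fixes H :: "'h::{real_inner, complete_space} \<Rightarrow> real"
  assumes clos: "closed {(u, c). u \<in> D \<and> H u \<le> c}"
    and u0: "u0 \<in> D" and R: "\<And>u v. u \<in> D \<Longrightarrow> v \<in> D \<Longrightarrow> norm (u - v) \<le> R"
    and m: "\<And>u. u \<in> D \<Longrightarrow> m \<le> H u" and \<tau>: "\<tau> > 0"
  shows "\<exists>u\<in>D. H u \<le> H u0 \<and>
           (\<exists>b. norm b \<le> \<tau> \<and> (\<forall>v\<in>D. H v \<ge> H u + inner b (v - u) - \<tau> * (norm (v - u))\<^sup>2))"
proof -
  have R0: "R \<ge> 0" using R[OF u0 u0] by simp
  \<comment> \<open>The quadratic terms have total weight at most \<open>\<tau>'\<close> and their
    gradient has norm at most \<open>2 * R * \<tau>'\<close>; this choice keeps both below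
    \<open>\<tau>\<close>.\<close>
  define \<tau>' where "\<tau>' = \<tau> / (2 * R + 1)"
  have \<tau>': "\<tau>' > 0" "\<tau>' \<le> \<tau>" "2 * R * \<tau>' \<le> \<tau>"
    using \<tau> R0 unfolding \<tau>'_def by (auto simp: field_simps)
  define \<mu> where "\<mu> n = \<tau>' * (1/2) ^ Suc n" for n
  have \<mu>: "\<mu> n > 0" for n using \<tau>' unfolding \<mu>_def by simp
  have sum\<mu>: "sum \<mu> {..<n} = \<tau>' * (1 - (1/2)^n)" for n
    by (induction n) (auto simp: \<mu>_def algebra_simps)
  have sum\<mu>_tail: "sum \<mu> {n..<k} \<le> \<tau>' * (1/2)^n" for n k
  proof (cases "n \<le> k")
    case True
    then have "sum \<mu> {n..<k} = sum \<mu> {..<k} - sum \<mu> {..<n}"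
      by (metis add_diff_cancel_left' atLeast0LessThan le0 sum.atLeastLessThan_concat)
    moreover have "\<tau>' * (1/2)^k \<ge> 0" using \<tau>' by simp
    ultimately show ?thesis unfolding sum\<mu> by (simp add: algebra_simps)
  qed (use \<tau>' in auto)
  \<comment> \<open>Chosen so that \<open>e 0 = H u0 - m + 1\<close>, which makes \<open>u0\<close>
    admissible as the first approximate minimiser.\<close>
  define c where "c = (H u0 - m + 1) / \<mu> 0"
  have c: "c > 0" using m[OF u0] \<mu> unfolding c_def by simp
  \<comment> \<open>In \<open>rad\<close> the weight \<open>\<mu> n\<close> cancels and leaves the
    squared radius \<open>c / real (Suc n)\<close>, which tends to 0.\<close>
  define e where "e n = \<mu> n * (c / real (Suc n))" for n
  have e: "e n > 0" for n using c \<mu> unfolding e_def by simp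
  let ?P = "\<lambda>n (G, u). u \<in> D \<and> (\<forall>v\<in>D. m \<le> G v) \<and> (\<forall>v\<in>D. G u \<le> G v + e n)"
  let ?Q = "\<lambda>n (G, u) (G', u'). G' = (\<lambda>v. G v + \<mu> n * (norm (v - u))\<^sup>2) \<and> G' u' \<le> G u"
  have "\<exists>f. \<forall>n. (?P n (f n) \<and> (n = 0 \<longrightarrow> f n = (H, u0))) \<and> ?Q n (f n) (f (Suc n))"
  proof (rule dependent_nat_choice)
    have "e 0 = H u0 - m + 1" using \<mu>[of 0] unfolding e_def c_def by simp
    then have "?P 0 (H, u0)" using u0 m by force
    then show "\<exists>x. ?P 0 x \<and> ((0::nat) = 0 \<longrightarrow> x = (H, u0))" by blast
  next
    fix x n
    assume A: "?P n x \<and> (n = 0 \<longrightarrow> x = (H, u0))"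
    obtain G u where x: "x = (G, u)" by force
    define G' where "G' v = G v + \<mu> n * (norm (v - u))\<^sup>2" for v
    have low: "m \<le> G' v" if "v \<in> D" for v
    proof -
      have "\<mu> n * (norm (v - u))\<^sup>2 \<ge> 0" using \<mu>[of n] by simp
      then show ?thesis using A that unfolding x G'_def by force
    qed
    obtain w where "w \<in> D" "G' w \<le> G' u" "\<forall>v\<in>D. G' w \<le> G' v + e (Suc n)"
      using approx_minimizer[of u D m G' "e (Suc n)"] low A e unfolding x by auto
    moreover have "G' u = G u" unfolding G'_def by simp
    ultimately have "?P (Suc n) (G', w)" "?Q n x (G', w)" using low unfolding x G'_def by auto
    then show "\<exists>y. (?P (Suc n) y \<and> (Suc n = 0 \<longrightarrow> y = (H, u0))) \<and> ?Q n x y"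
      by (intro exI[of _ "(G', w)"]) simp
  qed
  then obtain f where fs: "\<forall>n. (?P n (f n) \<and> (n = 0 \<longrightarrow> f n = (H, u0))) \<and> ?Q n (f n) (f (Suc n))"
    by (rule exE)
  note f = conjunct1[OF conjunct1[OF spec[OF fs]]] mp[OF conjunct2[OF conjunct1[OF spec[OF fs, of 0]]] refl]
    conjunct2[OF spec[OF fs]]
  define G where "G n = fst (f n)" for n
  define s where "s n = snd (f n)" for n
  have sD: "s n \<in> D" and near: "\<And>v. v \<in> D \<Longrightarrow> G n (s n) \<le> G n v + e n" for n
    using f(1)[of n] unfolding G_def s_def by (auto simp: case_prod_unfold)
  have GSuc: "G (Suc n) v = G n v + \<mu> n * (norm (v - s n))\<^sup>2" and desc: "G (Suc n) (s (Suc n)) \<le> G n (s n)" for n v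
    using f(3)[of n] unfolding G_def s_def by (auto simp: case_prod_unfold)
  have G0: "G 0 = H" "s 0 = u0" using f(2) unfolding G_def s_def by auto
  have Gsum: "G n v = H v + (\<Sum>i<n. \<mu> i * (norm (v - s i))\<^sup>2)" for n v
    by (induction n) (auto simp: G0 GSuc)
  have Gmono: "G n v \<le> G (Suc n) v" for n v using \<mu>[of n] by (simp add: GSuc)
  define S where "S n = {u \<in> D. G (Suc n) u \<le> G n (s n)}" for n
  have Ssub: "S (Suc n) \<subseteq> S n" for n
    unfolding S_def using order_trans[OF Gmono order_trans[OF _ desc]] by blast
  have Santi: "S k \<subseteq> S n" if "n \<le> k" for n k
    using that Ssub by (induction rule: dec_induct) blast+
  have sS: "s n \<in> S n" for n unfolding S_def using sD GSuc by simp
  have rad: "(norm (u - s n))\<^sup>2 \<le> c / real (Suc n)" if "u \<in> S n" for u n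
  proof -
    have "\<mu> n * (norm (u - s n))\<^sup>2 \<le> \<mu> n * (c / real (Suc n))"
      using that near[of u n] unfolding S_def GSuc e_def by simp
    then show ?thesis by (rule mult_left_le_imp_le[OF _ \<mu>])
  qed
  have "(\<lambda>n. sqrt (c / real (Suc n))) \<longlonglongrightarrow> sqrt (c * 0)"
    by (rule tendsto_real_sqrt) (use tendsto_mult[OF tendsto_const[of c] LIMSEQ_Suc[OF lim_1_over_n[where 'a=real]]] in simp)
  then have rlim: "(\<lambda>n. sqrt (c / real (Suc n))) \<longlonglongrightarrow> 0" by simp
  have dst: "dist u (s n) \<le> sqrt (c / real (Suc n))" if "u \<in> S n" for u n
    using rad[OF that] by (simp add: dist_norm real_le_rsqrt)
  have "Cauchy s"
  proof (rule metric_CauchyI)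
    fix r :: real assume "r > 0"
    then obtain N where N: "sqrt (c / real (Suc N)) < r / 2"
      using order_tendstoD(2)[OF rlim, of "r/2"] by (auto dest: eventually_happens)
    have "dist (s a) (s b) < r" if "a \<ge> N" "b \<ge> N" for a b
    proof -
      have "s a \<in> S N" "s b \<in> S N" using Santi sS that by blast+
      then show ?thesis using dst[of "s a" N] dst[of "s b" N] N dist_triangle2[of "s a" "s b" "s N"] by linarith
    qed
    then show "\<exists>M. \<forall>m\<ge>M. \<forall>n\<ge>M. dist (s m) (s n) < r" by blast
  qed
  then obtain u where u: "s \<longlonglongrightarrow> u" using Cauchy_convergent_iff convergent_def by blast
  have uS: "u \<in> S n" for n
  proof -
    \<comment> \<open>Only the epigraph of \<open>H\<close> is known to be closed, so the sublevel
      set is written as its preimage under a continuous map.\<close>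
    let ?E = "{(u, c). u \<in> D \<and> H u \<le> c}"
    let ?g = "\<lambda>v. (v, G n (s n) - (\<Sum>i<Suc n. \<mu> i * (norm (v - s i))\<^sup>2))"
    have "S n = ?g -` ?E" unfolding S_def Gsum by (auto simp: algebra_simps)
    moreover have "closed (?g -` ?E)"
      by (intro continuous_closed_vimage clos) (intro continuous_intros)
    ultimately have "closed (S n)" by simp
    then show ?thesis
      by (rule Lim_in_closed_set[OF _ _ _ u])
         (use sS Santi in \<open>auto simp: eventually_sequentially intro!: exI[of _ n]\<close>)
  qed
  have uD: "u \<in> D" using uS[of 0] unfolding S_def by simp
  \<comment> \<open>Minus the gradient at \<open>u\<close> of the accumulated quadratic
    perturbation; expanding each square around \<open>u\<close> (see \<open>sq\<close> below) leaves
    exactly this linear part.\<close>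
  define b where "b n = (\<Sum>i<n. (-2 * \<mu> i) *\<^sub>R (u - s i))" for n
  have bnd: "norm (\<Sum>i\<in>I. (-2 * \<mu> i) *\<^sub>R (u - s i)) \<le> 2 * R * sum \<mu> I" for I
  proof -
    have "norm (\<Sum>i\<in>I. (-2 * \<mu> i) *\<^sub>R (u - s i)) \<le> (\<Sum>i\<in>I. 2 * \<mu> i * R)"
    proof (rule sum_norm_le)
      fix i
      show "norm ((-2 * \<mu> i) *\<^sub>R (u - s i)) \<le> 2 * \<mu> i * R"
        using R[OF uD sD[of i]] \<mu>[of i] by simp
    qed
    also have "\<dots> = 2 * R * sum \<mu> I" unfolding sum_distrib_left by (rule sum.cong) auto
    finally show ?thesis .
  qed
  have "Cauchy b"
  proof (rule metric_CauchyI)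
    fix r :: real assume r: "r > 0"
    have "(\<lambda>n. 2 * R * (\<tau>' * (1/2)^n)) \<longlonglongrightarrow> 2 * R * (\<tau>' * 0)"
      by (intro tendsto_intros LIMSEQ_power_zero) auto
    then have "\<forall>\<^sub>F n in sequentially. 2 * R * (\<tau>' * (1/2)^n) < r / 2"
      by (rule order_tendstoD(2)) (use r in simp)
    then obtain N where N: "2 * R * (\<tau>' * (1/2)^N) < r / 2"
      by (auto simp only: eventually_sequentially)
    have tail: "dist (b n) (b N) < r / 2" if "n \<ge> N" for n
    proof -
      have "b n - b N = (\<Sum>i\<in>{N..<n}. (-2 * \<mu> i) *\<^sub>R (u - s i))"
        unfolding b_def using that sum.atLeastLessThan_concat[of 0 N n "\<lambda>i. (-2 * \<mu> i) *\<^sub>R (u - s i)"]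
        by (simp add: atLeast0LessThan algebra_simps)
      then have "dist (b n) (b N) \<le> 2 * R * sum \<mu> {N..<n}"
        using bnd by (simp add: dist_norm)
      also have "\<dots> \<le> 2 * R * (\<tau>' * (1/2)^N)"
        using sum\<mu>_tail R0 by (intro mult_left_mono) auto
      finally show ?thesis using N by simp
    qed
    have "dist (b n) (b k) < r" if "n \<ge> N" "k \<ge> N" for n k
      using tail[OF that(1)] tail[OF that(2)] dist_triangle2[of "b n" "b k" "b N"] by linarith
    then show "\<exists>M. \<forall>m\<ge>M. \<forall>n\<ge>M. dist (b m) (b n) < r" by blast
  qed
  then obtain b' where b': "b \<longlonglongrightarrow> b'" using Cauchy_convergent_iff convergent_def by blast
  have "norm (b n) \<le> \<tau>" for n
  proof -
    have "norm (b n) \<le> 2 * R * sum \<mu> {..<n}" unfolding b_def by (rule bnd)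
    also have "\<dots> \<le> 2 * R * \<tau>'" using R0 \<tau>' unfolding sum\<mu> by (intro mult_left_mono) (auto simp: algebra_simps)
    finally show ?thesis using \<tau>' by simp
  qed
  then have nb': "norm b' \<le> \<tau>"
    by (intro LIMSEQ_le_const2[OF tendsto_norm[OF b']]) auto
  have ineq: "H v \<ge> H u + inner b' (v - u) - \<tau> * (norm (v - u))\<^sup>2" if v: "v \<in> D" for v
  proof -
    have "H u + inner (b (Suc n)) (v - u) - \<tau> * (norm (v - u))\<^sup>2 \<le> H v + e n" for n
    proof -
      \<comment> \<open>\<open>u\<close> lies in every sublevel set and \<open>s n\<close> is an
        \<open>e n\<close>-minimiser of \<open>G n\<close>, so \<open>u\<close> nearly minimises
        \<open>G (Suc n)\<close>.\<close>
      have 1: "G (Suc n) u \<le> G (Suc n) v + e n"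
        using uS[of n] near[OF v, of n] Gmono[of n v] unfolding S_def by simp
      have sq: "(norm (v - s i))\<^sup>2 = (norm (u - s i))\<^sup>2 + (norm (v - u))\<^sup>2 + 2 * inner (u - s i) (v - u)" for i
      proof -
        have "v - s i = (u - s i) + (v - u)" by simp
        then show ?thesis using dot_norm[of "u - s i" "v - u"] by simp
      qed
      have "(\<Sum>i<k. \<mu> i * (norm (v - s i))\<^sup>2)
          = (\<Sum>i<k. \<mu> i * (norm (u - s i))\<^sup>2) + sum \<mu> {..<k} * (norm (v - u))\<^sup>2 - inner (b k) (v - u)" for k
      proof (induction k)
        case (Suc k)
        have "b (Suc k) = b k + (-2 * \<mu> k) *\<^sub>R (u - s k)" unfolding b_def by simp
        then have "inner (b (Suc k)) (v - u) = inner (b k) (v - u) - 2 * \<mu> k * inner (u - s k) (v - u)"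
          by (simp only: inner_add_left inner_scaleR_left)
        then show ?case using Suc by (simp only: sum.lessThan_Suc sq[of k] distrib_left distrib_right)
      qed (simp add: b_def)
      from this[of "Suc n"] have "(\<Sum>i<Suc n. \<mu> i * (norm (v - s i))\<^sup>2)
          = (\<Sum>i<Suc n. \<mu> i * (norm (u - s i))\<^sup>2) + sum \<mu> {..<Suc n} * (norm (v - u))\<^sup>2 - inner (b (Suc n)) (v - u)" .
      moreover have "sum \<mu> {..<Suc n} * (norm (v - u))\<^sup>2 \<le> \<tau> * (norm (v - u))\<^sup>2"
      proof (rule mult_right_mono)
        have "\<tau>' * (1/2)^Suc n \<ge> 0" using \<tau>' by simp
        then show "sum \<mu> {..<Suc n} \<le> \<tau>" using \<tau>' unfolding sum\<mu> right_diff_distrib by linarith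
      qed simp
      ultimately show ?thesis using 1 unfolding Gsum by linarith
    qed
    moreover have "(\<lambda>n. H u + inner (b (Suc n)) (v - u) - \<tau> * (norm (v - u))\<^sup>2)
        \<longlonglongrightarrow> H u + inner b' (v - u) - \<tau> * (norm (v - u))\<^sup>2"
      by (intro tendsto_intros LIMSEQ_Suc[OF b'])
    moreover have "(\<lambda>n. H v + e n) \<longlonglongrightarrow> H v + (\<tau>' * 0) * (c * 0)"
    proof -
      have "e = (\<lambda>n. (\<tau>' * (1/2)^Suc n) * (c * (1 / real (Suc n))))" by (auto simp: e_def \<mu>_def)
      then show ?thesis
        by (simp only:) (intro tendsto_intros LIMSEQ_Suc[OF lim_1_over_n] LIMSEQ_Suc[OF LIMSEQ_power_zero], simp)
    qed
    ultimately show ?thesis using LIMSEQ_le[of _ _ "\<lambda>n. H v + e n" "H v"] by auto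
  qed
  have "H u \<le> H u0"
  proof -
    have "G (Suc 0) u \<le> H u0" using uS[of 0] G0 unfolding S_def by simp
    moreover have "H u \<le> G (Suc 0) u" using Gmono[of 0 u] G0 by simp
    ultimately show ?thesis by simp
  qed
  then show ?thesis using uD nb' ineq by blast
qed

section \<open>Ekeland's principle\<close>

text \<open>\<open>compl\<close> bundles completeness with lower semicontinuity: limits are demanded
  only for Cauchy sequences along which \<open>f\<close> decreases, and the limit must not increase
  \<open>f\<close>. The minimality conclusion is not strict, so distinct points at distance 0 do no
  harm.\<close>

lemma ekeland_pseudometric:
  fixes d :: "'a \<Rightarrow> 'a \<Rightarrow> real" and f :: "'a \<Rightarrow> real"
  assumes d0: "\<And>p. p \<in> X \<Longrightarrow> d p p = 0"
    and dpos: "\<And>p q. d p q \<ge> 0"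
    and dsym: "\<And>p q. d p q = d q p"
    and dtri: "\<And>p q r. p \<in> X \<Longrightarrow> q \<in> X \<Longrightarrow> r \<in> X \<Longrightarrow> d p r \<le> d p q + d q r"
    and compl: "\<And>s. (\<And>n. s n \<in> X) \<Longrightarrow> (\<And>e. e > 0 \<Longrightarrow> \<exists>N. \<forall>m\<ge>N. \<forall>n\<ge>N. d (s m) (s n) < e) \<Longrightarrow> decseq (\<lambda>n. f (s n)) \<Longrightarrow>
        \<exists>p\<in>X. (\<lambda>n. d (s n) p) \<longlonglongrightarrow> 0 \<and> (\<forall>n. f p \<le> f (s n))"
    and f0: "\<And>p. p \<in> X \<Longrightarrow> f p \<ge> 0"
    and x: "x \<in> X" and lam: "lam > 0"
  shows "\<exists>y\<in>X. f y + lam * d y x \<le> f x \<and> (\<forall>z\<in>X. f y \<le> f z + lam * d z y)"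
proof -
  \<comment> \<open>The lower sets of Ekeland's order; the triangle inequality makes the relation
    transitive.\<close>
  define S where "S p = {q \<in> X. f q + lam * d q p \<le> f p}" for p
  have Strans: "r \<in> S p" if "q \<in> S p" "r \<in> S q" "p \<in> X" for p q r
  proof -
    have "q \<in> X" "r \<in> X" using that unfolding S_def by auto
    then have "lam * d r p \<le> lam * (d r q + d q p)" using dtri[of r q p] lam that by simp
    then show ?thesis using that unfolding S_def by (simp add: algebra_simps)
  qed
  let ?Q = "\<lambda>n p q. q \<in> S p \<and> (\<forall>v\<in>S p. f q \<le> f v + 1 / real (Suc n))"
  have "\<exists>s. \<forall>n. (s n \<in> X \<and> (n = 0 \<longrightarrow> s n = x)) \<and> ?Q n (s n) (s (Suc n))"
  proof (rule dependent_nat_choice)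
    show "\<exists>y. y \<in> X \<and> ((0::nat) = 0 \<longrightarrow> y = x)" using x by blast
  next
    fix p and n :: nat assume p: "p \<in> X \<and> (n = 0 \<longrightarrow> p = x)"
    have "p \<in> S p" using p d0 unfolding S_def by simp
    then obtain w where "w \<in> S p" "\<forall>v\<in>S p. f w \<le> f v + 1 / real (Suc n)"
      using approx_minimizer[of p "S p" 0 f "1 / real (Suc n)"] f0 unfolding S_def by auto
    then show "\<exists>y. (y \<in> X \<and> (Suc n = 0 \<longrightarrow> y = x)) \<and> ?Q n p y" unfolding S_def by blast
  qed
  then obtain s where s: "\<forall>n. (s n \<in> X \<and> (n = 0 \<longrightarrow> s n = x)) \<and> ?Q n (s n) (s (Suc n))"
    by (rule exE)
  have sX: "s n \<in> X" and sS: "s (Suc n) \<in> S (s n)" for n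
    using spec[OF s, of n] by (simp_all only: simp_thms)
  have s0: "s 0 = x" using spec[OF s, of 0] by (simp only: simp_thms)
  have smin: "f (s (Suc n)) \<le> f v + 1 / real (Suc n)" if "v \<in> S (s n)" for n v
    using bspec[OF conjunct2[OF conjunct2[OF spec[OF s]]] that] .
  have smem: "s k \<in> S (s n)" if "n \<le> k" for n k
    using that
  proof (induction rule: dec_induct)
    case base then show ?case using sX d0 unfolding S_def by simp
  next
    case (step k) then show ?case using Strans sS sX by blast
  qed
  have dle: "lam * d (s k) (s n) \<le> f (s n) - f (s k)" if "n \<le> k" for n k
    using smem[OF that] unfolding S_def by simp
  have dec: "decseq (\<lambda>n. f (s n))"
  proof (rule decseq_SucI)
    fix n
    have "lam * d (s (Suc n)) (s n) \<ge> 0" using dpos lam by simp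
    then show "f (s (Suc n)) \<le> f (s n)" using dle[of n "Suc n"] by simp
  qed
  have "convergent (\<lambda>n. f (s n))"
    using decseq_convergent[OF dec, of 0] f0[OF sX] unfolding convergent_def by blast
  then have Cf: "Cauchy (\<lambda>n. f (s n))" by (rule convergent_Cauchy)
  have "\<exists>N. \<forall>m\<ge>N. \<forall>n\<ge>N. d (s m) (s n) < e" if e: "e > 0" for e
  proof -
    obtain N where N: "\<And>m n. m \<ge> N \<Longrightarrow> n \<ge> N \<Longrightarrow> dist (f (s m)) (f (s n)) < lam * e"
      using metric_CauchyD[OF Cf, of "lam * e"] lam e by auto
    have "d (s m) (s n) < e" if "m \<ge> N" "n \<ge> N" for m n
    proof -
      have "lam * d (s m) (s n) \<le> \<bar>f (s n) - f (s m)\<bar>"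
        using dle[of n m] dle[of m n] dsym[of "s m" "s n"] by (cases "n \<le> m") auto
      also have "\<dots> < lam * e" using N[OF that] by (simp add: dist_real_def abs_minus_commute)
      finally show ?thesis using lam by simp
    qed
    then show ?thesis by blast
  qed
  from compl[OF sX this dec] obtain y where y: "y \<in> X" "(\<lambda>n. d (s n) y) \<longlonglongrightarrow> 0" "\<And>n. f y \<le> f (s n)"
    by blast
  have yS: "y \<in> S (s n)" for n
  proof -

    have ev: "lam * d y (s n) + f y \<le> f (s n) + lam * d (s k) y" if "k \<ge> n" for k
    proof -
      have "lam * d y (s n) \<le> lam * (d y (s k) + d (s k) (s n))" using dtri y(1) sX lam by simp
      also have "\<dots> = lam * d (s k) y + lam * d (s k) (s n)" using dsym by (simp add: algebra_simps)
      finally show ?thesis using dle[OF that] y(3)[of k] by linarith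
    qed
    have "(\<lambda>k. f (s n) + lam * d (s k) y) \<longlonglongrightarrow> f (s n) + lam * 0" by (intro tendsto_intros y)
    then have "lam * d y (s n) + f y \<le> f (s n) + lam * 0"
      by (rule LIMSEQ_le_const) (use ev in blast)
    then show ?thesis using y(1) unfolding S_def by simp
  qed
  have "f y \<le> f z + lam * d z y" if z: "z \<in> X" for z
  proof (rule ccontr)
    assume neg: "\<not> f y \<le> f z + lam * d z y"
    then have "z \<in> S y" using z unfolding S_def by simp
    \<comment> \<open>\<open>z\<close> lies below every \<open>s n\<close>, so near-minimality of
      \<open>s (Suc n)\<close> on \<open>S (s n)\<close> gives \<open>f y \<le> f z\<close> in the
      limit, against \<open>neg\<close>.\<close>
    then have zS: "z \<in> S (s n)" for n using Strans yS sX by blast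
    have "f y \<le> f z + 1 / real (Suc n)" for n using smin[OF zS[of n]] y(3)[of "Suc n"] by linarith
    moreover have "(\<lambda>n. f z + 1 / real (Suc n)) \<longlonglongrightarrow> f z + 0"
      by (intro tendsto_intros LIMSEQ_Suc[OF lim_1_over_n])
    ultimately have "f y \<le> f z + 0" using LIMSEQ_le_const by blast
    moreover have "lam * d z y \<ge> 0" using dpos lam by simp
    ultimately show False using neg by simp
  qed
  moreover have "f y + lam * d y x \<le> f x" using yS[of 0] s0 unfolding S_def by simp
  ultimately show ?thesis using y(1) by blast
qed

section \<open>Second derivatives\<close>

lemma bounded_multilinear_1:
  assumes "bounded_multilinear (Suc 0) m"
  shows "bounded_linear (\<lambda>v. m [v])"
proof -
  obtain C where C: "\<And>vs. length vs = Suc 0 \<Longrightarrow> norm (m vs) \<le> C * prod_list (map norm vs)"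
    using assms unfolding bounded_multilinear_def by blast
  have "linear (\<lambda>w. m ([] @ w # []))"
    using assms unfolding bounded_multilinear_def by (metis add_0 list.size(3) One_nat_def)
  then show ?thesis
    by (intro bounded_linear.intro bounded_linear_axioms.intro exI[of _ C])
       (use C[of "[_]"] in \<open>auto simp: mult.commute\<close>)
qed

lemma bounded_multilinear_2:
  assumes "bounded_multilinear (Suc (Suc 0)) m"
  shows "bounded_linear (\<lambda>v. m [w, v])" "bounded_linear (\<lambda>w. Blinfun (\<lambda>v. m [w, v]))"
proof -
  obtain C0 where C0: "\<And>vs. length vs = Suc (Suc 0) \<Longrightarrow> norm (m vs) \<le> C0 * prod_list (map norm vs)"
    using assms unfolding bounded_multilinear_def by blast
  have C: "norm (m [w, v]) \<le> \<bar>C0\<bar> * norm w * norm v" for w v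
  proof -
    have "norm (m [w, v]) \<le> C0 * (norm w * norm v)" using C0[of "[w, v]"] by simp
    also have "\<dots> \<le> \<bar>C0\<bar> * (norm w * norm v)" by (intro mult_right_mono) auto
    finally show ?thesis by (simp add: mult.assoc)
  qed
  have lin: "linear (\<lambda>w. m (us @ w # vs))" if "length us + length vs = Suc 0" for us vs
    using assms that unfolding bounded_multilinear_def by simp
  have l2: "linear (\<lambda>v. m [w, v])" and l1: "linear (\<lambda>w. m [w, v])" for w v
    using lin[of "[w]" "[]"] lin[of "[]" "[v]"] by simp_all
  show 1: "bounded_linear (\<lambda>v. m [w, v])" for w
    by (intro bounded_linear.intro l2 bounded_linear_axioms.intro exI[of _ "\<bar>C0\<bar> * norm w"])
       (use C[of w] in \<open>simp add: mult_ac\<close>)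
  have ap: "blinfun_apply (Blinfun (\<lambda>v. m [w, v])) v = m [w, v]" for w v
    by (simp add: bounded_linear_Blinfun_apply[OF 1])
  show "bounded_linear (\<lambda>w. Blinfun (\<lambda>v. m [w, v]))"
  proof (rule bounded_linear_intro[where K = "\<bar>C0\<bar>"])
    show "Blinfun (\<lambda>v. m [x + y, v]) = Blinfun (\<lambda>v. m [x, v]) + Blinfun (\<lambda>v. m [y, v])" for x y
      by (rule blinfun_eqI) (unfold blinfun.add_left ap, rule linear_add[OF l1])
    show "Blinfun (\<lambda>v. m [r *\<^sub>R x, v]) = r *\<^sub>R Blinfun (\<lambda>v. m [x, v])" for r x
      by (rule blinfun_eqI) (unfold blinfun.scaleR_left ap, rule linear_scale[OF l1])
    show "norm (Blinfun (\<lambda>v. m [x, v])) \<le> norm x * \<bar>C0\<bar>" for x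
      by (rule norm_blinfun_bound) (use C[of x] in \<open>simp_all add: ap mult_ac\<close>)
  qed
qed

text \<open>Derivatives on argument lists become bounded linear operators. Everything later rests on
  these two orders; continuity of \<open>f2\<close> comes from the third derivative.\<close>

lemma smooth_on_imp_C2:
  fixes f :: "'a::real_normed_vector \<Rightarrow> 'b::real_normed_vector"
  assumes "smooth_on S f" "open S"
  obtains f1 :: "'a \<Rightarrow> 'a \<Rightarrow>\<^sub>L 'b" and f2 :: "'a \<Rightarrow> 'a \<Rightarrow>\<^sub>L 'a \<Rightarrow>\<^sub>L 'b"
  where "\<And>x. x \<in> S \<Longrightarrow> (f has_derivative f1 x) (at x)"
    and "\<And>x. x \<in> S \<Longrightarrow> (f1 has_derivative f2 x) (at x)"
    and "continuous_on S f2"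
proof -
  obtain D :: "nat \<Rightarrow> 'a \<Rightarrow> 'a list \<Rightarrow> 'b" where D0: "\<And>x. x \<in> S \<Longrightarrow> D 0 x [] = f x"
    and Dm: "\<And>k x. x \<in> S \<Longrightarrow> bounded_multilinear k (D k x)"
    and Dd: "\<And>k x e. x \<in> S \<Longrightarrow> e > 0 \<Longrightarrow> \<exists>d>0. \<forall>y\<in>S. norm (y - x) < d \<longrightarrow>
           (\<forall>vs. length vs = k \<longrightarrow>
              norm (D k y vs - D k x vs - D (Suc k) x ((y - x) # vs))
                \<le> e * norm (y - x) * prod_list (map norm vs))"
  proof -
    obtain D :: "nat \<Rightarrow> 'a \<Rightarrow> 'a list \<Rightarrow> 'b" where D: "(\<forall>x\<in>S. D 0 x [] = f x) \<and>
        (\<forall>k. \<forall>x\<in>S. bounded_multilinear k (D k x)) \<and>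
        (\<forall>k. \<forall>x\<in>S. \<forall>e>0. \<exists>d>0. \<forall>y\<in>S. norm (y - x) < d \<longrightarrow>
           (\<forall>vs. length vs = k \<longrightarrow>
              norm (D k y vs - D k x vs - D (Suc k) x ((y - x) # vs))
                \<le> e * norm (y - x) * prod_list (map norm vs)))"
      using assms(1) unfolding smooth_on_def by (rule exE)
    show thesis
      by (rule that[of D]) (simp_all only: D)
  qed
  have Ddk: "\<forall>\<^sub>F y in at x. y \<in> S \<and> (\<forall>vs. length vs = k \<longrightarrow>
              norm (D k y vs - D k x vs - D (Suc k) x ((y - x) # vs))
                \<le> e * norm (y - x) * prod_list (map norm vs))" if xS: "x \<in> S" and e: "e > 0" for k x and e :: real
  proof -
    obtain d where d: "d > 0" "\<forall>y\<in>S. norm (y - x) < d \<longrightarrow>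
           (\<forall>vs. length vs = k \<longrightarrow>
              norm (D k y vs - D k x vs - D (Suc k) x ((y - x) # vs))
                \<le> e * norm (y - x) * prod_list (map norm vs))" using Dd[OF xS e, of k] by blast
    have "\<forall>\<^sub>F y in at x. y \<in> S" using assms(2) xS by (rule eventually_at_in_open')
    moreover have "\<forall>\<^sub>F y in at x. norm (y - x) < d"
      using d(1) unfolding eventually_at dist_norm by blast
    ultimately show ?thesis by eventually_elim (use d(2) in blast)
  qed
  define f1 where "f1 x = Blinfun (\<lambda>v. D (Suc 0) x [v])" for x
  define f2 where "f2 x = Blinfun (\<lambda>w. Blinfun (\<lambda>v. D (Suc (Suc 0)) x [w, v]))" for x
  have f1: "blinfun_apply (f1 x) v = D (Suc 0) x [v]" if "x \<in> S" for x v
    unfolding f1_def using bounded_multilinear_1[OF Dm[OF that]] by (simp add: bounded_linear_Blinfun_apply)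
  have f2: "blinfun_apply (blinfun_apply (f2 x) w) v = D (Suc (Suc 0)) x [w, v]" if "x \<in> S" for x w v
    unfolding f2_def using bounded_multilinear_2[OF Dm[OF that]] by (simp add: bounded_linear_Blinfun_apply)
  have "(f has_derivative f1 x) (at x)" if x: "x \<in> S" for x
    unfolding has_derivative_within_alt2
  proof (intro conjI allI impI)
    fix e :: real assume "e > 0"
    from Ddk[OF x this, of 0] show "\<forall>\<^sub>F y in at x. norm (f y - f x - blinfun_apply (f1 x) (y - x)) \<le> e * norm (y - x)"
      by eventually_elim (use x D0 f1 in auto)
  qed (rule blinfun.bounded_linear_right)
  moreover have "(f1 has_derivative f2 x) (at x)" if x: "x \<in> S" for x
    unfolding has_derivative_within_alt2
  proof (intro conjI allI impI)
    fix e :: real assume e: "e > 0"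
    from Ddk[OF x this, of "Suc 0"] show "\<forall>\<^sub>F y in at x. norm (f1 y - f1 x - blinfun_apply (f2 x) (y - x)) \<le> e * norm (y - x)"
    proof eventually_elim
      case (elim y)
      show ?case
      proof (rule norm_blinfun_bound)
        fix v
        show "norm (blinfun_apply (f1 y - f1 x - blinfun_apply (f2 x) (y - x)) v) \<le> e * norm (y - x) * norm v"
          using conjunct2[OF elim, rule_format, of "[v]"] elim x by (simp add: blinfun.diff_left f1 f2)
      qed (use e in simp)
    qed
  qed (rule blinfun.bounded_linear_right)
  moreover have "continuous_on S f2"
    unfolding continuous_on_eq_continuous_at[OF assms(2)]
  proof
    fix x assume x: "x \<in> S"
    \<comment> \<open>Only the size of the third derivative matters: it yields a Lipschitz estimate
      of \<open>f2\<close> at \<open>x\<close>.\<close>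
    obtain C0 where C0': "\<And>vs. length vs = 3 \<Longrightarrow> norm (D 3 x vs) \<le> C0 * prod_list (map norm vs)"
      using Dm[OF x, of 3] unfolding bounded_multilinear_def by blast
    have C0: "norm (D 3 x [u, w, v]) \<le> C0 * (norm u * (norm w * norm v))" for u w v
      using C0'[of "[u, w, v]"] by simp
    have ev: "\<forall>\<^sub>F y in at x. norm (f2 y - f2 x) \<le> (1 + \<bar>C0\<bar>) * norm (y - x)"
      using Ddk[OF x zero_less_one, of "Suc (Suc 0)"]
    proof eventually_elim
      case (elim y)
      have b: "norm (blinfun_apply (blinfun_apply (f2 y - f2 x) w) v) \<le> (1 + \<bar>C0\<bar>) * norm (y - x) * norm w * norm v" for w v
      proof -
        have 1: "norm (D 2 y [w, v] - D 2 x [w, v] - D 3 x [y - x, w, v]) \<le> norm (y - x) * norm w * norm v"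
          using conjunct2[OF elim, rule_format, of "[w, v]"] by (simp add: numeral_2_eq_2 numeral_3_eq_3 mult.assoc)
        have "C0 * (norm (y - x) * (norm w * norm v)) \<le> \<bar>C0\<bar> * (norm (y - x) * (norm w * norm v))"
          by (intro mult_right_mono) auto
        then have 2: "norm (D 3 x [y - x, w, v]) \<le> \<bar>C0\<bar> * (norm (y - x) * (norm w * norm v))"
          using C0[of "y - x" w v] by linarith
        have "D 2 y [w, v] - D 2 x [w, v] = (D 2 y [w, v] - D 2 x [w, v] - D 3 x [y - x, w, v]) + D 3 x [y - x, w, v]"
          by simp
        then have "norm (D 2 y [w, v] - D 2 x [w, v]) \<le> norm (D 2 y [w, v] - D 2 x [w, v] - D 3 x [y - x, w, v]) + norm (D 3 x [y - x, w, v])"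
          by (metis norm_triangle_ineq)
        also have "\<dots> \<le> norm (y - x) * norm w * norm v + \<bar>C0\<bar> * (norm (y - x) * (norm w * norm v))"
          using 1 2 by linarith
        finally show ?thesis using elim x by (simp add: f2 blinfun.diff_left numeral_2_eq_2 algebra_simps)
      qed
      show ?case
        by (rule norm_blinfun_bound, simp, rule norm_blinfun_bound, simp, rule b)
    qed
    have "((\<lambda>y. (1 + \<bar>C0\<bar>) * norm (y - x)) \<longlongrightarrow> (1 + \<bar>C0\<bar>) * norm (x - x)) (at x)"
      by (intro tendsto_intros)
    then have "((\<lambda>y. f2 y - f2 x) \<longlongrightarrow> 0) (at x)"
      by (intro Lim_null_comparison[OF ev]) simp
    then show "isCont f2 x" unfolding isCont_def by (simp add: LIM_zero_iff)
  qed
  ultimately show thesis by (rule that)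
qed

text \<open>As a function of \<open>s\<close>, the difference of \<open>f\<close> at
  \<open>x + s u + t v\<close> and at \<open>x + s u\<close> has a derivative close to
  \<open>t *\<^sub>R f2 v u\<close>, because both values of \<open>f1\<close> are compared with its
  linearisation at \<open>x\<close>. The mean value inequality does the rest.\<close>

lemma second_difference:
  fixes f :: "'a::real_normed_vector \<Rightarrow> 'b::real_normed_vector"
  assumes S: "open S" "x \<in> S"
    and f1: "\<And>x. x \<in> S \<Longrightarrow> (f has_derivative blinfun_apply (f1 x)) (at x)"
    and f2: "(f1 has_derivative f2) (at x)" and e: "e > 0"
  shows "\<exists>d>0. \<forall>t. 0 < t \<and> t < d \<longrightarrow>
     norm (f (x + t *\<^sub>R u + t *\<^sub>R v) - f (x + t *\<^sub>R u) - f (x + t *\<^sub>R v) + f x - t\<^sup>2 *\<^sub>R blinfun_apply (f2 v) u) \<le> e * t\<^sup>2"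
proof -
  interpret f2: bounded_linear f2 using f2 by (rule has_derivative_bounded_linear)
  \<comment> \<open>Normalised so that the derivative bound \<open>B\<close> below satisfies
    \<open>B * t \<le> e * t\<^sup>2\<close>.\<close>
  define N where "N = 2 * (norm u + norm v + 1) * (norm u + 1)"
  have N: "N > 0" unfolding N_def by (intro mult_pos_pos) (auto intro: add_nonneg_pos)
  have "e / N > 0" using e N by simp
  from f2 this obtain d0 where d0: "d0 > 0" "\<And>y. norm (y - x) < d0 \<Longrightarrow> norm (f1 y - f1 x - f2 (y - x)) \<le> e / N * norm (y - x)"
    unfolding has_derivative_at_alt by blast
  obtain r where r: "r > 0" "ball x r \<subseteq> S" using S open_contains_ball by blast
  define d where "d = min d0 r / (norm u + norm v + 1)"
  have pos: "norm u + norm v + 1 > 0" by (simp add: add_nonneg_pos)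
  have d: "d > 0" unfolding d_def using d0 r pos by simp
  have "norm (f (x + t *\<^sub>R u + t *\<^sub>R v) - f (x + t *\<^sub>R u) - f (x + t *\<^sub>R v) + f x - t\<^sup>2 *\<^sub>R blinfun_apply (f2 v) u) \<le> e * t\<^sup>2"
    if t: "0 < t" "t < d" for t
  proof -
    let ?M = "norm u + norm v + 1"
    have tM: "t * ?M < min d0 r" using t pos unfolding d_def by (simp add: field_simps)
    have near: "norm (s *\<^sub>R u + q *\<^sub>R v) \<le> t * ?M" if "0 \<le> s" "s \<le> t" "0 \<le> q" "q \<le> t" for s q
    proof -
      have "norm (s *\<^sub>R u + q *\<^sub>R v) \<le> s * norm u + q * norm v"
        using norm_triangle_ineq[of "s *\<^sub>R u" "q *\<^sub>R v"] that by simp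
      also have "\<dots> \<le> t * norm u + t * norm v" using that by (intro add_mono mult_right_mono) auto
      finally show ?thesis using t by (simp add: algebra_simps)
    qed
    have inS: "x + s *\<^sub>R u + q *\<^sub>R v \<in> S" if "0 \<le> s" "s \<le> t" "0 \<le> q" "q \<le> t" for s q
    proof -
      have "dist x (x + s *\<^sub>R u + q *\<^sub>R v) = norm (s *\<^sub>R u + q *\<^sub>R v)"
        unfolding dist_norm by (subst norm_minus_commute) (simp add: add.assoc)
      then show ?thesis using near[OF that] tM r by (auto simp: subset_iff)
    qed
    have est: "norm (f1 (x + s *\<^sub>R u + q *\<^sub>R v) - f1 x - f2 (s *\<^sub>R u + q *\<^sub>R v)) \<le> e / N * (t * ?M)"
      if "0 \<le> s" "s \<le> t" "0 \<le> q" "q \<le> t" for s q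
    proof -
      have eq: "x + s *\<^sub>R u + q *\<^sub>R v - x = s *\<^sub>R u + q *\<^sub>R v" by simp
      have "norm (f1 (x + s *\<^sub>R u + q *\<^sub>R v) - f1 x - f2 (s *\<^sub>R u + q *\<^sub>R v)) \<le> e / N * norm (s *\<^sub>R u + q *\<^sub>R v)"
        using d0(2)[of "x + s *\<^sub>R u + q *\<^sub>R v"] near[OF that] tM unfolding eq by simp
      also have "\<dots> \<le> e / N * (t * ?M)" using near[OF that] e N by (intro mult_left_mono) auto
      finally show ?thesis .
    qed
    define h where "h s = f (x + s *\<^sub>R u + t *\<^sub>R v) - f (x + s *\<^sub>R u) - s *\<^sub>R (t *\<^sub>R blinfun_apply (f2 v) u)" for s
    define h' where "h' s = blinfun_apply (f1 (x + s *\<^sub>R u + t *\<^sub>R v)) u - blinfun_apply (f1 (x + s *\<^sub>R u)) u - t *\<^sub>R blinfun_apply (f2 v) u" for s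
    have dh: "(h has_vector_derivative h' s) (at s)" if "0 \<le> s" "s \<le> t" for s
    proof -
      have "((\<lambda>s. f (x + s *\<^sub>R u + t *\<^sub>R v)) has_derivative (\<lambda>z. blinfun_apply (f1 (x + s *\<^sub>R u + t *\<^sub>R v)) (z *\<^sub>R u))) (at s)"
        by (rule has_derivative_compose[of "\<lambda>s. x + s *\<^sub>R u + t *\<^sub>R v", OF _ f1])
           (use that t inS in \<open>auto intro!: derivative_eq_intros\<close>)
      moreover have "((\<lambda>s. f (x + s *\<^sub>R u)) has_derivative (\<lambda>z. blinfun_apply (f1 (x + s *\<^sub>R u)) (z *\<^sub>R u))) (at s)"
        by (rule has_derivative_compose[of "\<lambda>s. x + s *\<^sub>R u", OF _ f1])
           (use that t inS[of s 0] in \<open>auto intro!: derivative_eq_intros\<close>)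
      ultimately show ?thesis unfolding h_def h'_def has_vector_derivative_def
        by (auto intro!: derivative_eq_intros simp: blinfun.scaleR_right algebra_simps)
    qed
    define B where "B = 2 * (e / N * (t * ?M)) * norm u"
    have bd: "norm (h' s) \<le> B" if s: "0 \<le> s" "s \<le> t" for s
    proof -
      let ?a = "f1 (x + s *\<^sub>R u + t *\<^sub>R v) - f1 x - f2 (s *\<^sub>R u + t *\<^sub>R v)"
      let ?b = "f1 (x + s *\<^sub>R u) - f1 x - f2 (s *\<^sub>R u)"
      have "h' s = blinfun_apply (?a - ?b) u"
        unfolding h'_def by (simp add: blinfun.diff_left f2.add f2.scaleR blinfun.add_left blinfun.scaleR_left)
      then have "norm (h' s) \<le> norm (?a - ?b) * norm u" using norm_blinfun by metis
      also have "\<dots> \<le> (2 * (e / N * (t * ?M))) * norm u"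
      proof (rule mult_right_mono)
        have "norm ?a \<le> e / N * (t * ?M)" using est[of s t] s t by linarith
        moreover have "norm ?b \<le> e / N * (t * ?M)" using est[of s 0] s t by simp
        ultimately show "norm (?a - ?b) \<le> 2 * (e / N * (t * ?M))"
          unfolding mult_2 by (rule order_trans[OF norm_triangle_ineq4 add_mono])
      qed simp
      finally show ?thesis unfolding B_def .
    qed
    have "norm (h t - h 0) \<le> B * t - B * 0"
    proof (rule differentiable_bound_general[OF t(1), where f = h and \<phi> = "\<lambda>s. B * s" and f' = h' and \<phi>' = "\<lambda>_. B"])
      show "continuous_on {0..t} h"
        by (intro continuous_at_imp_continuous_on ballI) (use dh has_vector_derivative_continuous in force)
      show "((\<lambda>s. B * s) has_vector_derivative B) (at s)" for s
        by (auto intro!: derivative_eq_intros simp: has_vector_derivative_def)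
    qed (use dh bd in \<open>auto intro!: continuous_intros\<close>)
    moreover have "h t - h 0 = f (x + t *\<^sub>R u + t *\<^sub>R v) - f (x + t *\<^sub>R u) - f (x + t *\<^sub>R v) + f x - t\<^sup>2 *\<^sub>R blinfun_apply (f2 v) u"
      unfolding h_def by (simp add: power2_eq_square)
    moreover have "B * t \<le> e * t\<^sup>2"
    proof -
      have "2 * ?M * norm u \<le> N" unfolding N_def using pos by (intro mult_left_mono) auto
      then have "e * t\<^sup>2 * (2 * ?M * norm u) / N \<le> e * t\<^sup>2 * N / N"
        using e N by (intro divide_right_mono mult_left_mono) auto
      moreover have "B * t = e * t\<^sup>2 * (2 * ?M * norm u) / N" unfolding B_def by (simp add: power2_eq_square)
      ultimately show ?thesis using N by simp
    qed
    ultimately show ?thesis by simp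
  qed
  then show ?thesis using d by blast
qed

text \<open>The second difference is symmetric in \<open>u\<close> and \<open>v\<close>, and both
  mixed derivatives are its limit after division by \<open>t\<^sup>2\<close>.\<close>

lemma second_derivative_symmetric:
  fixes f :: "'a::real_normed_vector \<Rightarrow> 'b::real_normed_vector"
  assumes S: "open S" "x \<in> S"
    and f1: "\<And>x. x \<in> S \<Longrightarrow> (f has_derivative blinfun_apply (f1 x)) (at x)"
    and f2: "(f1 has_derivative f2) (at x)"
  shows "blinfun_apply (f2 u) v = blinfun_apply (f2 v) u"
proof -
  have "norm (blinfun_apply (f2 u) v - blinfun_apply (f2 v) u) \<le> 0 + e" if e: "e > 0" for e
  proof -
    have e2: "e / 2 > 0" using e by simp
    from second_difference[OF S f1 f2 e2, of u v] second_difference[OF S f1 f2 e2, of v u]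
    obtain d d' where d: "d > 0" "d' > 0"
      and 1: "\<And>t. 0 < t \<and> t < d \<Longrightarrow> norm (f (x + t *\<^sub>R u + t *\<^sub>R v) - f (x + t *\<^sub>R u) - f (x + t *\<^sub>R v) + f x - t\<^sup>2 *\<^sub>R blinfun_apply (f2 v) u) \<le> e / 2 * t\<^sup>2"
      and 2: "\<And>t. 0 < t \<and> t < d' \<Longrightarrow> norm (f (x + t *\<^sub>R v + t *\<^sub>R u) - f (x + t *\<^sub>R v) - f (x + t *\<^sub>R u) + f x - t\<^sup>2 *\<^sub>R blinfun_apply (f2 u) v) \<le> e / 2 * t\<^sup>2"
      by blast
    define t where "t = min d d' / 2"
    have t: "0 < t" "t < d" "t < d'" using d unfolding t_def by auto
    let ?\<Delta> = "f (x + t *\<^sub>R u + t *\<^sub>R v) - f (x + t *\<^sub>R u) - f (x + t *\<^sub>R v) + f x"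
    have sw: "f (x + t *\<^sub>R v + t *\<^sub>R u) - f (x + t *\<^sub>R v) - f (x + t *\<^sub>R u) + f x = ?\<Delta>" by (simp add: algebra_simps)
    have "t\<^sup>2 * norm (blinfun_apply (f2 u) v - blinfun_apply (f2 v) u) = norm ((?\<Delta> - t\<^sup>2 *\<^sub>R blinfun_apply (f2 v) u) - (?\<Delta> - t\<^sup>2 *\<^sub>R blinfun_apply (f2 u) v))"
      by (simp flip: scaleR_diff_right)
    also have "\<dots> \<le> t\<^sup>2 * e"
      using norm_triangle_ineq4[of "?\<Delta> - t\<^sup>2 *\<^sub>R blinfun_apply (f2 v) u" "?\<Delta> - t\<^sup>2 *\<^sub>R blinfun_apply (f2 u) v"] 1[of t] 2[of t, unfolded sw] t
      by (simp add: mult.commute)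
    finally show ?thesis using t by simp
  qed
  then have "norm (blinfun_apply (f2 u) v - blinfun_apply (f2 v) u) \<le> 0" by (rule field_le_epsilon)
  then show ?thesis by simp
qed

section \<open>Local Lipschitz and Taylor estimates\<close>

text \<open>Continuity bounds \<open>f1\<close> by \<open>norm (f1 x) + 1\<close> near
  \<open>x\<close>, and a ball is convex. Applied one order higher it makes first derivatives
  Lipschitz.\<close>

lemma C1_imp_locally_lipschitz:
  fixes f :: "'a::real_normed_vector \<Rightarrow> 'b::real_normed_vector"
  assumes S: "open S" "x \<in> S"
    and f1: "\<And>x. x \<in> S \<Longrightarrow> (f has_derivative blinfun_apply (f1 x)) (at x)"
    and cont: "continuous_on S f1"
  shows "\<exists>r>0. \<exists>K\<ge>0. ball x r \<subseteq> S \<and> (\<forall>y\<in>ball x r. \<forall>z\<in>ball x r. norm (f y - f z) \<le> K * norm (y - z))"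
proof -
  have "isCont f1 x" using cont S by (simp add: continuous_on_eq_continuous_at)
  then obtain d where d: "d > 0" "\<And>y. dist y x < d \<Longrightarrow> dist (f1 y) (f1 x) < 1"
    unfolding continuous_at_eps_delta by (metis zero_less_one)
  obtain r where r: "r > 0" "ball x r \<subseteq> S" using S open_contains_ball by blast
  define r' where "r' = min d r"
  have "norm (f y - f z) \<le> (norm (f1 x) + 1) * norm (y - z)" if "y \<in> ball x r'" "z \<in> ball x r'" for y z
  proof (rule differentiable_bound[OF convex_ball _ _ that])
    fix w assume w: "w \<in> ball x r'"
    show "(f has_derivative blinfun_apply (f1 w)) (at w within ball x r')"
    proof (rule has_derivative_at_withinI[OF f1])
      show "w \<in> S" using w r unfolding r'_def by (auto simp: subset_iff)
    qed
    have "dist (f1 w) (f1 x) < 1" using w d unfolding r'_def by (simp add: dist_commute)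
    then have "norm (f1 w) \<le> norm (f1 x) + 1"
      using norm_triangle_sub[of "f1 w" "f1 x"] by (simp add: dist_norm)
    then show "onorm (blinfun_apply (f1 w)) \<le> norm (f1 x) + 1" by (simp add: norm_blinfun.rep_eq)
  qed
  moreover have "r' > 0" "ball x r' \<subseteq> S" using d r unfolding r'_def by auto
  ultimately show ?thesis by (intro exI[of _ r'] conjI exI[of _ "norm (f1 x) + 1"]) auto
qed

text \<open>Along the segment the derivative deviates from \<open>f1 x\<close> by at most
  \<open>K * norm (y - x)\<close>. A quadratic remainder is what a proximal inequality can
  absorb.\<close>

lemma C2_taylor:
  fixes f :: "'a::real_normed_vector \<Rightarrow> 'b::real_normed_vector"
  assumes S: "open S" "x \<in> S"
    and f1: "\<And>x. x \<in> S \<Longrightarrow> (f has_derivative blinfun_apply (f1 x)) (at x)"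
    and f2: "\<And>x. x \<in> S \<Longrightarrow> (f1 has_derivative blinfun_apply (f2 x)) (at x)"
    and cont: "continuous_on S f2"
  shows "\<exists>r>0. \<exists>K\<ge>0. ball x r \<subseteq> S \<and> (\<forall>y\<in>ball x r. norm (f y - f x - blinfun_apply (f1 x) (y - x)) \<le> K * (norm (y - x))\<^sup>2)"
proof -
  obtain r K where r: "r > 0" "K \<ge> 0" "ball x r \<subseteq> S"
    and K: "\<forall>y\<in>ball x r. \<forall>z\<in>ball x r. norm (f1 y - f1 z) \<le> K * norm (y - z)"
    using C1_imp_locally_lipschitz[OF S f2 cont] by blast
  have "norm (f y - f x - blinfun_apply (f1 x) (y - x)) \<le> K * (norm (y - x))\<^sup>2" if y: "y \<in> ball x r" for y
  proof -
    let ?C = "closed_segment x y"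
    have C: "?C \<subseteq> ball x r" using y r by (intro closed_segment_subset) auto
    have "norm (f y - f x - blinfun_apply (f1 x) (y - x)) \<le> norm (y - x) * (K * norm (y - x))"
    proof (rule differentiable_bound_linearization)
      show "x + t *\<^sub>R (y - x) \<in> ?C" if "t \<in> {0..1}" for t
        using that unfolding closed_segment_def by (auto intro!: exI[of _ t] simp: algebra_simps)
      show "(f has_derivative blinfun_apply (f1 z)) (at z within ?C)" if "z \<in> ?C" for z
        using that C r f1 by (auto intro: has_derivative_at_withinI)
      show "onorm (blinfun_apply (f1 z) - blinfun_apply (f1 x)) \<le> K * norm (y - x)" if z: "z \<in> ?C" for z
      proof -
        have "norm (f1 z - f1 x) \<le> K * norm (z - x)" using K z C r by auto
        also have "\<dots> \<le> K * norm (y - x)"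
          using segment_bound1[OF z] r by (intro mult_left_mono) (auto simp: norm_minus_commute)
        finally show ?thesis by (simp add: norm_blinfun.rep_eq minus_blinfun.rep_eq fun_diff_def)
      qed
    qed simp
    then show ?thesis by (simp add: power2_eq_square mult_ac)
  qed
  then show ?thesis using r by blast
qed

section \<open>Second-order differential equations\<close>

text \<open>The estimates satisfied by a quadratic form in \<open>w\<close> whose coefficients are
  bounded and Lipschitz in \<open>x\<close>. In this form they can be checked for Christoffel
  symbols that are known only through the Koszul formula.\<close>

definition quadratic_lipschitz :: "real \<Rightarrow> 'a set \<Rightarrow> ('a::real_normed_vector \<Rightarrow> 'a \<Rightarrow> 'a) \<Rightarrow> bool" where
  "quadratic_lipschitz C U Q \<longleftrightarrow> 0 \<le> C \<and>
     (\<forall>x\<in>U. \<forall>w. norm (Q x w) \<le> C * (norm w)\<^sup>2) \<and>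
     (\<forall>x\<in>U. \<forall>x'\<in>U. \<forall>w w'. norm (Q x w - Q x' w')
        \<le> C * ((norm w + norm w') * norm (w - w') + (norm w)\<^sup>2 * norm (x - x')))"

lemma quadratic_lipschitz_continuous_on:
  assumes Q: "quadratic_lipschitz C U Q"
    and "continuous_on S x" "continuous_on S w" "x ` S \<subseteq> U"
  shows "continuous_on S (\<lambda>s. Q (x s) (w s))"
  unfolding continuous_on_def
proof
  fix s0 assume s0: "s0 \<in> S"
  have lim: "(x \<longlongrightarrow> x s0) (at s0 within S)" "(w \<longlongrightarrow> w s0) (at s0 within S)"
    using assms(2,3) s0 unfolding continuous_on_def by auto
  let ?R = "\<lambda>s. C * ((norm (w s) + norm (w s0)) * norm (w s - w s0) + (norm (w s))\<^sup>2 * norm (x s - x s0))"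
  have "(?R \<longlongrightarrow> C * ((norm (w s0) + norm (w s0)) * norm (w s0 - w s0) + (norm (w s0))\<^sup>2 * norm (x s0 - x s0))) (at s0 within S)"
    by (intro tendsto_intros lim)
  then have "(?R \<longlongrightarrow> 0) (at s0 within S)" by simp
  moreover have "\<forall>\<^sub>F s in at s0 within S. norm (Q (x s) (w s) - Q (x s0) (w s0)) \<le> ?R s"
    unfolding eventually_at_filter
    by (rule always_eventually) (use Q assms(4) s0 in \<open>auto simp: quadratic_lipschitz_def image_subset_iff\<close>)
  ultimately have "((\<lambda>s. Q (x s) (w s) - Q (x s0) (w s0)) \<longlongrightarrow> 0) (at s0 within S)"
    by (rule Lim_null_comparison[rotated])
  then show "((\<lambda>s. Q (x s) (w s)) \<longlongrightarrow> Q (x s0) (w s0)) (at s0 within S)"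
    by (simp add: LIM_zero_iff)
qed

text \<open>Picard iteration for the velocity alone, the position being its integral. The unit time
  interval is kept and the initial velocity is made small instead; quadratic growth of
  \<open>Q\<close> makes this as good as a short time.\<close>

lemma second_order_ode_banach:
  fixes Q :: "'a::banach \<Rightarrow> 'a \<Rightarrow> 'a"
  assumes Q: "quadratic_lipschitz C (ball u0 r) Q" and r: "r > 0"
  shows "\<exists>\<rho>>0. \<forall>v. norm v < \<rho> \<longrightarrow> (\<exists>x w. x 0 = u0 \<and> w 0 = v \<and>
    (\<forall>t\<in>{0..1::real}. x t \<in> ball u0 r \<and> norm (w t) \<le> 2 * norm v \<and>
       (x has_vector_derivative w t) (at t within {0..1}) \<and>
       (w has_vector_derivative Q (x t) (w t)) (at t within {0..1})))"
proof -
  have C: "C \<ge> 0" using Q unfolding quadratic_lipschitz_def by simp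
  \<comment> \<open>The bounds give, in turn, \<open>norm v * norm v \<le> norm v\<close>; positions
    inside the ball, as the speed is at most \<open>2 * norm v\<close>; and invariance of
    \<open>X\<close> together with the contraction factor 1/2.\<close>
  define \<rho> where "\<rho> = min 1 (min (r / 2) (1 / (16 * (C + 1))))"
  have "\<rho> > 0" unfolding \<rho>_def using r C by simp
  moreover have "\<exists>x w. x 0 = u0 \<and> w 0 = v \<and>
    (\<forall>t\<in>{0..1::real}. x t \<in> ball u0 r \<and> norm (w t) \<le> 2 * norm v \<and>
       (x has_vector_derivative w t) (at t within {0..1}) \<and>
       (w has_vector_derivative Q (x t) (w t)) (at t within {0..1}))" if v: "norm v < \<rho>" for v
  proof -
    let ?n = "norm v"
    have n: "?n \<le> 1" "2 * ?n < r" "16 * (C + 1) * ?n \<le> 1"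
      using v C unfolding \<rho>_def by (auto simp: field_simps)
    have nn: "?n * ?n \<le> ?n" using n(1) by (simp add: mult_left_le)
    have Cn: "16 * (C * ?n) \<le> 1"
    proof -
      have "16 * (C + 1) * ?n = 16 * (C * ?n) + 16 * ?n" by (simp add: algebra_simps)
      then show ?thesis using n(3) norm_ge_zero[of v] by linarith
    qed
    have Cnn: "C * (?n * ?n) \<le> C * ?n" using nn C by (rule mult_left_mono)
    define X where "X = (PiC UNIV (\<lambda>_. cball v ?n) :: (real \<Rightarrow>\<^sub>C 'a) set)"
    have X: "w \<in> X \<longleftrightarrow> (\<forall>t. norm (apply_bcontfun w t - v) \<le> ?n)" for w
      unfolding X_def mem_PiC_iff by (auto simp: dist_norm norm_minus_commute)
    have "closed X" unfolding X_def by (rule closed_PiC) simp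
    then have "complete X" by (simp add: complete_eq_closed)
    have "const_bcontfun v \<in> X" by (simp add: X)
    then have "X \<noteq> {}" by blast
    have wb: "norm (apply_bcontfun w t) \<le> 2 * ?n" if "w \<in> X" for w t
    proof -
      have "norm (apply_bcontfun w t - v) \<le> ?n" using that unfolding X by blast
      then show ?thesis using norm_triangle_sub[of "apply_bcontfun w t" v] by linarith
    qed
    define pos where "pos w t = u0 + integral {0..t} (apply_bcontfun w)" for w and t :: real
    have intw: "apply_bcontfun w integrable_on {a..b}" for w :: "real \<Rightarrow>\<^sub>C 'a" and a b
      by (intro integrable_continuous_real) auto
    have posd: "(pos w has_vector_derivative apply_bcontfun w t) (at t within {0..1})" if "t \<in> {0..1}" for w t
      unfolding pos_def by (auto intro!: derivative_eq_intros integral_has_vector_derivative that)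
    have posc: "continuous_on {0..1} (pos w)" for w
      by (rule continuous_on_vector_derivative[OF posd])
    have posb: "pos w t \<in> ball u0 r" if "w \<in> X" "t \<in> {0..1}" for w t
    proof -
      have "norm (integral {0..t} (apply_bcontfun w)) \<le> 2 * ?n * (t - 0)"
        by (rule integral_bound) (use that wb in auto)
      also have "\<dots> \<le> 2 * ?n * 1" using that by (intro mult_left_mono) auto
      finally show ?thesis unfolding pos_def using n by (simp add: dist_norm)
    qed
    define g where "g w s = Q (pos w s) (apply_bcontfun w s)" for w s
    have gc: "continuous_on {0..1} (g w)" if "w \<in> X" for w
      unfolding g_def
      by (rule quadratic_lipschitz_continuous_on[OF Q posc]) (use posb that in auto)
    have gc': "continuous_on {0..t} (g w)" if "w \<in> X" "t \<le> 1" for w t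
      by (rule continuous_on_subset[OF gc]) (use that in auto)
    have gb: "norm (g w s) \<le> 4 * C * (?n * ?n)" if "w \<in> X" "s \<in> {0..1}" for w s
    proof -
      have "norm (g w s) \<le> C * (norm (apply_bcontfun w s))\<^sup>2"
        using Q posb[OF that] unfolding quadratic_lipschitz_def g_def by blast
      also have "\<dots> \<le> C * (2 * ?n)\<^sup>2" using wb[OF that(1)] C by (intro mult_left_mono power_mono) auto
      finally show ?thesis by (simp add: power2_eq_square)
    qed
    \<comment> \<open>Clamping time to the unit interval turns the iterates into bounded continuous
      functions on the whole line, which form a complete metric space.\<close>
    define cl where "cl t = max 0 (min 1 t)" for t :: real
    have cl: "0 \<le> cl t" "cl t \<le> 1" for t unfolding cl_def by auto
    define P where "P w = Bcontfun (\<lambda>t. v + integral {0..cl t} (g w))" for w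
    have cl01: "s \<in> {0..1}" if "s \<in> {0..cl t}" for s t using that cl(2)[of t] by auto
    have ib: "norm (integral {0..cl t} (g w)) \<le> ?n" if "w \<in> X" for w t
    proof -
      have "norm (integral {0..cl t} (g w)) \<le> 4 * C * (?n * ?n) * (cl t - 0)"
        by (rule integral_bound[OF cl(1) gc'[OF that cl(2)] gb[OF that cl01]])
      also have "\<dots> \<le> 4 * C * (?n * ?n) * 1" using cl C by (intro mult_left_mono) auto
      also have "\<dots> \<le> ?n"
      proof -
        have "4 * C * (?n * ?n) = (4 * (C * ?n)) * ?n" by simp
        also have "\<dots> \<le> 1 * ?n" using Cn C by (intro mult_right_mono) auto
        finally show ?thesis by simp
      qed
      finally show ?thesis .
    qed
    have P: "apply_bcontfun (P w) t = v + integral {0..cl t} (g w)" if w: "w \<in> X" for w t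
    proof -
      have "continuous_on UNIV cl" unfolding cl_def by (intro continuous_intros)
      moreover have "continuous_on {0..1} (\<lambda>t. integral {0..t} (g w))"
        by (intro indefinite_integral_continuous_1 integrable_continuous_real gc w)
      ultimately have "continuous_on UNIV ((\<lambda>t. integral {0..t} (g w)) \<circ> cl)"
        by (intro continuous_on_compose) (auto intro: continuous_on_subset simp: cl)
      then have "continuous_on UNIV (\<lambda>t. v + integral {0..cl t} (g w))"
        by (auto intro!: continuous_intros simp: o_def)
      moreover have "norm (v + integral {0..cl t} (g w)) \<le> ?n + ?n" for t
        using norm_triangle_ineq[of v "integral {0..cl t} (g w)"] ib[OF w, of t] by linarith
      ultimately have "(\<lambda>t. v + integral {0..cl t} (g w)) \<in> bcontfun" by (rule bcontfun_normI)
      then show ?thesis unfolding P_def by (simp add: Bcontfun_inverse)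
    qed
    have PX: "P ` X \<subseteq> X"
    proof
      fix z assume "z \<in> P ` X"
      then obtain w where w: "w \<in> X" "z = P w" by blast
      show "z \<in> X" unfolding X w(2) using P[OF w(1)] ib[OF w(1)] by simp
    qed
    have contr: "dist (P w) (P w') \<le> 1/2 * dist w w'" if w: "w \<in> X" "w' \<in> X" for w w'
    proof (rule dist_bound)
      fix t
      let ?D = "dist w w'"
      have D: "norm (apply_bcontfun w s - apply_bcontfun w' s) \<le> ?D" for s
        using dist_bounded[of w s w'] by (simp add: dist_norm)
      \<comment> \<open>Within unit time positions differ by no more than velocities do, so both
        terms of the Lipschitz estimate are small multiples of \<open>?D\<close>.\<close>
      have gd: "norm (g w s - g w' s) \<le> 1/2 * ?D" if s: "s \<in> {0..1}" for s
      proof -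
        have "pos w s - pos w' s = integral {0..s} (\<lambda>t. apply_bcontfun w t - apply_bcontfun w' t)"
          unfolding pos_def by (simp add: integral_diff intw)
        also have "norm \<dots> \<le> ?D * (s - 0)"
          by (rule integral_bound) (use s D in \<open>auto intro!: continuous_intros\<close>)
        also have "\<dots> \<le> ?D * 1" using s by (intro mult_left_mono) auto
        finally have pd: "norm (pos w s - pos w' s) \<le> ?D" by simp
        have "norm (g w s - g w' s) \<le> C * ((norm (w s) + norm (w' s)) * norm (w s - w' s) + (norm (w s))\<^sup>2 * norm (pos w s - pos w' s))"
          using Q posb[OF w(1) s] posb[OF w(2) s] unfolding quadratic_lipschitz_def g_def by blast
        also have "\<dots> \<le> C * ((2 * ?n + 2 * ?n) * ?D + (2 * ?n)\<^sup>2 * ?D)"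
          using wb[OF w(1), of s] wb[OF w(2), of s] pd D C
          by (intro mult_left_mono add_mono mult_mono power_mono) auto
        also have "\<dots> = (4 * (C * ?n) + 4 * (C * (?n * ?n))) * ?D" by (simp add: power2_eq_square algebra_simps)
        also have "\<dots> \<le> 1/2 * ?D" using Cn Cnn by (intro mult_right_mono) auto
        finally show ?thesis .
      qed
      have "dist (apply_bcontfun (P w) t) (apply_bcontfun (P w') t) = norm (integral {0..cl t} (\<lambda>s. g w s - g w' s))"
        unfolding dist_norm P[OF w(1)] P[OF w(2)]
        using gc'[OF w(1) cl(2)] gc'[OF w(2) cl(2)] by (simp add: integral_diff integrable_continuous_real)
      also have "\<dots> \<le> (1/2 * ?D) * (cl t - 0)"
        by (rule integral_bound[OF cl(1) _ gd[OF cl01]]) (use cl gc' w in \<open>auto intro!: continuous_intros\<close>)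
      also have "\<dots> \<le> (1/2 * ?D) * 1" using cl by (intro mult_left_mono) auto
      finally show "dist (apply_bcontfun (P w) t) (apply_bcontfun (P w') t) \<le> 1/2 * ?D" by simp
    qed
    obtain w where w: "w \<in> X" "P w = w"
      using Banach_fix[OF \<open>complete X\<close> \<open>X \<noteq> {}\<close> _ _ PX, of "1/2"] contr by auto
    have wt: "apply_bcontfun w t = v + integral {0..t} (g w)" if "t \<in> {0..1}" for t
      using P[OF w(1), of t] w(2) that by (simp add: cl_def)
    have wd: "(apply_bcontfun w has_vector_derivative g w t) (at t within {0..1})" if t: "t \<in> {0..1}" for t
    proof -
      have "((\<lambda>t. v + integral {0..t} (g w)) has_vector_derivative g w t) (at t within {0..1})"
        by (auto intro!: derivative_eq_intros integral_has_vector_derivative gc w t)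
      then show ?thesis by (rule has_vector_derivative_transform[OF t, rotated]) (use wt in auto)
    qed
    show ?thesis
    proof (rule exI[of _ "pos w"], rule exI[of _ "apply_bcontfun w"], intro conjI ballI)
      fix t :: real assume t: "t \<in> {0..1}"
      show "(apply_bcontfun w has_vector_derivative Q (pos w t) (apply_bcontfun w t)) (at t within {0..1})"
        using wd[OF t] unfolding g_def .
      show "pos w t \<in> ball u0 r" by (rule posb[OF w(1) t])
      show "norm (apply_bcontfun w t) \<le> 2 * norm v" by (rule wb[OF w(1)])
      show "(pos w has_vector_derivative apply_bcontfun w t) (at t within {0..1})" by (rule posd[OF t])
    next
      show "pos w 0 = u0" unfolding pos_def by simp
      show "apply_bcontfun w 0 = v" using wt[of 0] by simp
    qed
  qed
  ultimately show ?thesis by blast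
qed

lemma norm_blinfun_inner_right: "norm (blinfun_inner_right u) = norm (u :: 'h::real_inner)"
proof (rule antisym)
  show "norm (blinfun_inner_right u) \<le> norm u"
    by (rule norm_blinfun_bound) (auto simp: blinfun_inner_right.rep_eq Cauchy_Schwarz_ineq2)
  have "norm u * norm u \<le> norm (blinfun_inner_right u) * norm u"
    using norm_blinfun[of "blinfun_inner_right u" u]
    by (simp add: blinfun_inner_right.rep_eq norm_eq_sqrt_inner)
  then show "norm u \<le> norm (blinfun_inner_right u)"
    by (cases "u = 0") auto
qed

lemma surj_blinfun_inner_right:
  "surj (blinfun_inner_right :: 'h::{real_inner, complete_space} \<Rightarrow> 'h \<Rightarrow>\<^sub>L real)"
proof (rule surjI[where f = "\<lambda>l. SOME z. blinfun_inner_right z = l"])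
  fix l :: "'h \<Rightarrow>\<^sub>L real"
  define B where "B = Blinfun (\<lambda>u::'h. blinfun_inner_right u)"
  have B: "blinfun_apply B u = blinfun_inner_right u" for u
    unfolding B_def by (simp add: bounded_linear_Blinfun_apply bounded_linear_blinfun_inner_right)
  have "\<exists>z. \<forall>w. bil B z w = l w"
  proof (rule riesz_coercive[where k = 1])
    show "bil B u v = bil B v u" for u v
      unfolding B blinfun_inner_right.rep_eq by (rule inner_commute)
    show "1 * (norm u)\<^sup>2 \<le> bil B u u" for u
      unfolding B blinfun_inner_right.rep_eq by (simp add: power2_norm_eq_inner)
  qed simp
  then have "\<exists>z. blinfun_inner_right z = l" unfolding B by (metis blinfun_eqI)
  then show "blinfun_inner_right (SOME z. blinfun_inner_right z = l) = l" by (rule someI_ex)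
qed

text \<open>The sort of \<^typ>\<open>'h\<close> is not contained in class \<^class>\<open>banach\<close>, which integration requires, so the
  equation is solved in the dual space and carried back by the Riesz isometry.\<close>

lemma second_order_ode_hilbert:
  fixes Q :: "'h::{real_inner, complete_space} \<Rightarrow> 'h \<Rightarrow> 'h"
  assumes Q: "quadratic_lipschitz C (ball u0 r) Q" and r: "r > 0"
  shows "\<exists>\<rho>>0. \<forall>v. norm v < \<rho> \<longrightarrow> (\<exists>x w. x 0 = u0 \<and> w 0 = v \<and>
    (\<forall>t\<in>{0..1::real}. x t \<in> ball u0 r \<and> norm (w t) \<le> 2 * norm v \<and>
       (x has_vector_derivative w t) (at t within {0..1}) \<and>
       (w has_vector_derivative Q (x t) (w t)) (at t within {0..1})))"
proof -
  let ?J = "blinfun_inner_right :: 'h \<Rightarrow> 'h \<Rightarrow>\<^sub>L real"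
  define I where "I = inv ?J"
  have J: "bounded_linear ?J" by (rule bounded_linear_blinfun_inner_right)
  have JI: "?J (I l) = l" for l
    unfolding I_def by (rule surj_f_inv_f[OF surj_blinfun_inner_right])
  have Jd: "?J (u - v) = ?J u - ?J v" for u v by (rule linear_diff[OF bounded_linear.linear[OF J]])
  have "inj ?J"
  proof (rule injI)
    fix u v assume "?J u = ?J v"
    then have "norm (?J (u - v)) = 0" unfolding Jd by simp
    then show "u = v" unfolding norm_blinfun_inner_right by simp
  qed
  then have IJ: "I (?J u) = u" for u unfolding I_def by simp
  have nI: "norm (I l) = norm l" for l using norm_blinfun_inner_right[of "I l"] by (simp add: JI)
  have I: "bounded_linear I"
  proof (rule bounded_linear_intro[where K = 1])
    show "I (x + y) = I x + I y" for x y
      by (metis IJ JI linear_add[OF bounded_linear.linear[OF J]])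
    show "I (c *\<^sub>R x) = c *\<^sub>R I x" for c x
      by (metis IJ JI linear_scale[OF bounded_linear.linear[OF J]])
  qed (simp add: nI)
  have Id: "norm (I u - I v) = norm (u - v)" for u v
    by (metis nI linear_diff[OF bounded_linear.linear[OF I]])
  \<comment> \<open>Conjugation by a linear isometry leaves the constant \<open>C\<close> and the
    radius unchanged.\<close>
  define Q' where "Q' x w = ?J (Q (I x) (I w))" for x w
  have inb: "I x \<in> ball u0 r" if "x \<in> ball (?J u0) r" for x
    using that Id[of "?J u0" x] by (simp add: dist_norm IJ)
  have "quadratic_lipschitz C (ball (?J u0) r) Q'"
    unfolding quadratic_lipschitz_def
  proof (intro conjI ballI allI)
    show "C \<ge> 0" using Q unfolding quadratic_lipschitz_def by simp
  next
    fix x w assume x: "x \<in> ball (?J u0) r"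
    have "norm (Q (I x) (I w)) \<le> C * (norm (I w))\<^sup>2"
      using Q inb[OF x] unfolding quadratic_lipschitz_def by blast
    then show "norm (Q' x w) \<le> C * (norm w)\<^sup>2" unfolding Q'_def norm_blinfun_inner_right nI .
  next
    fix x x' w w' assume x: "x \<in> ball (?J u0) r" "x' \<in> ball (?J u0) r"
    have "norm (Q (I x) (I w) - Q (I x') (I w'))
        \<le> C * ((norm (I w) + norm (I w')) * norm (I w - I w') + (norm (I w))\<^sup>2 * norm (I x - I x'))"
      using Q inb[OF x(1)] inb[OF x(2)] unfolding quadratic_lipschitz_def by blast
    then show "norm (Q' x w - Q' x' w')
        \<le> C * ((norm w + norm w') * norm (w - w') + (norm w)\<^sup>2 * norm (x - x'))"
      unfolding Q'_def Jd[symmetric] norm_blinfun_inner_right nI Id .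
  qed
  from second_order_ode_banach[OF this r] obtain \<rho> where \<rho>: "\<rho> > 0"
    and sol: "\<And>v. norm v < \<rho> \<Longrightarrow> \<exists>x w. x 0 = ?J u0 \<and> w 0 = v \<and>
    (\<forall>t\<in>{0..1::real}. x t \<in> ball (?J u0) r \<and> norm (w t) \<le> 2 * norm v \<and>
       (x has_vector_derivative w t) (at t within {0..1}) \<and>
       (w has_vector_derivative Q' (x t) (w t)) (at t within {0..1}))" by blast
  have "\<exists>x w. x 0 = u0 \<and> w 0 = v \<and>
    (\<forall>t\<in>{0..1::real}. x t \<in> ball u0 r \<and> norm (w t) \<le> 2 * norm v \<and>
       (x has_vector_derivative w t) (at t within {0..1}) \<and>
       (w has_vector_derivative Q (x t) (w t)) (at t within {0..1}))" if v: "norm v < \<rho>" for v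
  proof -
    obtain x w where xw: "x 0 = ?J u0" "w 0 = ?J v"
      and t: "\<And>t. t \<in> {0..1::real} \<Longrightarrow> x t \<in> ball (?J u0) r \<and> norm (w t) \<le> 2 * norm (?J v) \<and>
       (x has_vector_derivative w t) (at t within {0..1}) \<and>
       (w has_vector_derivative Q' (x t) (w t)) (at t within {0..1})"
      using sol[of "?J v"] v unfolding norm_blinfun_inner_right by blast
    show ?thesis
    proof (rule exI[of _ "\<lambda>t. I (x t)"], rule exI[of _ "\<lambda>t. I (w t)"], intro conjI ballI)
      fix s :: real assume s: "s \<in> {0..1}"
      note xs = t[OF s]
      show "I (x s) \<in> ball u0 r" using xs inb by blast
      show "norm (I (w s)) \<le> 2 * norm v" using xs unfolding nI norm_blinfun_inner_right by blast
      show "((\<lambda>t. I (x t)) has_vector_derivative I (w s)) (at s within {0..1})"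
        using xs by (intro bounded_linear.has_vector_derivative[OF I]) blast
      have "((\<lambda>t. I (w t)) has_vector_derivative I (Q' (x s) (w s))) (at s within {0..1})"
        using xs by (intro bounded_linear.has_vector_derivative[OF I]) blast
      then show "((\<lambda>t. I (w t)) has_vector_derivative Q (I (x s)) (I (w s))) (at s within {0..1})"
        unfolding Q'_def IJ .
    qed (simp_all only: xw IJ)
  qed
  then show ?thesis using \<rho> by blast
qed

lemma vector_derivative_norm_bound:
  fixes f :: "real \<Rightarrow> 'a::real_normed_vector"
  assumes d: "\<And>t. t \<in> {a..b} \<Longrightarrow> (f has_vector_derivative f' t) (at t within {a..b})"
    and B: "\<And>t. t \<in> {a..b} \<Longrightarrow> norm (f' t) \<le> B"
    and s: "s \<in> {a..b}" "t \<in> {a..b}"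
  shows "norm (f t - f s) \<le> B * \<bar>t - s\<bar>"
proof -
  have "norm (f t - f s) \<le> B * norm (t - s)"
  proof (rule differentiable_bound[where S = "{a..b}" and f' = "\<lambda>t h. h *\<^sub>R f' t"])
    show "(f has_derivative (\<lambda>h. h *\<^sub>R f' t)) (at t within {a..b})" if "t \<in> {a..b}" for t
      using d[OF that] unfolding has_vector_derivative_def .
    show "onorm (\<lambda>h::real. h *\<^sub>R f' t) \<le> B" if "t \<in> {a..b}" for t
    proof (rule onorm_bound)
      show "0 \<le> B" using B[OF that] norm_ge_zero[of "f' t"] by linarith
      show "norm (h *\<^sub>R f' t) \<le> B * norm h" for h :: real
        using mult_left_mono[OF B[OF that], of "\<bar>h\<bar>"] by (simp add: mult.commute)
    qed
  qed (use s in simp_all)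
  then show ?thesis by simp
qed

text \<open>By the mean value inequality the largest difference \<open>D m\<close> on the interval
  is at most \<open>(b - a) * (1 + C * (2 * W + W\<^sup>2)) * D m\<close>, so \<open>small\<close>
  forces it to vanish. No integral is involved, hence the plain normed space.\<close>

lemma second_order_ode_unique:
  fixes x y u v :: "real \<Rightarrow> 'a::real_normed_vector"
  assumes Q: "quadratic_lipschitz C U Q" and ab: "a \<le> b"
    and xd: "\<And>t. t \<in> {a..b} \<Longrightarrow> x t \<in> U \<and> norm (u t) \<le> W \<and> (x has_vector_derivative u t) (at t within {a..b}) \<and>
       (u has_vector_derivative Q (x t) (u t)) (at t within {a..b})"
    and yd: "\<And>t. t \<in> {a..b} \<Longrightarrow> y t \<in> U \<and> norm (v t) \<le> W \<and> (y has_vector_derivative v t) (at t within {a..b}) \<and>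
       (v has_vector_derivative Q (y t) (v t)) (at t within {a..b})"
    and init: "x a = y a" "u a = v a"
    and small: "(b - a) * (1 + C * (2 * W + W\<^sup>2)) < 1"
    and t: "t \<in> {a..b}"
  shows "x t = y t" "u t = v t"
proof -
  have C: "C \<ge> 0" using Q unfolding quadratic_lipschitz_def by simp
  have "norm (u a) \<le> W" using xd[of a] ab by simp
  then have W: "W \<ge> 0" using norm_ge_zero[of "u a"] by linarith
  define D where "D t = norm (x t - y t) + norm (u t - v t)" for t
  have "continuous_on {a..b} x" "continuous_on {a..b} y" "continuous_on {a..b} u" "continuous_on {a..b} v"
    by (rule continuous_on_vector_derivative, use xd yd in blast)+
  then have "continuous_on {a..b} D" unfolding D_def by (intro continuous_intros)
  then obtain m where m: "m \<in> {a..b}" "\<And>t. t \<in> {a..b} \<Longrightarrow> D t \<le> D m"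
    using continuous_attains_sup[of "{a..b}" D] ab by auto
  have D0: "D t \<ge> 0" and Dx: "norm (x t - y t) \<le> D t" and Du: "norm (u t - v t) \<le> D t" for t
    unfolding D_def by simp_all
  let ?K = "C * (2 * W + W\<^sup>2)"
  have K: "?K \<ge> 0" using C W by simp
  have 1: "norm ((x m - y m) - (x a - y a)) \<le> D m * \<bar>m - a\<bar>"
  proof (rule vector_derivative_norm_bound[where f = "\<lambda>t. x t - y t" and f' = "\<lambda>t. u t - v t"])
    fix t assume t: "t \<in> {a..b}"
    show "((\<lambda>t. x t - y t) has_vector_derivative u t - v t) (at t within {a..b})"
      using xd[OF t] yd[OF t] by (intro has_vector_derivative_diff) auto
    show "norm (u t - v t) \<le> D m" using m(2)[OF t] Du[of t] by linarith
  qed (use m(1) ab in simp_all)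
  have 2: "norm ((u m - v m) - (u a - v a)) \<le> (?K * D m) * \<bar>m - a\<bar>"
  proof (rule vector_derivative_norm_bound[where f = "\<lambda>t. u t - v t" and f' = "\<lambda>t. Q (x t) (u t) - Q (y t) (v t)"])
    fix t assume t: "t \<in> {a..b}"
    show "((\<lambda>t. u t - v t) has_vector_derivative Q (x t) (u t) - Q (y t) (v t)) (at t within {a..b})"
      using xd[OF t] yd[OF t] by (intro has_vector_derivative_diff) auto
    have "norm (Q (x t) (u t) - Q (y t) (v t)) \<le> C * ((norm (u t) + norm (v t)) * norm (u t - v t) + (norm (u t))\<^sup>2 * norm (x t - y t))"
      using Q xd[OF t] yd[OF t] unfolding quadratic_lipschitz_def by blast
    also have "\<dots> \<le> C * ((W + W) * D m + W\<^sup>2 * D m)"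
    proof -
      have "norm (u t - v t) \<le> D m" "norm (x t - y t) \<le> D m"
        using m(2)[OF t] Du[of t] Dx[of t] by linarith+
      then show ?thesis
        using xd[OF t] yd[OF t] C W by (intro mult_left_mono add_mono mult_mono power_mono) auto
    qed
    also have "\<dots> = ?K * D m" by (simp add: algebra_simps)
    finally show "norm (Q (x t) (u t) - Q (y t) (v t)) \<le> ?K * D m" .
  qed (use m(1) ab in simp_all)
  have "D m \<le> D m * \<bar>m - a\<bar> + (?K * D m) * \<bar>m - a\<bar>"
    using 1 2 init unfolding D_def[of m] by simp
  also have "\<dots> = D m * (\<bar>m - a\<bar> * (1 + ?K))" by (simp add: algebra_simps)
  also have "\<dots> \<le> D m * ((b - a) * (1 + ?K))"
    using D0 K m(1) by (intro mult_left_mono mult_right_mono) auto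
  finally have "D m * (1 - (b - a) * (1 + ?K)) \<le> 0" by (simp add: algebra_simps)
  then have "D m \<le> 0" using small by (simp add: mult_le_0_iff)
  then have "D t \<le> 0" using m(2)[OF t] by simp
  then have "norm (x t - y t) \<le> 0" "norm (u t - v t) \<le> 0" using Dx[of t] Du[of t] by linarith+
  then show "x t = y t" "u t = v t" by auto
qed

section \<open>Christoffel symbols and changes of charts\<close>

definition C2_data :: "'a::real_normed_vector set \<Rightarrow> ('a \<Rightarrow> 'b::real_normed_vector) \<Rightarrow> ('a \<Rightarrow> 'a \<Rightarrow>\<^sub>L 'b) \<Rightarrow> ('a \<Rightarrow> 'a \<Rightarrow>\<^sub>L 'a \<Rightarrow>\<^sub>L 'b) \<Rightarrow> bool" where
  "C2_data S f f1 f2 \<longleftrightarrow> (\<forall>x\<in>S. (f has_derivative blinfun_apply (f1 x)) (at x)) \<and>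
     (\<forall>x\<in>S. (f1 has_derivative blinfun_apply (f2 x)) (at x)) \<and> continuous_on S f2"

lemma C2_dataD:
  assumes "C2_data S f f1 f2"
  shows "x \<in> S \<Longrightarrow> (f has_derivative blinfun_apply (f1 x)) (at x)"
    and "x \<in> S \<Longrightarrow> (f1 has_derivative blinfun_apply (f2 x)) (at x)"
    and "continuous_on S f2" "continuous_on S f1" "continuous_on S f"
proof -
  show *: "x \<in> S \<Longrightarrow> (f has_derivative blinfun_apply (f1 x)) (at x)" "x \<in> S \<Longrightarrow> (f1 has_derivative blinfun_apply (f2 x)) (at x)"
    "continuous_on S f2" for x
    using assms unfolding C2_data_def by auto
  show "continuous_on S f1" "continuous_on S f"
    using has_derivative_continuous[OF *(1)] has_derivative_continuous[OF *(2)]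
    by (auto intro!: continuous_at_imp_continuous_on)
qed

lemma smooth_on_C2_data:
  assumes "smooth_on S f" "open S"
  shows "\<exists>f1 f2. C2_data S f f1 f2"
proof (rule smooth_on_imp_C2[OF assms])
  fix f1 f2
  assume "\<And>x. x \<in> S \<Longrightarrow> (f has_derivative blinfun_apply (f1 x)) (at x)"
    "\<And>x. x \<in> S \<Longrightarrow> (f1 has_derivative blinfun_apply (f2 x)) (at x)" "continuous_on S f2"
  then have "C2_data S f f1 f2" unfolding C2_data_def by simp
  then show ?thesis by blast
qed

lemma norm_bil: "\<bar>bil B u v\<bar> \<le> norm B * norm u * norm v"
proof -
  have "\<bar>bil B u v\<bar> \<le> norm (blinfun_apply B u) * norm v" using norm_blinfun[of "blinfun_apply B u" v] by simp
  also have "\<dots> \<le> norm B * norm u * norm v" by (intro mult_right_mono norm_blinfun norm_ge_zero)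
  finally show ?thesis .
qed

lemma norm_tril: "\<bar>bil (blinfun_apply S u) v w\<bar> \<le> norm S * norm u * norm v * norm w"
proof -
  have "\<bar>bil (blinfun_apply S u) v w\<bar> \<le> norm (blinfun_apply S u) * norm v * norm w" by (rule norm_bil)
  also have "\<dots> \<le> norm S * norm u * norm v * norm w" by (intro mult_right_mono norm_blinfun norm_ge_zero)
  finally show ?thesis .
qed

text \<open>With \<open>S\<close> the derivative of the metric, this is the right side of the Koszul
  formula tested against \<open>y\<close>. Both lower arguments equal \<open>w\<close>, since the
  geodesic equation contains only diagonal values.\<close>

definition koszul :: "('h::real_normed_vector \<Rightarrow>\<^sub>L 'h \<Rightarrow>\<^sub>L 'h \<Rightarrow>\<^sub>L real) \<Rightarrow> 'h \<Rightarrow> 'h \<Rightarrow> real" where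
  "koszul S w y = 2 * bil (blinfun_apply S w) w y - bil (blinfun_apply S y) w w"

lemma koszul_bound: "\<bar>koszul S w y\<bar> \<le> 3 * (norm S * (norm w)\<^sup>2 * norm y)"
proof -
  have aux: "\<bar>2 * a - b\<bar> \<le> 2 * A + B" if "\<bar>a\<bar> \<le> A" "\<bar>b\<bar> \<le> B" for a b A B :: real
    using that by linarith
  have "\<bar>koszul S w y\<bar> \<le> 2 * (norm S * norm w * norm w * norm y) + norm S * norm y * norm w * norm w"
    unfolding koszul_def by (rule aux[OF norm_tril norm_tril])
  also have "\<dots> = 3 * (norm S * (norm w)\<^sup>2 * norm y)" by (simp add: power2_eq_square)
  finally show ?thesis .
qed

lemma koszul_diff_left: "koszul S w y - koszul S' w y = koszul (S - S') w y"
  unfolding koszul_def by (simp add: blinfun.diff_left algebra_simps)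

lemma koszul_diff_right:
  "\<bar>koszul S w y - koszul S w' y\<bar> \<le> 3 * (norm S * ((norm w + norm w') * norm (w - w')) * norm y)"
proof -
  have aux: "\<bar>2 * (a + b) - (c + d)\<bar> \<le> 2 * (A + B) + (C + D)"
    if "\<bar>a\<bar> \<le> A" "\<bar>b\<bar> \<le> B" "\<bar>c\<bar> \<le> C" "\<bar>d\<bar> \<le> D" for a b c d A B C D :: real
    unfolding distrib_left using that by (intro abs_leI) (simp_all add: abs_le_iff)
  have e: "koszul S w y - koszul S w' y =
     2 * (bil (blinfun_apply S w) (w - w') y + bil (blinfun_apply S (w - w')) w' y)
     - (bil (blinfun_apply S y) w (w - w') + bil (blinfun_apply S y) (w - w') w')"
    unfolding koszul_def by (simp add: blinfun.diff_left blinfun.diff_right algebra_simps)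
  have "\<bar>koszul S w y - koszul S w' y\<bar> \<le> 2 * (norm S * norm w * norm (w - w') * norm y + norm S * norm (w - w') * norm w' * norm y)
     + (norm S * norm y * norm w * norm (w - w') + norm S * norm y * norm (w - w') * norm w')"
    unfolding e by (rule aux[OF norm_tril norm_tril norm_tril norm_tril])
  also have "\<dots> = 3 * (norm S * ((norm w + norm w') * norm (w - w')) * norm y)" by (simp add: algebra_simps)
  finally show ?thesis .
qed

text \<open>\<open>Z x w\<close> is the Christoffel symbol of the metric \<open>G\<close> at \<open>(w, w)\<close>, characterised by the Koszul
  formula.\<close>

lemma koszul_solution_quadratic_lipschitz:
  fixes G :: "'h::{real_inner, complete_space} \<Rightarrow> 'h \<Rightarrow>\<^sub>L 'h \<Rightarrow>\<^sub>L real"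
  assumes S: "open S" "x0 \<in> S" and C2: "C2_data S G G1 G2"
    and k: "k > 0" "\<And>u. k * (norm u)\<^sup>2 \<le> bil (G x0) u u"
    and Z: "\<And>x w y. x \<in> S \<Longrightarrow> 2 * bil (G x) (Z x w) y = koszul (G1 x) w y"
  shows "\<exists>r>0. \<exists>C. ball x0 r \<subseteq> S \<and> quadratic_lipschitz C (ball x0 r) (\<lambda>x w. - Z x w)"
proof -
  note D = C2_dataD[OF C2]
  obtain r0 L0 where r0: "r0 > 0" "L0 \<ge> 0" "ball x0 r0 \<subseteq> S"
    and L0: "\<forall>y\<in>ball x0 r0. \<forall>z\<in>ball x0 r0. norm (G y - G z) \<le> L0 * norm (y - z)"
    using C1_imp_locally_lipschitz[OF S D(1) D(4)] by blast
  obtain r1 L1 where r1: "r1 > 0" "L1 \<ge> 0" "ball x0 r1 \<subseteq> S"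
    and L1: "\<forall>y\<in>ball x0 r1. \<forall>z\<in>ball x0 r1. norm (G1 y - G1 z) \<le> L1 * norm (y - z)"
    using C1_imp_locally_lipschitz[OF S D(2) D(3)] by blast
  \<comment> \<open>Small enough that the metric changes by at most \<open>k / 2\<close>, so half of
    the coercivity constant survives on the whole ball.\<close>
  define r where "r = min (min r0 r1) (k / (2 * (L0 + 1)))"
  have r: "r > 0" "r \<le> r0" "r \<le> r1" "r \<le> k / (2 * (L0 + 1))" using r0 r1 k unfolding r_def by auto
  have sub: "ball x0 r \<subseteq> S" using r r0 by auto
  define \<kappa> where "\<kappa> = k / 2"
  have \<kappa>: "\<kappa> > 0" unfolding \<kappa>_def using k by simp
  have coer: "\<kappa> * (norm u)\<^sup>2 \<le> bil (G x) u u" if x: "x \<in> ball x0 r" for x u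
  proof -
    have "norm (G x - G x0) \<le> L0 * norm (x - x0)" using L0 x r r0 by auto
    also have "\<dots> \<le> L0 * r" using x r0 by (intro mult_left_mono) (auto simp: dist_norm norm_minus_commute)
    also have "\<dots> \<le> (L0 + 1) * r" using r by simp
    also have "\<dots> \<le> \<kappa>" using r(4) r0(2) unfolding \<kappa>_def by (simp add: field_simps)
    finally have n: "norm (G x - G x0) \<le> \<kappa>" .
    have "\<bar>bil (G x - G x0) u u\<bar> \<le> norm (G x - G x0) * norm u * norm u" by (rule norm_bil)
    also have "\<dots> \<le> \<kappa> * norm u * norm u" using n by (intro mult_right_mono) auto
    finally have "\<bar>bil (G x) u u - bil (G x0) u u\<bar> \<le> \<kappa> * (norm u)\<^sup>2"
      by (simp add: blinfun.diff_left power2_eq_square mult.assoc)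
    moreover have "\<kappa> * (norm u)\<^sup>2 + \<kappa> * (norm u)\<^sup>2 \<le> bil (G x0) u u" using k(2)[of u] unfolding \<kappa>_def by simp
    ultimately show ?thesis by linarith
  qed
  define K1 where "K1 = norm (G1 x0) + L1 * r"
  have K1: "norm (G1 x) \<le> K1" if x: "x \<in> ball x0 r" for x
  proof -
    have "norm (G1 x - G1 x0) \<le> L1 * norm (x - x0)" using L1 x r r1 by auto
    also have "\<dots> \<le> L1 * r" using x r1 by (intro mult_left_mono) (auto simp: dist_norm norm_minus_commute)
    finally show ?thesis unfolding K1_def using norm_triangle_sub[of "G1 x" "G1 x0"] by linarith
  qed
  have K10: "K1 \<ge> 0" unfolding K1_def using r1 r by simp
  \<comment> \<open>Coercivity bounds the left side of the premise below by a multiple of the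
    squared norm, and one factor \<open>norm z\<close> cancels.\<close>
  have cancel: "norm z \<le> a / (2 * \<kappa>)" if x: "x \<in> ball x0 r" and "2 * bil (G x) z z \<le> a * norm z" "a \<ge> 0" for x z and a :: real
  proof (cases "z = 0")
    case False
    have "2 * (\<kappa> * (norm z)\<^sup>2) \<le> a * norm z" using coer[OF x, of z] that by linarith
    then have "(2 * \<kappa> * norm z) * norm z \<le> a * norm z" by (simp add: power2_eq_square)
    then have "2 * \<kappa> * norm z \<le> a" using False by simp
    then show ?thesis using \<kappa> by (simp add: field_simps)
  qed (use that \<kappa> in simp)
  define C0 where "C0 = 3 * K1 / (2 * \<kappa>)"
  have C00: "C0 \<ge> 0" unfolding C0_def using K10 \<kappa> by simp
  have zb: "norm (Z x w) \<le> C0 * (norm w)\<^sup>2" if x: "x \<in> ball x0 r" for x w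
  proof -
    have "2 * bil (G x) (Z x w) (Z x w) \<le> 3 * (norm (G1 x) * (norm w)\<^sup>2 * norm (Z x w))"
      using Z[of x w "Z x w"] koszul_bound[of "G1 x" w "Z x w"] x sub by auto
    also have "\<dots> \<le> 3 * (K1 * (norm w)\<^sup>2 * norm (Z x w))"
      using K1[OF x] by (intro mult_left_mono mult_right_mono) auto
    also have "\<dots> = (3 * K1 * (norm w)\<^sup>2) * norm (Z x w)" by simp
    finally have "norm (Z x w) \<le> (3 * K1 * (norm w)\<^sup>2) / (2 * \<kappa>)"
      by (rule cancel[OF x]) (use K10 in simp)
    then show ?thesis unfolding C0_def by simp
  qed
  define C where "C = C0 + 3 * K1 / (2 * \<kappa>) + (3 * L1 + 2 * L0 * C0) / (2 * \<kappa>)"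
  have parts: "C0 \<le> C" "3 * K1 / (2 * \<kappa>) \<le> C" "(3 * L1 + 2 * L0 * C0) / (2 * \<kappa>) \<le> C" "0 \<le> C"
    using C00 K10 \<kappa> r0 r1 unfolding C_def by auto
  have zl: "norm (Z x w - Z x' w') \<le> C * ((norm w + norm w') * norm (w - w') + (norm w)\<^sup>2 * norm (x - x'))"
    if x: "x \<in> ball x0 r" "x' \<in> ball x0 r" for x x' w w'
  proof -
    let ?y = "Z x w - Z x' w'"
    let ?p = "(norm w + norm w') * norm (w - w')" and ?q = "(norm w)\<^sup>2 * norm (x - x')"
    have pq: "?p \<ge> 0" "?q \<ge> 0" by auto
    have xx: "x \<in> ball x0 r0" "x' \<in> ball x0 r0" "x \<in> ball x0 r1" "x' \<in> ball x0 r1" using x r by auto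
    \<comment> \<open>The Koszul formulas at \<open>x\<close> and \<open>x'\<close> are tested
      against the difference \<open>?y\<close> itself; evaluating \<open>Z x w\<close> with the
      metric at \<open>x'\<close> instead of \<open>x\<close> costs the last summand.\<close>
    have "2 * bil (G x') ?y ?y = (koszul (G1 x) w ?y - koszul (G1 x') w ?y) + (koszul (G1 x') w ?y - koszul (G1 x') w' ?y)
        - 2 * bil (G x - G x') (Z x w) ?y"
      using Z[of x w ?y] Z[of x' w' ?y] x sub by (simp add: subset_iff blinfun.diff_left blinfun.diff_right)
    moreover have "\<bar>koszul (G1 x) w ?y - koszul (G1 x') w ?y\<bar> \<le> 3 * L1 * ?q * norm ?y"
    proof -
      have "\<bar>koszul (G1 x) w ?y - koszul (G1 x') w ?y\<bar> \<le> 3 * (norm (G1 x - G1 x') * (norm w)\<^sup>2 * norm ?y)"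
        unfolding koszul_diff_left by (rule koszul_bound)
      also have "\<dots> \<le> 3 * ((L1 * norm (x - x')) * (norm w)\<^sup>2 * norm ?y)"
        using L1 xx by (intro mult_left_mono mult_right_mono) auto
      finally show ?thesis by (simp add: mult_ac)
    qed
    moreover have "\<bar>koszul (G1 x') w ?y - koszul (G1 x') w' ?y\<bar> \<le> 3 * K1 * ?p * norm ?y"
    proof -
      have "\<bar>koszul (G1 x') w ?y - koszul (G1 x') w' ?y\<bar> \<le> 3 * (norm (G1 x') * ?p * norm ?y)"
        by (rule koszul_diff_right)
      also have "\<dots> \<le> 3 * (K1 * ?p * norm ?y)"
        using K1[OF x(2)] by (intro mult_left_mono mult_right_mono) auto
      finally show ?thesis by (simp only: mult_ac)
    qed
    moreover have "\<bar>bil (G x - G x') (Z x w) ?y\<bar> \<le> L0 * C0 * ?q * norm ?y"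
    proof -
      have "\<bar>bil (G x - G x') (Z x w) ?y\<bar> \<le> norm (G x - G x') * norm (Z x w) * norm ?y" by (rule norm_bil)
      also have "\<dots> \<le> (L0 * norm (x - x')) * (C0 * (norm w)\<^sup>2) * norm ?y"
        using L0 xx zb[OF x(1)] r0 by (intro mult_right_mono mult_mono) auto
      finally show ?thesis by (simp add: mult_ac)
    qed
    moreover have "a \<le> A + B + 2 * D"
      if "a = b + c - 2 * d" "\<bar>b\<bar> \<le> A" "\<bar>c\<bar> \<le> B" "\<bar>d\<bar> \<le> D" for a b c d A B D :: real
      using that by linarith
    ultimately have "2 * bil (G x') ?y ?y \<le> 3 * L1 * ?q * norm ?y + 3 * K1 * ?p * norm ?y + 2 * (L0 * C0 * ?q * norm ?y)"
      by blast
    also have "\<dots> = ((3 * L1 + 2 * L0 * C0) * ?q + 3 * K1 * ?p) * norm ?y" by (simp add: algebra_simps)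
    finally have "norm ?y \<le> ((3 * L1 + 2 * L0 * C0) * ?q + 3 * K1 * ?p) / (2 * \<kappa>)"
      by (rule cancel[OF x(2)]) (use pq r0 r1 C00 K10 in simp)
    also have "\<dots> = (3 * L1 + 2 * L0 * C0) / (2 * \<kappa>) * ?q + 3 * K1 / (2 * \<kappa>) * ?p"
      by (simp only: add_divide_distrib[of "_ * ?q"] times_divide_eq_left)
    also have "\<dots> \<le> C * ?q + C * ?p" using parts pq by (intro add_mono mult_right_mono) auto
    finally show ?thesis by (simp add: algebra_simps)
  qed
  have "quadratic_lipschitz C (ball x0 r) (\<lambda>x w. - Z x w)"
    unfolding quadratic_lipschitz_def
  proof (intro conjI ballI allI)
    fix x w assume x: "x \<in> ball x0 r"
    have "norm (Z x w) \<le> C0 * (norm w)\<^sup>2" by (rule zb[OF x])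
    also have "\<dots> \<le> C * (norm w)\<^sup>2" using parts by (intro mult_right_mono) auto
    finally show "norm (- Z x w) \<le> C * (norm w)\<^sup>2" by simp
  next
    fix x x' w w' assume x: "x \<in> ball x0 r" "x' \<in> ball x0 r"
    have "norm (- Z x w - - Z x' w') = norm (Z x w - Z x' w')" by (metis minus_diff_minus norm_minus_cancel)
    then show "norm (- Z x w - - Z x' w') \<le> C * ((norm w + norm w') * norm (w - w') + (norm w)\<^sup>2 * norm (x - x'))"
      using zl[OF x] by simp
  qed (use parts in simp)
  then show ?thesis using r(1) sub by blast
qed

lemma has_derivative_blinfun_apply:
  assumes "(F has_derivative F') (at x)" "(G has_derivative G') (at x)"
  shows "((\<lambda>y. blinfun_apply (F y) (G y)) has_derivative
    (\<lambda>h. blinfun_apply (F x) (G' h) + blinfun_apply (F' h) (G x))) (at x)"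
  using bounded_bilinear.FDERIV[OF bounded_bilinear_blinfun_apply assms] .

lemma has_derivative_blinfun_apply_const:
  "(F has_derivative F') (at x) \<Longrightarrow> ((\<lambda>y. blinfun_apply (F y) a) has_derivative (\<lambda>h. blinfun_apply (F' h) a)) (at x)"
  by (rule bounded_linear.has_derivative[OF blinfun.bounded_linear_left])

section \<open>Charts, transition maps and the metric in coordinates\<close>

locale riemannian =
  fixes M :: "('m::t2_space, 'h::{real_inner, complete_space}) manifold"
  assumes riem: "riemannian_manifold M"
begin

definition overlap :: "('m, 'h) chart \<Rightarrow> ('m, 'h) chart \<Rightarrow> 'h set" where
  "overlap c c' = chart_map c ` (chart_dom c \<inter> chart_dom c')"

lemma chart_props:
  assumes "c \<in> atlas M"
  shows "open (chart_dom c)" "open (chart_img c)" "continuous_on (chart_dom c) (chart_map c)"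
    "continuous_on (chart_img c) (chart_inv c)"
    "\<And>p. p \<in> chart_dom c \<Longrightarrow> chart_map c p \<in> chart_img c"
    "\<And>p. p \<in> chart_dom c \<Longrightarrow> chart_inv c (chart_map c p) = p"
    "\<And>x. x \<in> chart_img c \<Longrightarrow> chart_inv c x \<in> chart_dom c"
    "\<And>x. x \<in> chart_img c \<Longrightarrow> chart_map c (chart_inv c x) = x"
proof -
  have "is_chart c" using riem assms unfolding riemannian_manifold_def smooth_atlas_def by blast
  then have o: "open (chart_dom c)" "open (chart_img c)"
    and h: "homeomorphism (chart_dom c) (chart_img c) (chart_map c) (chart_inv c)"
    unfolding is_chart_def by blast+
  show "open (chart_dom c)" "open (chart_img c)" by (fact o)+
  show "continuous_on (chart_dom c) (chart_map c)" "continuous_on (chart_img c) (chart_inv c)"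
    using h by (simp_all add: homeomorphism_cont1 homeomorphism_cont2)
  show "chart_map c p \<in> chart_img c" if "p \<in> chart_dom c" for p
    using that unfolding chart_img_def by (rule imageI)
  show "chart_inv c (chart_map c p) = p" if "p \<in> chart_dom c" for p
    using homeomorphism_apply1[OF h that] .
  show "chart_inv c x \<in> chart_dom c" if "x \<in> chart_img c" for x
    using homeomorphism_image2[OF h] that by (metis imageI)
  show "chart_map c (chart_inv c x) = x" if "x \<in> chart_img c" for x
    using homeomorphism_apply2[OF h that] .
qed

lemma open_chart_preimage:
  assumes "c \<in> atlas M" "open U"
  shows "open {p \<in> chart_dom c. chart_map c p \<in> U}"
proof -
  have "{p \<in> chart_dom c. chart_map c p \<in> U} = chart_map c -` U \<inter> chart_dom c" by auto
  then show ?thesis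
    using continuous_open_preimage[OF chart_props(3,1)[OF assms(1)] assms(2)] by (simp add: Int_commute vimage_def)
qed

lemma open_chart_inv_preimage:
  assumes "c \<in> atlas M" "open U"
  shows "open {x \<in> chart_img c. chart_inv c x \<in> U}"
proof -
  have "{x \<in> chart_img c. chart_inv c x \<in> U} = chart_img c \<inter> chart_inv c -` U" by auto
  then show ?thesis
    using continuous_open_preimage[OF chart_props(4,2)[OF assms(1)] assms(2)] by simp
qed

lemma ref_chart: "ref_chart M p \<in> atlas M" "p \<in> chart_dom (ref_chart M p)"
proof -
  have "\<exists>c. c \<in> atlas M \<and> p \<in> chart_dom c"
    using riem unfolding riemannian_manifold_def smooth_atlas_def by blast
  then have "ref_chart M p \<in> atlas M \<and> p \<in> chart_dom (ref_chart M p)"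
    unfolding ref_chart_def by (rule someI_ex)
  then show "ref_chart M p \<in> atlas M" "p \<in> chart_dom (ref_chart M p)" by auto
qed

lemma overlap:
  assumes "c \<in> atlas M" "c' \<in> atlas M"
  shows "open (overlap c c')" "smooth_on (overlap c c') (transition c c')" "overlap c c' \<subseteq> chart_img c"
    "\<And>x. x \<in> overlap c c' \<Longrightarrow> chart_inv c x \<in> chart_dom c'"
    "\<And>x. x \<in> overlap c c' \<Longrightarrow> transition c c' x \<in> overlap c' c"
proof -
  have "overlap c c' = {x \<in> chart_img c. chart_inv c x \<in> chart_dom c'}"
    unfolding overlap_def using chart_props(5-8)[OF assms(1)] by force
  then show "open (overlap c c')" using open_chart_inv_preimage[OF assms(1) chart_props(1)[OF assms(2)]] by simp
  show "smooth_on (overlap c c') (transition c c')"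
    using riem assms unfolding riemannian_manifold_def smooth_atlas_def overlap_def by blast
  show "overlap c c' \<subseteq> chart_img c" unfolding overlap_def chart_img_def by blast
  show "chart_inv c x \<in> chart_dom c'" "transition c c' x \<in> overlap c' c" if "x \<in> overlap c c'" for x
    using that chart_props(6)[OF assms(1)] unfolding overlap_def transition_def by auto
qed

lemma transition_map:
  assumes "c \<in> atlas M" "p \<in> chart_dom c"
  shows "transition c c' (chart_map c p) = chart_map c' p"
  using chart_props(6)[OF assms] unfolding transition_def by simp

text \<open>Derivatives of transition maps and of the metric, fixed by choice so that they can be
  named. The second ones are chosen relative to the first ones already selected.\<close>

definition tr1 where "tr1 c c' = (SOME f1. \<exists>f2. C2_data (overlap c c') (transition c c') f1 f2)"
definition tr2 where "tr2 c c' = (SOME f2. C2_data (overlap c c') (transition c c') (tr1 c c') f2)"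
definition g1 where "g1 c = (SOME f1. \<exists>f2. C2_data (chart_img c) (metric M c) f1 f2)"
definition g2 where "g2 c = (SOME f2. C2_data (chart_img c) (metric M c) (g1 c) f2)"

lemma transition_C2:
  assumes "c \<in> atlas M" "c' \<in> atlas M"
  shows "C2_data (overlap c c') (transition c c') (tr1 c c') (tr2 c c')"
proof -
  have "\<exists>f2. C2_data (overlap c c') (transition c c') (tr1 c c') f2"
    using someI_ex[OF smooth_on_C2_data[OF overlap(2,1)[OF assms]]] unfolding tr1_def .
  then show ?thesis unfolding tr2_def by (rule someI_ex)
qed

lemma metric_C2:
  assumes "c \<in> atlas M"
  shows "C2_data (chart_img c) (metric M c) (g1 c) (g2 c)"
proof -
  have "smooth_on (chart_img c) (metric M c)" using riem assms unfolding riemannian_manifold_def by blast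
  then have "\<exists>f2. C2_data (chart_img c) (metric M c) (g1 c) f2"
    using someI_ex[OF smooth_on_C2_data[OF _ chart_props(2)[OF assms]]] unfolding g1_def by blast
  then show ?thesis unfolding g2_def by (rule someI_ex)
qed

lemma metric_sym: "c \<in> atlas M \<Longrightarrow> x \<in> chart_img c \<Longrightarrow> bil (metric M c x) u v = bil (metric M c x) v u"
  using riem unfolding riemannian_manifold_def by blast

lemma metric_coercive: "c \<in> atlas M \<Longrightarrow> x \<in> chart_img c \<Longrightarrow> \<exists>k>0. \<forall>u. k * (norm u)\<^sup>2 \<le> bil (metric M c x) u u"
  using riem unfolding riemannian_manifold_def by blast

lemma metric_nonneg: "c \<in> atlas M \<Longrightarrow> x \<in> chart_img c \<Longrightarrow> 0 \<le> bil (metric M c x) u u"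
proof -
  assume "c \<in> atlas M" "x \<in> chart_img c"
  from metric_coercive[OF this]
  obtain k where k: "k > 0" "\<And>u. k * (norm u)\<^sup>2 \<le> bil (metric M c x) u u" by blast
  have "0 \<le> k * (norm u)\<^sup>2" using k(1) by simp
  then show ?thesis using k(2)[of u] by linarith
qed

lemma metric_eq_0:
  assumes "c \<in> atlas M" "x \<in> chart_img c" "\<And>w. bil (metric M c x) u w = 0"
  shows "u = 0"
proof -
  obtain k where k: "k > 0" "\<And>u. k * (norm u)\<^sup>2 \<le> bil (metric M c x) u u" using metric_coercive[OF assms(1,2)] by blast
  have "k * (norm u)\<^sup>2 \<le> 0" using k(2)[of u] assms(3) by simp
  then show ?thesis using k(1) by (simp add: mult_le_0_iff)
qed

lemma metric_transform:
  assumes "c \<in> atlas M" "c' \<in> atlas M" "x \<in> overlap c c'"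
  shows "bil (metric M c x) u v = bil (metric M c' (transition c c' x)) (tr1 c c' x u) (tr1 c c' x v)"
proof -
  obtain p where p: "p \<in> chart_dom c \<inter> chart_dom c'" "x = chart_map c p" using assms(3) unfolding overlap_def by blast
  have "frechet_derivative (transition c c') (at x) = blinfun_apply (tr1 c c' x)"
    using frechet_derivative_at[OF C2_dataD(1)[OF transition_C2[OF assms(1,2)] assms(3)]] by simp
  moreover have "transition c c' x = chart_map c' p" using transition_map[of c p] assms p by simp
  moreover have "bil (metric M c (chart_map c p)) u v
      = bil (metric M c' (chart_map c' p)) (frechet_derivative (transition c c') (at (chart_map c p)) u)
          (frechet_derivative (transition c c') (at (chart_map c p)) v)"
    using riem assms(1,2) p(1) unfolding riemannian_manifold_def Let_def by blast
  ultimately show ?thesis using p(2) by simp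
qed

text \<open>Chain rule for two transition maps that compose to the identity on an open set. With the
  charts exchanged it shows that \<open>tr1 c c' x\<close> is onto.\<close>

lemma tr1_inverse:
  assumes "c \<in> atlas M" "c' \<in> atlas M" "x \<in> overlap c c'"
  shows "tr1 c' c (transition c c' x) (tr1 c c' x u) = u"
proof -
  have "((\<lambda>y. transition c' c (transition c c' y)) has_derivative (\<lambda>u. tr1 c' c (transition c c' x) (tr1 c c' x u))) (at x)"
    by (rule has_derivative_compose[OF C2_dataD(1)[OF transition_C2] C2_dataD(1)[OF transition_C2]])
       (use assms overlap(5)[OF assms(1,2)] in auto)
  moreover have "((\<lambda>y. transition c' c (transition c c' y)) has_derivative (\<lambda>u. u)) (at x)"
  proof (rule has_derivative_transform_within_open[OF has_derivative_ident overlap(1)[OF assms(1,2)] assms(3)])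
    fix y assume "y \<in> overlap c c'"
    then obtain p where p: "p \<in> chart_dom c" "p \<in> chart_dom c'" "y = chart_map c p"
      unfolding overlap_def by blast
    show "y = transition c' c (transition c c' y)"
      unfolding p(3) transition_map[OF assms(1) p(1)] transition_map[OF assms(2) p(2)] ..
  qed
  ultimately have "(\<lambda>u. tr1 c' c (transition c c' x) (tr1 c c' x u)) = (\<lambda>u. u)"
    by (rule has_derivative_unique)
  then show ?thesis by (rule fun_cong)
qed

lemma tr2_symmetric:
  assumes "c \<in> atlas M" "c' \<in> atlas M" "x \<in> overlap c c'"
  shows "tr2 c c' x u v = tr2 c c' x v u"
  by (rule second_derivative_symmetric[OF overlap(1)[OF assms(1,2)] assms(3) C2_dataD(1)[OF transition_C2[OF assms(1,2)]]
        C2_dataD(2)[OF transition_C2[OF assms(1,2)] assms(3)]])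

section \<open>Christoffel symbols and their transformation law\<close>

text \<open>The description in the definition is meaningful: Riesz representation supplies a
  solution, coercivity its uniqueness.\<close>

lemma christoffel:
  assumes "c \<in> atlas M" "x \<in> chart_img c"
  shows "2 * bil (metric M c x) (christoffel M c x w w) y = koszul (g1 c x) w y"
proof -
  have dg: "frechet_derivative (metric M c) (at x) = blinfun_apply (g1 c x)"
    using frechet_derivative_at[OF C2_dataD(1)[OF metric_C2[OF assms(1)] assms(2)]] by simp
  obtain k where k: "k > 0" "\<And>u. k * (norm u)\<^sup>2 \<le> bil (metric M c x) u u" using metric_coercive[OF assms] by blast
  define l where "l = Blinfun (\<lambda>y. koszul (g1 c x) w y / 2)"
  have "bounded_linear (\<lambda>y. koszul (g1 c x) w y / 2)"
  proof (rule bounded_linear_intro[where K = "3 * (norm (g1 c x) * (norm w)\<^sup>2) / 2"])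
    show "norm (koszul (g1 c x) w y / 2) \<le> norm y * (3 * (norm (g1 c x) * (norm w)\<^sup>2) / 2)" for y
      using koszul_bound[of "g1 c x" w y] by (simp add: field_simps)
  qed (simp_all add: koszul_def blinfun.add_right blinfun.add_left blinfun.scaleR_right blinfun.scaleR_left
      field_simps)
  then have l: "l y = koszul (g1 c x) w y / 2" for y unfolding l_def by (simp add: bounded_linear_Blinfun_apply)
  obtain z where z: "\<And>y. bil (metric M c x) z y = l y"
    using riesz_coercive[OF metric_sym[OF assms] k, of l] by blast
  have zk: "2 * bil (metric M c x) z y = koszul (g1 c x) w y" for y unfolding z l by simp
  have "christoffel M c x w w = z"
    unfolding christoffel_def Let_def dg
  proof (rule the_equality)
    show "\<forall>y. 2 * bil (metric M c x) z y = bil (g1 c x w) w y + bil (g1 c x w) w y - bil (g1 c x y) w w"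
      unfolding zk koszul_def by simp
  next
    fix z' assume z': "\<forall>y. 2 * bil (metric M c x) z' y = bil (g1 c x w) w y + bil (g1 c x w) w y - bil (g1 c x y) w w"
    have "z' - z = 0"
    proof (rule metric_eq_0[OF assms])
      fix y
      have "2 * bil (metric M c x) z' y = 2 * bil (metric M c x) z y"
        using z' unfolding zk koszul_def by simp
      then show "bil (metric M c x) (z' - z) y = 0" by (simp add: blinfun.diff_left blinfun.diff_right)
    qed
    then show "z' = z" by simp
  qed
  then show ?thesis using zk by simp
qed

lemma christoffel_quadratic_lipschitz:
  assumes "c \<in> atlas M" "x0 \<in> chart_img c"
  shows "\<exists>r>0. \<exists>C. ball x0 r \<subseteq> chart_img c \<and> quadratic_lipschitz C (ball x0 r) (\<lambda>x w. - christoffel M c x w w)"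
proof -
  obtain k where k: "k > 0" "\<And>u. k * (norm u)\<^sup>2 \<le> bil (metric M c x0) u u" using metric_coercive[OF assms] by blast
  show ?thesis
    by (rule koszul_solution_quadratic_lipschitz[OF chart_props(2)[OF assms(1)] assms(2) metric_C2[OF assms(1)] k christoffel[OF assms(1)]])
qed

text \<open>The tensor law of the metric, differentiated in direction \<open>w\<close> by the
  product rule.\<close>

lemma metric_derivative_transform:
  assumes "c \<in> atlas M" "c' \<in> atlas M" "x \<in> overlap c c'"
  shows "bil (g1 c x w) a b = bil (g1 c' (transition c c' x) (tr1 c c' x w)) (tr1 c c' x a) (tr1 c c' x b)
    + bil (metric M c' (transition c c' x)) (tr2 c c' x w a) (tr1 c c' x b)
    + bil (metric M c' (transition c c' x)) (tr1 c c' x a) (tr2 c c' x w b)"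
proof -
  note tC = C2_dataD[OF transition_C2[OF assms(1,2)]]
  have xi: "x \<in> chart_img c" "transition c c' x \<in> chart_img c'"
    by (rule subsetD[OF overlap(3)[OF assms(1,2)] assms(3)], rule subsetD[OF overlap(3)[OF assms(2,1)] overlap(5)[OF assms]])
  have 1: "((\<lambda>y. bil (metric M c y) a b) has_derivative (\<lambda>w. bil (g1 c x w) a b)) (at x)"
    by (rule has_derivative_blinfun_apply_const, rule has_derivative_blinfun_apply_const,
        rule C2_dataD(1)[OF metric_C2[OF assms(1)] xi(1)])
  have m': "((\<lambda>y. metric M c' (transition c c' y)) has_derivative (\<lambda>w. g1 c' (transition c c' x) (tr1 c c' x w))) (at x)"
    by (rule has_derivative_compose[OF tC(1)[OF assms(3)] C2_dataD(1)[OF metric_C2[OF assms(2)] xi(2)]])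
  have t': "((\<lambda>y. tr1 c c' y a) has_derivative (\<lambda>w. tr2 c c' x w a)) (at x)" for a
    by (rule has_derivative_blinfun_apply_const, rule tC(2)[OF assms(3)])
  have 2: "((\<lambda>y. bil (metric M c' (transition c c' y)) (tr1 c c' y a) (tr1 c c' y b)) has_derivative
     (\<lambda>w. bil (g1 c' (transition c c' x) (tr1 c c' x w)) (tr1 c c' x a) (tr1 c c' x b)
    + bil (metric M c' (transition c c' x)) (tr2 c c' x w a) (tr1 c c' x b)
    + bil (metric M c' (transition c c' x)) (tr1 c c' x a) (tr2 c c' x w b))) (at x)"
  proof (rule has_derivative_eq_rhs)
    show "((\<lambda>y. bil (metric M c' (transition c c' y)) (tr1 c c' y a) (tr1 c c' y b)) has_derivative
       (\<lambda>w. blinfun_apply (blinfun_apply (metric M c' (transition c c' x)) (tr1 c c' x a)) (tr2 c c' x w b)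
         + blinfun_apply (blinfun_apply (metric M c' (transition c c' x)) (tr2 c c' x w a)
            + blinfun_apply (g1 c' (transition c c' x) (tr1 c c' x w)) (tr1 c c' x a)) (tr1 c c' x b))) (at x)"
      by (rule has_derivative_blinfun_apply, rule has_derivative_blinfun_apply, rule m', rule t', rule t')
  qed (simp add: blinfun.add_left fun_eq_iff)
  have "((\<lambda>y. bil (metric M c y) a b) has_derivative
     (\<lambda>w. bil (g1 c' (transition c c' x) (tr1 c c' x w)) (tr1 c c' x a) (tr1 c c' x b)
    + bil (metric M c' (transition c c' x)) (tr2 c c' x w a) (tr1 c c' x b)
    + bil (metric M c' (transition c c' x)) (tr1 c c' x a) (tr2 c c' x w b))) (at x)"
    by (rule has_derivative_transform_within_open[OF 2 overlap(1)[OF assms(1,2)] assms(3)])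
       (use metric_transform[OF assms(1,2)] in simp)
  with 1 have "(\<lambda>w. bil (g1 c x w) a b)
     = (\<lambda>w. bil (g1 c' (transition c c' x) (tr1 c c' x w)) (tr1 c c' x a) (tr1 c c' x b)
    + bil (metric M c' (transition c c' x)) (tr2 c c' x w a) (tr1 c c' x b)
    + bil (metric M c' (transition c c' x)) (tr1 c c' x a) (tr2 c c' x w b))"
    by (rule has_derivative_unique)
  then show ?thesis by (rule fun_cong)
qed


text \<open>In the Koszul formula the terms that pair \<open>tr1 c c' x u\<close> with a mixed
  second derivative cancel by symmetry of \<open>tr2\<close>; the inhomogeneous term
  \<open>tr2 c c' x u u\<close> is what remains.\<close>

lemma christoffel_transform:
  assumes "c \<in> atlas M" "c' \<in> atlas M" "x \<in> overlap c c'"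
  shows "christoffel M c' (transition c c' x) (tr1 c c' x u) (tr1 c c' x u)
    = tr1 c c' x (christoffel M c x u u) - tr2 c c' x u u"
proof -
  let ?x = "transition c c' x" and ?T = "blinfun_apply (tr1 c c' x)" and ?S = "\<lambda>u v. blinfun_apply (blinfun_apply (tr2 c c' x) u) v"
  let ?m = "\<lambda>u v. bil (metric M c' ?x) u v"
  have xi: "x \<in> chart_img c" "?x \<in> chart_img c'"
    by (rule subsetD[OF overlap(3)[OF assms(1,2)] assms(3)], rule subsetD[OF overlap(3)[OF assms(2,1)] overlap(5)[OF assms]])
  let ?d = "?T (christoffel M c x u u) - ?S u u - christoffel M c' ?x (?T u) (?T u)"
  obtain p where p: "p \<in> chart_dom c" "p \<in> chart_dom c'" "x = chart_map c p"
    using assms(3) unfolding overlap_def by blast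
  have xx: "transition c' c ?x = x"
    unfolding p(3) transition_map[OF assms(1) p(1)] by (rule transition_map[OF assms(2) p(2)])
  have "?m ?d w' = 0" for w'
  proof -
    \<comment> \<open>Every test vector in the chart \<open>c'\<close> is the image of one in the
      chart \<open>c\<close>, where the Koszul formula is expanded.\<close>
    define w where "w = tr1 c' c ?x w'"
    have w': "w' = ?T w"
      using tr1_inverse[OF assms(2,1) overlap(5)[OF assms]] unfolding w_def xx by (rule sym)
    have "2 * ?m (?T (christoffel M c x u u)) (?T w) = koszul (g1 c x) u w"
      using christoffel[OF assms(1) xi(1), of u w] metric_transform[OF assms] by simp
    also have "\<dots> = koszul (g1 c' ?x) (?T u) (?T w) + 2 * ?m (?S u u) (?T w)
        + 2 * (?m (?T u) (?S u w)) - 2 * ?m (?T u) (?S w u)"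
      unfolding koszul_def metric_derivative_transform[OF assms]
        metric_sym[OF assms(2) xi(2), of "?S w u" "?T u"] by (simp only: distrib_left)
    finally have "2 * ?m (?T (christoffel M c x u u)) (?T w) = 2 * ?m (christoffel M c' ?x (?T u) (?T u)) (?T w) + 2 * ?m (?S u u) (?T w)"
      unfolding christoffel[OF assms(2) xi(2)] tr2_symmetric[OF assms, of w u] by simp
    then show ?thesis unfolding w' blinfun.diff_left blinfun.diff_right by linarith
  qed
  then have "?d = 0" by (rule metric_eq_0[OF assms(2) xi(2)])
  then show ?thesis unfolding right_minus_eq by (rule sym)
qed

end

section \<open>Curves and the Riemannian distance\<close>

lemma has_vector_derivative_compose_deriv:
  assumes f: "(f has_derivative F) (at (x t))" and x: "(x has_vector_derivative v) (at t within S)"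
  shows "((\<lambda>s. f (x s)) has_vector_derivative F v) (at t within S)"
proof -
  have "((\<lambda>s. f (x s)) has_derivative (\<lambda>h. F (h *\<^sub>R v))) (at t within S)"
    by (rule has_derivative_compose[OF x[unfolded has_vector_derivative_def] f])
  then show ?thesis
    unfolding has_vector_derivative_def linear_scale[OF has_derivative_linear[OF f]] .
qed

text \<open>Derivatives within \<open>J\<close> may be computed on a relatively open part, such as
  the parameters whose image lies in a given chart.\<close>

lemma at_within_relopen:
  assumes "t \<in> U" "open U"
  shows "at t within (J \<inter> U) = at t within J"
  by (rule at_within_nhd[OF assms]) auto

lemma relatively_open_preimage:
  assumes "continuous_on J \<gamma>" "open V"
  obtains U where "open U" "{t \<in> J. \<gamma> t \<in> V} = J \<inter> U"
proof -
  obtain U where "open U" "U \<inter> J = \<gamma> -` V \<inter> J"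
    using assms unfolding continuous_on_open_invariant by blast
  then show thesis by (intro that[of U]) auto
qed

lemma at_within_interval_nonbot:
  fixes a b t :: real
  assumes "a < b" "t \<in> {a..b}"
  shows "at t within {a..b} \<noteq> bot"
  using assms unfolding trivial_limit_within by simp

context riemannian begin

definition speed :: "(real \<Rightarrow> 'm) \<Rightarrow> real \<Rightarrow> real" where
  "speed \<gamma> t = tangent_norm M (\<gamma> t) (velocity M \<gamma> t)"

lemma in_overlap:
  "p \<in> chart_dom c \<Longrightarrow> p \<in> chart_dom c' \<Longrightarrow> chart_map c p \<in> overlap c c'"
  unfolding overlap_def by blast

lemma chart_derivative_transform:
  assumes c: "c \<in> atlas M" "c' \<in> atlas M" and d: "\<gamma> t \<in> chart_dom c" "\<gamma> t \<in> chart_dom c'"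
    and cont: "continuous_on J \<gamma>" and t: "t \<in> J"
    and v: "((chart_map c \<circ> \<gamma>) has_vector_derivative v) (at t within J)"
  shows "((chart_map c' \<circ> \<gamma>) has_vector_derivative tr1 c c' (chart_map c (\<gamma> t)) v) (at t within J)"
proof -
  obtain U where U: "open U" "{s \<in> J. \<gamma> s \<in> chart_dom c \<inter> chart_dom c'} = J \<inter> U"
    using relatively_open_preimage[OF cont open_Int[OF chart_props(1)[OF c(1)] chart_props(1)[OF c(2)]]] .
  have tU: "t \<in> U" using U(2) t d by blast
  have "((\<lambda>s. transition c c' ((chart_map c \<circ> \<gamma>) s)) has_vector_derivative tr1 c c' (chart_map c (\<gamma> t)) v) (at t within J)"
    by (rule has_vector_derivative_compose_deriv[OF _ v])
       (simp add: C2_dataD(1)[OF transition_C2[OF c] in_overlap[OF d]])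
  then have 1: "((\<lambda>s. transition c c' ((chart_map c \<circ> \<gamma>) s)) has_vector_derivative tr1 c c' (chart_map c (\<gamma> t)) v) (at t within (J \<inter> U))"
    unfolding at_within_relopen[OF tU U(1)] .
  have "((chart_map c' \<circ> \<gamma>) has_vector_derivative tr1 c c' (chart_map c (\<gamma> t)) v) (at t within (J \<inter> U))"
  proof (rule has_vector_derivative_transform[OF _ _ 1])
    show "t \<in> J \<inter> U" using t tU by blast
    fix s assume "s \<in> J \<inter> U"
    then have "\<gamma> s \<in> chart_dom c" using U(2) by blast
    then show "(chart_map c' \<circ> \<gamma>) s = transition c c' ((chart_map c \<circ> \<gamma>) s)"
      using transition_map[OF c(1)] by simp
  qed
  then show ?thesis unfolding at_within_relopen[OF tU U(1)] .
qed

text \<open>Although defined through the reference chart, the tangent norm can be computed in any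
  chart, by the tensor law.\<close>

lemma tangent_norm_chart:
  assumes "c \<in> atlas M" "p \<in> chart_dom c"
  shows "tangent_norm M p (tr1 c (ref_chart M p) (chart_map c p) u) = sqrt (bil (metric M c (chart_map c p)) u u)"
  unfolding tangent_norm_def tangent_inner_def
  using metric_transform[OF assms(1) ref_chart(1) in_overlap[OF assms(2) ref_chart(2)], of u u]
  by (simp add: transition_map[OF assms])

lemma speed_chart:
  assumes c: "c \<in> atlas M" "\<gamma> t \<in> chart_dom c" and J: "open J" "t \<in> J" "continuous_on J \<gamma>"
    and v: "((chart_map c \<circ> \<gamma>) has_vector_derivative v) (at t)"
  shows "speed \<gamma> t = sqrt (bil (metric M c (chart_map c (\<gamma> t))) v v)"
proof -
  have "at t within J = at t" using J(1,2) by (rule at_within_open[rotated])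
  then have "((chart_map (ref_chart M (\<gamma> t)) \<circ> \<gamma>) has_vector_derivative tr1 c (ref_chart M (\<gamma> t)) (chart_map c (\<gamma> t)) v) (at t)"
    using chart_derivative_transform[OF c(1) ref_chart(1) c(2) ref_chart(2) J(3,2)] v by simp
  then have "velocity M \<gamma> t = tr1 c (ref_chart M (\<gamma> t)) (chart_map c (\<gamma> t)) v"
    unfolding velocity_def by (rule vector_derivative_at)
  then show ?thesis unfolding speed_def using tangent_norm_chart[OF c] by simp
qed

lemma speed_nonneg: "speed \<gamma> t \<ge> 0"
  unfolding speed_def tangent_norm_def tangent_inner_def
  by (intro real_sqrt_ge_zero metric_nonneg ref_chart chart_props(5))

lemma C1_curve_on_subset:
  assumes C1: "C1_curve_on M J \<gamma>" and "J' \<subseteq> J"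
  shows "C1_curve_on M J' \<gamma>"
  unfolding C1_curve_on_def
proof (intro conjI ballI)
  show "continuous_on J' \<gamma>" using C1 assms(2) unfolding C1_curve_on_def by (meson continuous_on_subset)
  fix c assume "c \<in> atlas M"
  then obtain v where v: "continuous_on {t\<in>J. \<gamma> t \<in> chart_dom c} v"
    "\<And>t. t\<in>J \<Longrightarrow> \<gamma> t \<in> chart_dom c \<Longrightarrow> ((chart_map c \<circ> \<gamma>) has_vector_derivative v t) (at t within J)"
    using C1 unfolding C1_curve_on_def by blast
  show "\<exists>v. continuous_on {t\<in>J'. \<gamma> t \<in> chart_dom c} v \<and>
    (\<forall>t\<in>J'. \<gamma> t \<in> chart_dom c \<longrightarrow> ((chart_map c \<circ> \<gamma>) has_vector_derivative v t) (at t within J'))"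
  proof (intro exI[of _ v] conjI ballI impI)
    show "continuous_on {t\<in>J'. \<gamma> t \<in> chart_dom c} v"
      by (rule continuous_on_subset[OF v(1)]) (use assms(2) in blast)
    show "((chart_map c \<circ> \<gamma>) has_vector_derivative v t) (at t within J')" if "t \<in> J'" "\<gamma> t \<in> chart_dom c" for t
      by (rule has_vector_derivative_within_subset[OF v(2) assms(2)]) (use that assms(2) in blast)+
  qed
qed

text \<open>\<open>speed\<close> uses two-sided derivatives and a reference chart that jumps with
  \<open>t\<close>, so its values at the end points are not controlled; \<open>\<sigma>\<close> is
  its continuous version, built from derivatives within the interval. The coordinate expressions in
  different charts coincide, so continuity can be checked in one fixed chart near each
  \<open>t\<close>.\<close>

lemma C1_curve_speed:
  assumes C1: "C1_curve_on M {a..b} \<gamma>" and ab: "a < b"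
  shows "\<exists>\<sigma>. continuous_on {a..b} \<sigma> \<and> (\<forall>t\<in>{a<..<b}. speed \<gamma> t = \<sigma> t) \<and>
    (\<forall>c\<in>atlas M. \<forall>t\<in>{a..b}. \<forall>v. \<gamma> t \<in> chart_dom c \<longrightarrow>
      ((chart_map c \<circ> \<gamma>) has_vector_derivative v) (at t within {a..b}) \<longrightarrow>
      \<sigma> t = sqrt (bil (metric M c (chart_map c (\<gamma> t))) v v))"
proof -
  let ?J = "{a..b}"
  have cont: "continuous_on ?J \<gamma>" using C1 unfolding C1_curve_on_def by blast
  have "\<forall>c\<in>atlas M. \<exists>v. continuous_on {t\<in>?J. \<gamma> t \<in> chart_dom c} v \<and>
    (\<forall>t\<in>?J. \<gamma> t \<in> chart_dom c \<longrightarrow> ((chart_map c \<circ> \<gamma>) has_vector_derivative v t) (at t within ?J))"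
    using C1 unfolding C1_curve_on_def by blast
  from bchoice[OF this] obtain v where
    v0: "\<forall>c\<in>atlas M. continuous_on {t\<in>?J. \<gamma> t \<in> chart_dom c} (v c) \<and>
      (\<forall>t\<in>?J. \<gamma> t \<in> chart_dom c \<longrightarrow> ((chart_map c \<circ> \<gamma>) has_vector_derivative v c t) (at t within ?J))" ..
  have vc: "continuous_on {t\<in>?J. \<gamma> t \<in> chart_dom c} (v c)" if "c \<in> atlas M" for c
    using v0 that by blast
  have vd: "((chart_map c \<circ> \<gamma>) has_vector_derivative v c t) (at t within ?J)"
    if "c \<in> atlas M" "t\<in>?J" "\<gamma> t \<in> chart_dom c" for c t
    using v0 that by blast
  have vu: "w = v c t" if "c \<in> atlas M" "t\<in>?J" "\<gamma> t \<in> chart_dom c"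
     "((chart_map c \<circ> \<gamma>) has_vector_derivative w) (at t within ?J)" for c t w
    by (rule vector_derivative_unique_within[OF at_within_interval_nonbot[OF ab that(2)] that(4) vd[OF that(1-3)]])
  define ex where "ex c t = sqrt (bil (metric M c (chart_map c (\<gamma> t))) (v c t) (v c t))" for c t
  define \<sigma> where "\<sigma> t = ex (ref_chart M (\<gamma> t)) t" for t
  have ex: "\<sigma> t = ex c t" if "c \<in> atlas M" "t \<in> ?J" "\<gamma> t \<in> chart_dom c" for c t
  proof -
    let ?r = "ref_chart M (\<gamma> t)"
    have "v ?r t = tr1 c ?r (chart_map c (\<gamma> t)) (v c t)"
      by (rule vu[OF ref_chart(1) that(2) ref_chart(2), symmetric])
         (rule chart_derivative_transform[OF that(1) ref_chart(1) that(3) ref_chart(2) cont that(2) vd[OF that]])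
    then show ?thesis unfolding \<sigma>_def ex_def
      using metric_transform[OF that(1) ref_chart(1) in_overlap[OF that(3) ref_chart(2)], of "v c t" "v c t"]
      by (simp add: transition_map[OF that(1,3)])
  qed
  have "continuous_on ?J \<sigma>"
    unfolding continuous_on_eq_continuous_within
  proof
    fix t assume t: "t \<in> ?J"
    define c where "c = ref_chart M (\<gamma> t)"
    have c: "c \<in> atlas M" "\<gamma> t \<in> chart_dom c" unfolding c_def using ref_chart by auto
    obtain U where U: "open U" "{s \<in> ?J. \<gamma> s \<in> chart_dom c} = ?J \<inter> U"
      using relatively_open_preimage[OF cont chart_props(1)[OF c(1)]] .
    have tU: "t \<in> U" using U(2) t c by blast
    have JU: "\<And>s. s \<in> ?J \<inter> U \<Longrightarrow> \<gamma> s \<in> chart_dom c" using U(2) by blast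
    have g: "continuous_on (?J \<inter> U) \<gamma>" by (rule continuous_on_subset[OF cont]) blast
    have x: "continuous_on (?J \<inter> U) (\<lambda>t. chart_map c (\<gamma> t))"
      by (rule continuous_on_compose2[OF chart_props(3)[OF c(1)] g]) (use JU in blast)
    have m: "continuous_on (?J \<inter> U) (\<lambda>t. metric M c (chart_map c (\<gamma> t)))"
      by (rule continuous_on_compose2[OF C2_dataD(5)[OF metric_C2[OF c(1)]] x]) (use JU chart_props(5)[OF c(1)] in blast)
    have "continuous_on (?J \<inter> U) (v c)" using vc[OF c(1)] unfolding U(2) .
    then have "continuous_on (?J \<inter> U) (ex c)"
      unfolding ex_def by (intro continuous_on_real_sqrt bounded_bilinear.continuous_on[OF bounded_bilinear_blinfun_apply] m)
    then have "continuous_on (?J \<inter> U) \<sigma>"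
      by (rule continuous_on_eq) (use ex[OF c(1)] JU in auto)
    then have "continuous (at t within (?J \<inter> U)) \<sigma>"
      using t tU unfolding continuous_on_eq_continuous_within by blast
    then show "continuous (at t within ?J) \<sigma>" unfolding at_within_relopen[OF tU U(1)] .
  qed
  moreover have "speed \<gamma> t = \<sigma> t" if t: "t \<in> {a<..<b}" for t
  proof -
    let ?c = "ref_chart M (\<gamma> t)"
    have tJ: "t \<in> ?J" using t by auto
    have "at t within ?J = at t" using t by (simp add: at_within_Icc_at)
    then have "((chart_map ?c \<circ> \<gamma>) has_vector_derivative v ?c t) (at t)"
      using vd[OF ref_chart(1) tJ ref_chart(2)] by simp
    moreover have "continuous_on {a<..<b} \<gamma>" by (rule continuous_on_subset[OF cont]) auto
    ultimately show ?thesis unfolding \<sigma>_def ex_def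
      by (intro speed_chart[OF ref_chart open_greaterThanLessThan t])
  qed
  moreover have "\<sigma> t = sqrt (bil (metric M c (chart_map c (\<gamma> t))) w w)"
    if "c \<in> atlas M" "t \<in> {a..b}" "\<gamma> t \<in> chart_dom c" "((chart_map c \<circ> \<gamma>) has_vector_derivative w) (at t within {a..b})" for c t w
    using ex[OF that(1-3)] vu[OF that] unfolding ex_def by simp
  ultimately show ?thesis by blast
qed

section \<open>Piecewise C1 curves and their length\<close>

text \<open>Arbitrary intervals are allowed because curves get subdivided, reversed and
  concatenated.\<close>

definition pw :: "real \<Rightarrow> real \<Rightarrow> (real \<Rightarrow> 'm) \<Rightarrow> bool" where
  "pw a b \<gamma> \<longleftrightarrow> continuous_on {a..b} \<gamma> \<and>
     (\<exists>S. finite S \<and> (\<forall>c d. a \<le> c \<and> c < d \<and> d \<le> b \<and> {c<..<d} \<inter> S = {} \<longrightarrow> C1_curve_on M {c..d} \<gamma>))"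

lemma piecewise_pw: "piecewise_C1_curve M \<gamma> = pw 0 1 \<gamma>"
  unfolding piecewise_C1_curve_def pw_def by simp

text \<open>Induction on the number of exceptional points strictly inside the interval: split at one
  of them, and both halves contain fewer.\<close>

lemma pw_induct:
  assumes pw: "pw a b \<gamma>" and ab: "a \<le> b"
    and refl: "\<And>c. a \<le> c \<Longrightarrow> c \<le> b \<Longrightarrow> P c c"
    and C1: "\<And>c d. a \<le> c \<Longrightarrow> c < d \<Longrightarrow> d \<le> b \<Longrightarrow> C1_curve_on M {c..d} \<gamma> \<Longrightarrow> P c d"
    and trans: "\<And>c d e. a \<le> c \<Longrightarrow> c \<le> d \<Longrightarrow> d \<le> e \<Longrightarrow> e \<le> b \<Longrightarrow> P c d \<Longrightarrow> P d e \<Longrightarrow> P c e"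
  shows "P a b"
proof -
  obtain S where S: "finite S" "\<And>c d. a \<le> c \<Longrightarrow> c < d \<Longrightarrow> d \<le> b \<Longrightarrow> {c<..<d} \<inter> S = {} \<Longrightarrow> C1_curve_on M {c..d} \<gamma>"
    using pw unfolding pw_def by blast
  have "P c d" if "a \<le> c" "c \<le> d" "d \<le> b" for c d
    using that
  proof (induction "card ({c<..<d} \<inter> S)" arbitrary: c d rule: less_induct)
    case less
    show ?case
    proof (cases "c = d")
      case True then show ?thesis using refl less by simp
    next
      case False
      show ?thesis
      proof (cases "{c<..<d} \<inter> S = {}")
        case True then show ?thesis using C1 S(2) less False by simp
      next
        case ne: False
        then obtain s where s: "c < s" "s < d" "s \<in> S" by auto
        have fin: "finite ({c<..<d} \<inter> S)" using S(1) by blast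
        have "card ({c<..<s} \<inter> S) < card ({c<..<d} \<inter> S)" "card ({s<..<d} \<inter> S) < card ({c<..<d} \<inter> S)"
          by (rule psubset_card_mono[OF fin], use s in auto)+
        then have "P c s" "P s d" using less s by auto
        then show ?thesis using trans[of c s d] less s by simp
      qed
    qed
  qed
  then show ?thesis using ab by simp
qed

lemma pw_subset:
  assumes "pw a b \<gamma>" "a \<le> a'" "b' \<le> b"
  shows "pw a' b' \<gamma>"
proof -
  obtain S where S: "finite S" "\<And>c d. a \<le> c \<and> c < d \<and> d \<le> b \<and> {c<..<d} \<inter> S = {} \<Longrightarrow> C1_curve_on M {c..d} \<gamma>"
    and c: "continuous_on {a..b} \<gamma>"
    using assms(1) unfolding pw_def by blast
  have "continuous_on {a'..b'} \<gamma>" by (rule continuous_on_subset[OF c]) (use assms in auto)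
  then show ?thesis unfolding pw_def
    by (intro conjI exI[of _ S] S(1) allI impI S(2)) (use assms in auto)
qed

text \<open>On a C1 piece \<open>speed\<close> agrees with a continuous function except perhaps at
  the two end points.\<close>

lemma pw_speed_integrable:
  assumes "pw a b \<gamma>" "a \<le> b"
  shows "speed \<gamma> integrable_on {a..b}"
proof (rule pw_induct[OF assms, where P = "\<lambda>a b. speed \<gamma> integrable_on {a..b}"])
  fix c d assume cd: "c < d" and C1: "C1_curve_on M {c..d} \<gamma>"
  obtain \<sigma> where \<sigma>: "continuous_on {c..d} \<sigma>" "\<And>t. t \<in> {c<..<d} \<Longrightarrow> speed \<gamma> t = \<sigma> t"
    using C1_curve_speed[OF C1 cd] by blast
  show "speed \<gamma> integrable_on {c..d}"
    by (rule integrable_spike_finite[of "{c, d}", OF _ _ integrable_continuous_real[OF \<sigma>(1)]]) (use \<sigma>(2) in auto)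
next
  fix c d e :: real assume "c \<le> d" "d \<le> e" "speed \<gamma> integrable_on {c..d}" "speed \<gamma> integrable_on {d..e}"
  then show "speed \<gamma> integrable_on {c..e}" by (rule Henstock_Kurzweil_Integration.integrable_combine)
qed (rule integrable_on_refl[where 'a=real, unfolded cbox_interval])

text \<open>The derivative of the real function \<open>\<Phi>\<close>, length divided by
  \<open>sqrt k\<close>, dominates the norm of the chart velocity. The mean value inequality then
  bounds the displacement without any vector-valued integral.\<close>

lemma pw_chart_displacement:
  assumes pw: "pw a b \<gamma>" and ab: "a \<le> b" and c: "c \<in> atlas M" and k: "k > 0"
    and img: "\<And>t. t \<in> {a..b} \<Longrightarrow> \<gamma> t \<in> chart_dom c \<and> (\<forall>u. k * (norm u)\<^sup>2 \<le> bil (metric M c (chart_map c (\<gamma> t))) u u)"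
  shows "norm (chart_map c (\<gamma> b) - chart_map c (\<gamma> a)) \<le> integral {a..b} (speed \<gamma>) / sqrt k"
proof (rule pw_induct[OF pw ab, where P = "\<lambda>a b. norm (chart_map c (\<gamma> b) - chart_map c (\<gamma> a)) \<le> integral {a..b} (speed \<gamma>) / sqrt k"])
  fix p q assume pq: "a \<le> p" "p < q" "q \<le> b" and C1: "C1_curve_on M {p..q} \<gamma>"
  obtain \<sigma> where \<sigma>: "continuous_on {p..q} \<sigma>" "\<And>t. t \<in> {p<..<q} \<Longrightarrow> speed \<gamma> t = \<sigma> t"
    "\<And>c t v. c \<in> atlas M \<Longrightarrow> t \<in> {p..q} \<Longrightarrow> \<gamma> t \<in> chart_dom c \<Longrightarrow>
      ((chart_map c \<circ> \<gamma>) has_vector_derivative v) (at t within {p..q}) \<Longrightarrow>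
      \<sigma> t = sqrt (bil (metric M c (chart_map c (\<gamma> t))) v v)"
    using C1_curve_speed[OF C1 pq(2)] by blast
  obtain v where v: "\<And>t. t\<in>{p..q} \<Longrightarrow> \<gamma> t \<in> chart_dom c \<Longrightarrow> ((chart_map c \<circ> \<gamma>) has_vector_derivative v t) (at t within {p..q})"
    using C1 c unfolding C1_curve_on_def by blast
  have vd: "((chart_map c \<circ> \<gamma>) has_vector_derivative v t) (at t within {p..q})" if "t \<in> {p..q}" for t
    by (rule v[OF that]) (use img[of t] that pq in auto)
  define \<Phi> where "\<Phi> t = integral {p..t} \<sigma> / sqrt k" for t
  have \<Phi>: "(\<Phi> has_vector_derivative \<sigma> t / sqrt k) (at t within {p..q})" if "t \<in> {p..q}" for t
    unfolding \<Phi>_def by (rule has_vector_derivative_divide, rule integral_has_vector_derivative[OF \<sigma>(1) that])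
  have "norm ((chart_map c \<circ> \<gamma>) q - (chart_map c \<circ> \<gamma>) p) \<le> \<Phi> q - \<Phi> p"
  proof (rule differentiable_bound_general[OF pq(2), where f' = v and \<phi>' = "\<lambda>t. \<sigma> t / sqrt k"])
    show "continuous_on {p..q} (chart_map c \<circ> \<gamma>)" "continuous_on {p..q} \<Phi>"
      using continuous_on_vector_derivative[OF vd] continuous_on_vector_derivative[OF \<Phi>] by auto
    fix t assume t: "p < t" "t < q"
    then have tq: "t \<in> {p..q}" and at: "at t within {p..q} = at t" by (auto simp: at_within_Icc_at)
    show "((chart_map c \<circ> \<gamma>) has_vector_derivative v t) (at t)" using vd[OF tq] unfolding at .
    show "(\<Phi> has_vector_derivative \<sigma> t / sqrt k) (at t)" using \<Phi>[OF tq] unfolding at .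
    have tab: "t \<in> {a..b}" using t pq by auto
    have "\<sigma> t = sqrt (bil (metric M c (chart_map c (\<gamma> t))) (v t) (v t))"
      by (rule \<sigma>(3)[OF c tq _ vd[OF tq]]) (use img[OF tab] in blast)
    moreover have "sqrt (k * (norm (v t))\<^sup>2) \<le> sqrt (bil (metric M c (chart_map c (\<gamma> t))) (v t) (v t))"
      using img[OF tab] by (intro real_sqrt_le_mono) blast
    moreover have "sqrt (k * (norm (v t))\<^sup>2) = sqrt k * norm (v t)" by (simp add: real_sqrt_mult)
    ultimately show "norm (v t) \<le> \<sigma> t / sqrt k" using k by (simp add: field_simps)
  qed
  moreover have "integral {p..q} \<sigma> = integral {p..q} (speed \<gamma>)"
    by (rule integral_spike[of "{p, q}"]) (use \<sigma>(2) in auto)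
  ultimately show "norm (chart_map c (\<gamma> q) - chart_map c (\<gamma> p)) \<le> integral {p..q} (speed \<gamma>) / sqrt k"
    unfolding \<Phi>_def by simp
next
  fix p q r :: real assume o: "a \<le> p" "p \<le> q" "q \<le> r" "r \<le> b"
    and 1: "norm (chart_map c (\<gamma> q) - chart_map c (\<gamma> p)) \<le> integral {p..q} (speed \<gamma>) / sqrt k"
    and 2: "norm (chart_map c (\<gamma> r) - chart_map c (\<gamma> q)) \<le> integral {q..r} (speed \<gamma>) / sqrt k"
  have "integral {p..q} (speed \<gamma>) + integral {q..r} (speed \<gamma>) = integral {p..r} (speed \<gamma>)"
    by (rule Henstock_Kurzweil_Integration.integral_combine[OF o(2,3) pw_speed_integrable[OF pw_subset[OF pw o(1,4)]]])
      (use o in linarith)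
  then have "integral {p..r} (speed \<gamma>) / sqrt k = integral {p..q} (speed \<gamma>) / sqrt k + integral {q..r} (speed \<gamma>) / sqrt k"
    by (metis add_divide_distrib)
  moreover have "norm (chart_map c (\<gamma> r) - chart_map c (\<gamma> p)) \<le> norm (chart_map c (\<gamma> r) - chart_map c (\<gamma> q)) + norm (chart_map c (\<gamma> q) - chart_map c (\<gamma> p))"
    using norm_triangle_ineq[of "chart_map c (\<gamma> r) - chart_map c (\<gamma> q)" "chart_map c (\<gamma> q) - chart_map c (\<gamma> p)"] by simp
  ultimately show "norm (chart_map c (\<gamma> r) - chart_map c (\<gamma> p)) \<le> integral {p..r} (speed \<gamma>) / sqrt k"
    using 1 2 by linarith
qed (use k in simp)


lemma pw_differentiable:
  assumes pw: "pw a b \<gamma>"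
  shows "\<exists>S. finite S \<and> (\<forall>t\<in>{a<..<b} - S. \<exists>v. ((chart_map (ref_chart M (\<gamma> t)) \<circ> \<gamma>) has_vector_derivative v) (at t))"
proof -
  obtain S where S: "finite S" "\<And>c d. a \<le> c \<and> c < d \<and> d \<le> b \<and> {c<..<d} \<inter> S = {} \<Longrightarrow> C1_curve_on M {c..d} \<gamma>"
    using pw unfolding pw_def by blast
  have "\<exists>v. ((chart_map (ref_chart M (\<gamma> t)) \<circ> \<gamma>) has_vector_derivative v) (at t)" if t: "t \<in> {a<..<b} - S" for t
  proof -
    have "open ({a<..<b} - S)" using S(1) by (simp add: finite_imp_closed open_Diff)
    then obtain e where e: "e > 0" "cball t e \<subseteq> {a<..<b} - S" using t open_contains_cball by blast
    have sub: "{t - e..t + e} \<subseteq> {a<..<b} - S" using e(2) by (simp add: cball_eq_atLeastAtMost)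
    have ends: "t - e \<in> {t - e..t + e}" "t + e \<in> {t - e..t + e}" using e(1) by auto
    have "{t - e<..<t + e} \<subseteq> {t - e..t + e}" by auto
    then have "{t - e<..<t + e} \<inter> S = {}" using sub by blast
    moreover have "a \<le> t - e" "t + e \<le> b" using subsetD[OF sub ends(1)] subsetD[OF sub ends(2)] by auto
    ultimately have C1: "C1_curve_on M {t - e..t + e} \<gamma>" using S(2)[of "t - e" "t + e"] e(1) by simp
    have "\<exists>v. ((chart_map (ref_chart M (\<gamma> t)) \<circ> \<gamma>) has_vector_derivative v) (at t within {t - e..t + e})"
      using C1 ref_chart e(1) unfolding C1_curve_on_def by force
    moreover have "at t within {t - e..t + e} = at t" using e(1) by (simp add: at_within_Icc_at)
    ultimately show ?thesis by simp
  qed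
  then show ?thesis using S(1) by blast
qed

lemma C1_curve_on_affine:
  assumes C1: "C1_curve_on M J \<gamma>" and J: "(\<lambda>t. m * t + q) ` J' \<subseteq> J"
  shows "C1_curve_on M J' (\<lambda>t. \<gamma> (m * t + q))"
  unfolding C1_curve_on_def
proof (intro conjI ballI)
  let ?h = "\<lambda>t. m * t + q"
  have h: "continuous_on J' ?h" by (intro continuous_intros)
  show "continuous_on J' (\<lambda>t. \<gamma> (m * t + q))"
    using C1 unfolding C1_curve_on_def by (intro continuous_on_compose2[OF _ h J]) blast
  fix c assume "c \<in> atlas M"
  then obtain v where v: "continuous_on {t\<in>J. \<gamma> t \<in> chart_dom c} v"
    "\<And>t. t\<in>J \<Longrightarrow> \<gamma> t \<in> chart_dom c \<Longrightarrow> ((chart_map c \<circ> \<gamma>) has_vector_derivative v t) (at t within J)"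
    using C1 unfolding C1_curve_on_def by blast
  show "\<exists>v. continuous_on {t \<in> J'. \<gamma> (m * t + q) \<in> chart_dom c} v \<and>
     (\<forall>t\<in>J'. \<gamma> (m * t + q) \<in> chart_dom c \<longrightarrow>
        ((chart_map c \<circ> (\<lambda>t. \<gamma> (m * t + q))) has_vector_derivative v t) (at t within J'))"
  proof (intro exI[of _ "\<lambda>t. m *\<^sub>R v (?h t)"] conjI ballI impI)
    have "continuous_on {t \<in> J'. \<gamma> (m * t + q) \<in> chart_dom c} (\<lambda>t. v (?h t))"
      by (rule continuous_on_compose2[OF v(1)]) (use J in \<open>auto intro!: continuous_intros\<close>)
    then show "continuous_on {t \<in> J'. \<gamma> (m * t + q) \<in> chart_dom c} (\<lambda>t. m *\<^sub>R v (?h t))"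
      by (intro continuous_intros)
    fix t assume t: "t \<in> J'" "\<gamma> (m * t + q) \<in> chart_dom c"
    have hJ: "?h t \<in> J" using J t(1) by blast
    have "((chart_map c \<circ> \<gamma> \<circ> ?h) has_vector_derivative m *\<^sub>R v (?h t)) (at t within J')"
    proof (rule vector_diff_chain_within)
      show "(?h has_vector_derivative m) (at t within J')"
        by (auto intro!: derivative_eq_intros simp: has_vector_derivative_def)
      show "((chart_map c \<circ> \<gamma>) has_vector_derivative v (?h t)) (at (?h t) within ?h ` J')"
        by (rule has_vector_derivative_within_subset[OF v(2)[OF hJ t(2)] J])
    qed
    then show "((chart_map c \<circ> (\<lambda>t. \<gamma> (m * t + q))) has_vector_derivative m *\<^sub>R v (?h t)) (at t within J')"
      by (simp add: o_def)
  qed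
qed

lemma tangent_norm_scaleR: "tangent_norm M p (m *\<^sub>R u) = \<bar>m\<bar> * tangent_norm M p u"
  unfolding tangent_norm_def tangent_inner_def
  by (simp add: blinfun.scaleR_left blinfun.scaleR_right real_sqrt_mult flip: mult.assoc)

text \<open>\<open>m\<close> may be negative, which reverses the curve.\<close>

lemma pw_affine:
  assumes pw: "pw a b \<gamma>" and ab: "a \<le> b" and m: "m \<noteq> 0" and im: "(\<lambda>t. m * t + q) ` {a'..b'} = {a..b}" and ab': "a' \<le> b'"
  shows "pw a' b' (\<lambda>t. \<gamma> (m * t + q))"
    and "integral {a'..b'} (speed (\<lambda>t. \<gamma> (m * t + q))) = integral {a..b} (speed \<gamma>)"
proof -
  let ?h = "\<lambda>t. m * t + q"
  have inj: "inj_on ?h X" for X using m by (auto simp: inj_on_def)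
  obtain S where S: "finite S" "\<And>c d. a \<le> c \<and> c < d \<and> d \<le> b \<and> {c<..<d} \<inter> S = {} \<Longrightarrow> C1_curve_on M {c..d} \<gamma>"
    and cont: "continuous_on {a..b} \<gamma>"
    using pw unfolding pw_def by blast
  have fin: "finite (?h -` S)" if "finite S" for S :: "real set" by (rule finite_vimageI[OF that inj])
  show "pw a' b' (\<lambda>t. \<gamma> (?h t))"
    unfolding pw_def
  proof (intro conjI exI[of _ "?h -` S"] allI impI)
    show "continuous_on {a'..b'} (\<lambda>t. \<gamma> (?h t))"
      by (rule continuous_on_compose2[OF cont]) (use im in \<open>auto intro!: continuous_intros\<close>)
    show "finite (?h -` S)" by (rule fin[OF S(1)])
    fix c d assume cd: "a' \<le> c \<and> c < d \<and> d \<le> b' \<and> {c<..<d} \<inter> ?h -` S = {}"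
    \<comment> \<open>\<open>min\<close> and \<open>max\<close> treat both orientations at
      once.\<close>
    define lo hi where "lo = min (?h c) (?h d)" and "hi = max (?h c) (?h d)"
    have "?h c \<in> {a..b}" "?h d \<in> {a..b}" using cd im by (metis atLeastAtMost_iff imageI less_imp_le order_trans)+
    then have 1: "a \<le> lo" "hi \<le> b" unfolding lo_def hi_def by auto
    have "?h c \<noteq> ?h d" using cd m by simp
    then have 2: "lo < hi" unfolding lo_def hi_def by linarith
    have 3: "{lo<..<hi} \<inter> S = {}"
    proof (rule ccontr)
      assume "{lo<..<hi} \<inter> S \<noteq> {}"
      then obtain s where s: "lo < s" "s < hi" "s \<in> S" by auto
      define t where "t = (s - q) / m"
      have st: "s = ?h t" unfolding t_def using m by simp
      have "c < t \<and> t < d"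
      proof (cases "m > 0")
        case True
        then have "lo = ?h c" "hi = ?h d" unfolding lo_def hi_def using cd by auto
        then show ?thesis using s(1,2) True unfolding st by simp
      next
        case False
        then have "m < 0" using m by simp
        moreover from this have "lo = ?h d" "hi = ?h c" unfolding lo_def hi_def using cd by auto
        ultimately show ?thesis using s(1,2) unfolding st by simp
      qed
      then have "t \<in> {c<..<d} \<inter> ?h -` S" using s(3) st by auto
      then show False using cd by blast
    qed
    have "?h ` {c..d} \<subseteq> {lo..hi}"
    proof (cases "m > 0")
      case True then show ?thesis unfolding lo_def hi_def by (auto simp: min_le_iff_disj le_max_iff_disj)
    next
      case False then show ?thesis using m unfolding lo_def hi_def
        by (auto simp: min_le_iff_disj le_max_iff_disj not_less)
    qed
    then show "C1_curve_on M {c..d} (\<lambda>t. \<gamma> (?h t))"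
      by (rule C1_curve_on_affine[OF S(2)[OF conjI[OF 1(1) conjI[OF 2 conjI[OF 1(2) 3]]]]])
  qed
  obtain N where N: "finite N" "\<And>t. t \<in> {a<..<b} - N \<Longrightarrow> \<exists>v. ((chart_map (ref_chart M (\<gamma> t)) \<circ> \<gamma>) has_vector_derivative v) (at t)"
    using pw_differentiable[OF pw] by blast
  \<comment> \<open>The chain rule needs a two-sided derivative of \<open>\<gamma>\<close> at
    \<open>?h t\<close>, so finitely many parameters are discarded, among them those mapped to the
    end points.\<close>
  have sp: "speed (\<lambda>t. \<gamma> (?h t)) t = \<bar>m\<bar> * speed \<gamma> (?h t)" if t: "t \<in> {a'..b'} - ?h -` (N \<union> {a, b})" for t
  proof -
    have "?h t \<in> {a..b}" using im t by blast
    then have "?h t \<in> {a<..<b} - N" using t by auto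
    then obtain v where v: "((chart_map (ref_chart M (\<gamma> (?h t))) \<circ> \<gamma>) has_vector_derivative v) (at (?h t))" using N(2) by blast
    have "((chart_map (ref_chart M (\<gamma> (?h t))) \<circ> \<gamma> \<circ> ?h) has_vector_derivative m *\<^sub>R v) (at t)"
      by (rule vector_diff_chain_at[where f = ?h, OF _ v]) (auto intro!: derivative_eq_intros simp: has_vector_derivative_def)
    then have "velocity M (\<lambda>t. \<gamma> (?h t)) t = m *\<^sub>R v"
      unfolding velocity_def by (intro vector_derivative_at) (simp add: o_def)
    moreover have "velocity M \<gamma> (?h t) = v" unfolding velocity_def by (rule vector_derivative_at[OF v])
    ultimately show ?thesis unfolding speed_def by (simp add: tangent_norm_scaleR)
  qed
  have "(speed \<gamma> has_integral integral {a..b} (speed \<gamma>)) (cbox a b)"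
    using pw_speed_integrable[OF pw ab] by (simp add: has_integral_integral)
  from has_integral_affinity[OF this m, of q]
  have 1: "((\<lambda>t. speed \<gamma> (?h t)) has_integral (1 / \<bar>m\<bar>) * integral {a..b} (speed \<gamma>)) ((\<lambda>x. (1 / m) * x + - ((1 / m) * q)) ` {a..b})"
    by simp
  have "(\<lambda>x. (1 / m) * x + - ((1 / m) * q)) ` {a..b} = {a'..b'}"
  proof -
    have "(\<lambda>x. (1 / m) * x + - ((1 / m) * q)) (?h t) = t" for t using m by (simp add: field_simps)
    then show ?thesis unfolding im[symmetric] image_image by simp
  qed
  with 1 have "((\<lambda>t. speed \<gamma> (?h t)) has_integral (1 / \<bar>m\<bar>) * integral {a..b} (speed \<gamma>)) {a'..b'}" by (simp only:)
  from has_integral_mult_right[OF this, of "\<bar>m\<bar>"]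
  have 2: "((\<lambda>t. \<bar>m\<bar> * speed \<gamma> (?h t)) has_integral integral {a..b} (speed \<gamma>)) {a'..b'}"
    using m by simp
  have "(speed (\<lambda>t. \<gamma> (?h t)) has_integral integral {a..b} (speed \<gamma>)) {a'..b'}"
    by (rule has_integral_spike_finite[OF _ _ 2, of "?h -` (N \<union> {a, b})"]) (use fin N(1) sp in auto)
  then show "integral {a'..b'} (speed (\<lambda>t. \<gamma> (?h t))) = integral {a..b} (speed \<gamma>)" by (rule integral_unique)
qed

lemma C1_curve_on_cong:
  assumes C1: "C1_curve_on M J \<gamma>" and eq: "\<And>t. t \<in> J \<Longrightarrow> \<gamma>' t = \<gamma> t"
  shows "C1_curve_on M J \<gamma>'"
  unfolding C1_curve_on_def
proof (intro conjI ballI)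
  show "continuous_on J \<gamma>'" using C1 eq unfolding C1_curve_on_def by (metis continuous_on_cong)
  fix c assume "c \<in> atlas M"
  then obtain v where v: "continuous_on {t\<in>J. \<gamma> t \<in> chart_dom c} v"
    "\<And>t. t\<in>J \<Longrightarrow> \<gamma> t \<in> chart_dom c \<Longrightarrow> ((chart_map c \<circ> \<gamma>) has_vector_derivative v t) (at t within J)"
    using C1 unfolding C1_curve_on_def by blast
  have s: "{t\<in>J. \<gamma>' t \<in> chart_dom c} = {t\<in>J. \<gamma> t \<in> chart_dom c}" using eq by auto
  have "((chart_map c \<circ> \<gamma>') has_vector_derivative v t) (at t within J)" if "t \<in> J" "\<gamma>' t \<in> chart_dom c" for t
    by (rule has_vector_derivative_transform[OF that(1) _ v(2)[OF that(1)]]) (use that eq in auto)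
  then show "\<exists>v. continuous_on {t\<in>J. \<gamma>' t \<in> chart_dom c} v \<and>
    (\<forall>t\<in>J. \<gamma>' t \<in> chart_dom c \<longrightarrow> ((chart_map c \<circ> \<gamma>') has_vector_derivative v t) (at t within J))"
    unfolding s using v(1) by blast
qed

text \<open>Derivatives are local, so the speeds agree on the open interval, whatever the curves do
  outside it.\<close>

lemma pw_cong:
  assumes pw: "pw a b \<gamma>" and eq: "\<And>t. t \<in> {a..b} \<Longrightarrow> \<gamma>' t = \<gamma> t"
  shows "pw a b \<gamma>'" and "integral {a..b} (speed \<gamma>') = integral {a..b} (speed \<gamma>)"
proof -
  obtain S where S: "finite S" "\<And>c d. a \<le> c \<and> c < d \<and> d \<le> b \<and> {c<..<d} \<inter> S = {} \<Longrightarrow> C1_curve_on M {c..d} \<gamma>"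
    and cont: "continuous_on {a..b} \<gamma>"
    using pw unfolding pw_def by blast
  show "pw a b \<gamma>'"
    unfolding pw_def
  proof (intro conjI exI[of _ S] allI impI S(1))
    show "continuous_on {a..b} \<gamma>'" using cont eq by (metis continuous_on_cong)
    fix c d assume cd: "a \<le> c \<and> c < d \<and> d \<le> b \<and> {c<..<d} \<inter> S = {}"
    show "C1_curve_on M {c..d} \<gamma>'"
      by (rule C1_curve_on_cong[OF S(2)[OF cd]]) (use cd eq in auto)
  qed
  have "speed \<gamma> t = speed \<gamma>' t" if t: "t \<in> {a<..<b}" for t
  proof -
    have ev: "\<forall>\<^sub>F s in nhds t. \<gamma>' s = \<gamma> s"
      by (rule eventually_nhds_in_open[OF open_greaterThanLessThan t, THEN eventually_mono]) (use eq in auto)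
    have g: "\<gamma>' t = \<gamma> t" using eq t by auto
    have "vector_derivative (chart_map c \<circ> \<gamma>') (at t) = vector_derivative (chart_map c \<circ> \<gamma>) (at t)" for c :: "('m, 'h) chart"
      by (rule vector_derivative_cong_eq) (use ev in \<open>auto elim: eventually_mono\<close>)
    then show ?thesis unfolding speed_def velocity_def g by simp
  qed
  then show "integral {a..b} (speed \<gamma>') = integral {a..b} (speed \<gamma>)"
    by (intro integral_spike[of "{a, b}"]) auto
qed

lemma pw_combine:
  assumes 1: "pw a b \<gamma>" and 2: "pw b c \<gamma>" and o: "a \<le> b" "b \<le> c"
  shows "pw a c \<gamma>" and "integral {a..c} (speed \<gamma>) = integral {a..b} (speed \<gamma>) + integral {b..c} (speed \<gamma>)"
proof -
  obtain S where S: "finite S" "\<And>p q. a \<le> p \<and> p < q \<and> q \<le> b \<and> {p<..<q} \<inter> S = {} \<Longrightarrow> C1_curve_on M {p..q} \<gamma>"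
    and cS: "continuous_on {a..b} \<gamma>"
    using 1 unfolding pw_def by blast
  obtain T where T: "finite T" "\<And>p q. b \<le> p \<and> p < q \<and> q \<le> c \<and> {p<..<q} \<inter> T = {} \<Longrightarrow> C1_curve_on M {p..q} \<gamma>"
    and cT: "continuous_on {b..c} \<gamma>"
    using 2 unfolding pw_def by blast
  show pw: "pw a c \<gamma>"
    unfolding pw_def
  proof (intro conjI exI[of _ "insert b (S \<union> T)"] allI impI)
    have "continuous_on ({a..b} \<union> {b..c}) \<gamma>" by (intro continuous_on_closed_Un cS cT) auto
    then show "continuous_on {a..c} \<gamma>" using o by (simp add: ivl_disj_un_two_touch)
    show "finite (insert b (S \<union> T))" using S T by simp
    fix p q assume pq: "a \<le> p \<and> p < q \<and> q \<le> c \<and> {p<..<q} \<inter> insert b (S \<union> T) = {}"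
    then have "b \<notin> {p<..<q}" by blast
    then have "q \<le> b \<or> b \<le> p" by auto
    then show "C1_curve_on M {p..q} \<gamma>" using pq S(2)[of p q] T(2)[of p q] by blast
  qed
  show "integral {a..c} (speed \<gamma>) = integral {a..b} (speed \<gamma>) + integral {b..c} (speed \<gamma>)"
    using Henstock_Kurzweil_Integration.integral_combine[OF o pw_speed_integrable[OF pw]] o by simp
qed

lemma curve_length: "curve_length M \<gamma> = integral {0..1} (speed \<gamma>)"
  unfolding curve_length_def speed_def ..

section \<open>The distance as an extended pseudometric\<close>

lemma rdist_le:
  assumes "pw 0 1 \<gamma>" "\<gamma> 0 = p" "\<gamma> 1 = q"
  shows "rdist M p q \<le> ennreal (integral {0..1} (speed \<gamma>))"
  unfolding rdist_def curve_length by (rule INF_lower) (use assms piecewise_pw in auto)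

lemma rdist_less:
  assumes "rdist M p q < r"
  obtains \<gamma> where "pw 0 1 \<gamma>" "\<gamma> 0 = p" "\<gamma> 1 = q" "ennreal (integral {0..1} (speed \<gamma>)) < r"
  using assms unfolding rdist_def curve_length INF_less_iff piecewise_pw by blast

lemma integral_speed_nonneg: "integral {a..b} (speed \<gamma>) \<ge> 0"
  by (cases "speed \<gamma> integrable_on {a..b}")
     (auto intro: Henstock_Kurzweil_Integration.integral_nonneg speed_nonneg simp: not_integrable_integral)

lemma pw_const: "pw a b (\<lambda>_. p)"
  unfolding pw_def C1_curve_on_def
  by (auto simp: o_def intro!: exI[of _ "{}"] exI[of _ "\<lambda>_. 0"])

lemma rdist_refl: "rdist M p p = 0"
proof -
  have "velocity M (\<lambda>_. p) t = 0" for t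
    unfolding velocity_def by (intro vector_derivative_at) (simp add: o_def)
  then have "speed (\<lambda>_. p) t = 0" for t
    unfolding speed_def tangent_norm_def tangent_inner_def by (simp add: blinfun.zero_left)
  then have "speed (\<lambda>_. p) = (\<lambda>_. 0)" by (rule ext)
  then have "integral {0..1} (speed (\<lambda>_. p)) = 0" by simp
  then show ?thesis using rdist_le[OF pw_const, of p p p] by simp
qed

lemma rdist_sym_le: "rdist M q p \<le> rdist M p q"
proof (rule dense_ge)
  fix r assume "rdist M p q < r"
  then obtain \<gamma> where \<gamma>: "pw 0 1 \<gamma>" "\<gamma> 0 = p" "\<gamma> 1 = q" "ennreal (integral {0..1} (speed \<gamma>)) < r"
    by (rule rdist_less)
  have im: "(\<lambda>t. - 1 * t + 1) ` {0..1::real} = {0..1}"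
    by (force simp: image_iff intro: bexI[of _ "1 - _"])
  have "rdist M q p \<le> ennreal (integral {0..1} (speed (\<lambda>t. \<gamma> (- 1 * t + 1))))"
    by (rule rdist_le[OF pw_affine(1)[OF \<gamma>(1) _ _ im]]) (use \<gamma> in auto)
  also have "integral {0..1} (speed (\<lambda>t. \<gamma> (- 1 * t + 1))) = integral {0..1} (speed \<gamma>)"
    by (rule pw_affine(2)[OF \<gamma>(1) _ _ im]) auto
  finally show "rdist M q p \<le> r" using \<gamma>(4) by simp
qed

lemma rdist_sym: "rdist M q p = rdist M p q"
  by (intro antisym rdist_sym_le)

text \<open>Run through both curves at double speed; affine reparametrisation does not change the
  length.\<close>

lemma rdist_triangle_curves:
  assumes 1: "pw 0 1 \<gamma>" "\<gamma> 0 = p" "\<gamma> 1 = q" and 2: "pw 0 1 \<delta>" "\<delta> 0 = q" "\<delta> 1 = r"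
  shows "rdist M p r \<le> ennreal (integral {0..1} (speed \<gamma>)) + ennreal (integral {0..1} (speed \<delta>))"
proof -
  define \<kappa> where "\<kappa> t = (if t \<le> 1/2 then \<gamma> (2 * t + 0) else \<delta> (2 * t + - 1))" for t :: real
  have im: "(\<lambda>t. 2 * t + 0) ` {0..1/2} = {0..1::real}" "(\<lambda>t. 2 * t + - 1) ` {1/2..1} = {0..1::real}"
    by (simp_all only: image_affinity_atLeastAtMost) auto
  have e1: "\<kappa> t = \<gamma> (2 * t + 0)" if "t \<in> {0..1/2}" for t using that unfolding \<kappa>_def by simp
  have e2: "\<kappa> t = \<delta> (2 * t + - 1)" if "t \<in> {1/2..1}" for t
  proof (cases "t = 1/2")
    case True
    show ?thesis unfolding True \<kappa>_def using 1(3) 2(2) by simp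
  next
    case False
    then show ?thesis using that unfolding \<kappa>_def by simp
  qed
  have two: "(2::real) \<noteq> 0" "(0::real) \<le> 1" "(0::real) \<le> 1/2" "(1/2::real) \<le> 1" by auto
  note a1 = pw_affine[OF 1(1) two(2,1) im(1) two(3)] and a2 = pw_affine[OF 2(1) two(2,1) im(2) two(4)]
  have b1: "pw 0 (1/2) \<kappa>" "integral {0..1/2} (speed \<kappa>) = integral {0..1/2} (speed (\<lambda>t. \<gamma> (2 * t + 0)))"
    by (rule pw_cong[OF a1(1)], erule e1)+
  have b2: "pw (1/2) 1 \<kappa>" "integral {1/2..1} (speed \<kappa>) = integral {1/2..1} (speed (\<lambda>t. \<delta> (2 * t + - 1)))"
    by (rule pw_cong[OF a2(1)], erule e2)+
  note c = pw_combine[OF b1(1) b2(1) two(3,4)]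
  have "rdist M p r \<le> ennreal (integral {0..1} (speed \<kappa>))"
    by (rule rdist_le[OF c(1)]) (use 1 2 in \<open>auto simp: \<kappa>_def\<close>)
  also have "integral {0..1} (speed \<kappa>) = integral {0..1} (speed \<gamma>) + integral {0..1} (speed \<delta>)"
    using c(2) unfolding b1(2) b2(2) a1(2) a2(2) .
  finally show ?thesis by (simp add: ennreal_plus integral_speed_nonneg)
qed

lemma rdist_triangle: "rdist M p r \<le> rdist M p q + rdist M q r"
proof (rule ennreal_le_epsilon)
  fix e :: real assume top: "rdist M p q + rdist M q r < top" and e: "0 < e"
  have "rdist M p q < top" "rdist M q r < top" using top by (simp_all add: less_top[symmetric])
  then have "rdist M p q < rdist M p q + ennreal (e / 2)" "rdist M q r < rdist M q r + ennreal (e / 2)"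
    using e by (simp_all add: ennreal_add_left_cancel_less)
  then obtain \<gamma> \<delta> where g: "pw 0 1 \<gamma>" "\<gamma> 0 = p" "\<gamma> 1 = q" "ennreal (integral {0..1} (speed \<gamma>)) < rdist M p q + ennreal (e / 2)"
    and d: "pw 0 1 \<delta>" "\<delta> 0 = q" "\<delta> 1 = r" "ennreal (integral {0..1} (speed \<delta>)) < rdist M q r + ennreal (e / 2)"
    by (elim rdist_less)
  have "rdist M p r \<le> ennreal (integral {0..1} (speed \<gamma>)) + ennreal (integral {0..1} (speed \<delta>))"
    by (rule rdist_triangle_curves[OF g(1-3) d(1-3)])
  also have "\<dots> \<le> (rdist M p q + ennreal (e / 2)) + (rdist M q r + ennreal (e / 2))"
    using g(4) d(4) by (intro add_mono) auto
  also have "\<dots> = rdist M p q + rdist M q r + (ennreal (e / 2) + ennreal (e / 2))" by (simp only: ac_simps)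
  also have "ennreal (e / 2) + ennreal (e / 2) = ennreal e" using e by (simp flip: ennreal_plus)
  finally show "rdist M p r \<le> rdist M p q + rdist M q r + ennreal e" .
qed

section \<open>Comparison of the distance with norms in a chart\<close>

text \<open>The straight coordinate segment is an admissible curve, and its squared speed is the
  metric evaluated on the constant vector \<open>y - x\<close>.\<close>

lemma rdist_chart_segment:
  assumes c: "c \<in> atlas M" and seg: "closed_segment x y \<subseteq> chart_img c" and B: "B \<ge> 0"
    "\<And>z. z \<in> closed_segment x y \<Longrightarrow> bil (metric M c z) (y - x) (y - x) \<le> B\<^sup>2"
  shows "rdist M (chart_inv c x) (chart_inv c y) \<le> ennreal B"
proof -
  define l where "l t = x + t *\<^sub>R (y - x)" for t :: real
  define \<gamma> where "\<gamma> t = chart_inv c (l t)" for t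
  have lseg: "l t \<in> closed_segment x y" if "t \<in> {0..1}" for t
    using that unfolding l_def closed_segment_def by (auto intro!: exI[of _ t] simp: algebra_simps)
  have limg: "l t \<in> chart_img c" if "t \<in> {0..1}" for t using lseg[OF that] seg by blast
  have gdom: "\<gamma> t \<in> chart_dom c" "chart_map c (\<gamma> t) = l t" if "t \<in> {0..1}" for t
    unfolding \<gamma>_def using chart_props(7,8)[OF c] limg[OF that] by auto
  have lc: "continuous_on J l" for J unfolding l_def by (intro continuous_intros)
  have ld: "(l has_vector_derivative (y - x)) (at t within J)" for t J
    unfolding l_def by (auto intro!: derivative_eq_intros simp: has_vector_derivative_def)
  have gc: "continuous_on {0..1} \<gamma>"
    unfolding \<gamma>_def by (rule continuous_on_compose2[OF chart_props(4)[OF c] lc]) (use limg in blast)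
  have C1: "C1_curve_on M {0..1} \<gamma>"
    unfolding C1_curve_on_def
  proof (intro conjI ballI gc)
    fix c' assume c': "c' \<in> atlas M"
    have ov: "l t \<in> overlap c c'" if "t \<in> {0..1}" "\<gamma> t \<in> chart_dom c'" for t
      using in_overlap[OF gdom(1)[OF that(1)] that(2)] gdom(2)[OF that(1)] by simp
    show "\<exists>v. continuous_on {t \<in> {0..1}. \<gamma> t \<in> chart_dom c'} v \<and>
       (\<forall>t\<in>{0..1}. \<gamma> t \<in> chart_dom c' \<longrightarrow> ((chart_map c' \<circ> \<gamma>) has_vector_derivative v t) (at t within {0..1}))"
    proof (intro exI[of _ "\<lambda>t. tr1 c c' (l t) (y - x)"] conjI ballI impI)
      have "continuous_on {t \<in> {0..1}. \<gamma> t \<in> chart_dom c'} (\<lambda>t. tr1 c c' (l t))"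
        by (rule continuous_on_compose2[OF C2_dataD(4)[OF transition_C2[OF c c']] lc]) (use ov in blast)
      then show "continuous_on {t \<in> {0..1}. \<gamma> t \<in> chart_dom c'} (\<lambda>t. tr1 c c' (l t) (y - x))"
        by (rule bounded_linear.continuous_on[OF blinfun.bounded_linear_left])
      fix t :: real assume t: "t \<in> {0..1}" "\<gamma> t \<in> chart_dom c'"
      have "chart_map c' \<circ> \<gamma> = (\<lambda>s. transition c c' (l s))" unfolding \<gamma>_def transition_def by auto
      then show "((chart_map c' \<circ> \<gamma>) has_vector_derivative tr1 c c' (l t) (y - x)) (at t within {0..1})"
        using has_vector_derivative_compose_deriv[where x = l, OF C2_dataD(1)[OF transition_C2[OF c c'] ov[OF t]] ld] by simp
    qed
  qed
  have pw: "pw 0 1 \<gamma>"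
    unfolding pw_def by (intro conjI gc exI[of _ "{}"] allI impI C1_curve_on_subset[OF C1]) auto
  have "speed \<gamma> t \<le> B" if t: "t \<in> {0<..<1}" for t
  proof -
    have tJ: "t \<in> {0..1}" using t by auto
    have "((chart_map c \<circ> \<gamma>) has_vector_derivative (y - x)) (at t within {0..1})"
      by (rule has_vector_derivative_transform[OF tJ _ ld]) (use gdom in auto)
    then have d: "((chart_map c \<circ> \<gamma>) has_vector_derivative (y - x)) (at t)" using t by (simp add: at_within_Icc_at)
    have "continuous_on {0<..<1} \<gamma>" by (rule continuous_on_subset[OF gc]) auto
    from speed_chart[OF c gdom(1)[OF tJ] open_greaterThanLessThan t this d]
    have "speed \<gamma> t = sqrt (bil (metric M c (l t)) (y - x) (y - x))" unfolding gdom(2)[OF tJ] .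
    also have "\<dots> \<le> sqrt (B\<^sup>2)" by (intro real_sqrt_le_mono B(2) lseg tJ)
    finally show ?thesis using B(1) by simp
  qed
  then have le: "(if t \<in> {0, 1} then B else speed \<gamma> t) \<le> B" if "t \<in> {0..1}" for t using that by auto
  \<comment> \<open>At 0 and 1 the two-sided derivative in \<open>speed\<close> depends on
    \<open>\<gamma>\<close> outside the interval; replacing two values leaves the integral
    unchanged.\<close>
  let ?s = "\<lambda>t. if t \<in> {0, 1} then B else speed \<gamma> t"
  have "?s integrable_on {0..1}"
    by (rule integrable_spike_finite[of "{0, 1}", OF _ _ pw_speed_integrable[OF pw]]) auto
  then have "integral {0..1} ?s \<le> integral {0..1} (\<lambda>_::real. B)"
    by (intro integral_le le) auto
  moreover have "integral {0..1} ?s = integral {0..1} (speed \<gamma>)"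
    by (rule integral_spike[of "{0, 1}"]) auto
  ultimately have "integral {0..1} (speed \<gamma>) \<le> B" by simp
  moreover have "rdist M (chart_inv c x) (chart_inv c y) \<le> ennreal (integral {0..1} (speed \<gamma>))"
    by (rule rdist_le[OF pw]) (auto simp: \<gamma>_def l_def)
  ultimately show ?thesis using ennreal_leI order_trans by blast
qed


text \<open>Coercivity at \<open>u0\<close> turns continuity in operator norm into a relative
  comparison of the quadratic forms.\<close>

lemma metric_near:
  assumes c: "c \<in> atlas M" "u0 \<in> chart_img c" and \<eta>: "\<eta> > 0"
  shows "\<exists>r>0. cball u0 r \<subseteq> chart_img c \<and> (\<forall>x\<in>cball u0 r. \<forall>w.
    bil (metric M c x) w w \<le> (1 + \<eta>) * bil (metric M c u0) w w \<and>
    bil (metric M c u0) w w \<le> (1 + \<eta>) * bil (metric M c x) w w)"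
proof -
  obtain k where k: "k > 0" "\<And>u. k * (norm u)\<^sup>2 \<le> bil (metric M c u0) u u" using metric_coercive[OF c] by blast
  \<comment> \<open>With this relative error \<open>s \<le> \<eta>\<close> and
    \<open>(1 + \<eta>) * (1 - s) = 1\<close>, so one estimate yields both inequalities.\<close>
  define s where "s = \<eta> / (1 + \<eta>)"
  have s: "s > 0" "s \<le> \<eta>" "(1 + \<eta>) * (1 - s) = 1" using \<eta> unfolding s_def by (auto simp: field_simps)
  have "isCont (metric M c) u0"
    using C2_dataD(5)[OF metric_C2[OF c(1)]] chart_props(2)[OF c(1)] c(2) by (simp add: continuous_on_eq_continuous_at)
  then obtain d where d: "d > 0" "\<And>x. dist x u0 < d \<Longrightarrow> dist (metric M c x) (metric M c u0) < s * k"
    unfolding continuous_at_eps_delta using s(1) k(1) by (meson mult_pos_pos)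
  obtain r0 where r0: "r0 > 0" "cball u0 r0 \<subseteq> chart_img c"
    using chart_props(2)[OF c(1)] c(2) open_contains_cball by blast
  define r where "r = min r0 (d / 2)"
  have "bil (metric M c x) w w \<le> (1 + \<eta>) * bil (metric M c u0) w w \<and>
    bil (metric M c u0) w w \<le> (1 + \<eta>) * bil (metric M c x) w w" if x: "x \<in> cball u0 r" for x w
  proof -
    let ?a = "bil (metric M c u0) w w" and ?b = "bil (metric M c x) w w"
    have "dist x u0 < d" using x d(1) unfolding r_def by (auto simp: dist_commute)
    then have n: "norm (metric M c x - metric M c u0) \<le> s * k" using d(2) unfolding dist_norm by force
    have "\<bar>?b - ?a\<bar> = \<bar>bil (metric M c x - metric M c u0) w w\<bar>" by (simp add: blinfun.diff_left)
    also have "\<dots> \<le> norm (metric M c x - metric M c u0) * norm w * norm w" by (rule norm_bil)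
    also have "\<dots> \<le> (s * k) * norm w * norm w" using n by (intro mult_right_mono) auto
    also have "\<dots> = s * (k * (norm w)\<^sup>2)" by (simp add: power2_eq_square)
    also have "\<dots> \<le> s * ?a" using k(2) s(1) by (intro mult_left_mono) auto
    finally have ab: "\<bar>?b - ?a\<bar> \<le> s * ?a" .
    have a0: "?a \<ge> 0" by (rule metric_nonneg[OF c])
    have "s * ?a \<le> \<eta> * ?a" using s(2) a0 by (rule mult_right_mono)
    then have 1: "?b \<le> (1 + \<eta>) * ?a" using ab by (simp add: distrib_right)
    have "(1 - s) * ?a \<le> ?b" using ab by (simp add: left_diff_distrib)
    then have "(1 + \<eta>) * ((1 - s) * ?a) \<le> (1 + \<eta>) * ?b" using \<eta> by (intro mult_left_mono) auto
    then have 2: "?a \<le> (1 + \<eta>) * ?b" unfolding mult.assoc[symmetric] s(3) by simp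
    show ?thesis using 1 2 by simp
  qed
  moreover have "r > 0" "cball u0 r \<subseteq> chart_img c" using r0 d unfolding r_def by (auto simp: subset_iff)
  ultimately show ?thesis by blast
qed

text \<open>A short curve from \<open>p\<close> cannot leave a small coordinate ball: at the first exit time its
  coordinates would converge inside the ball, and limits in the manifold are unique.\<close>

lemma rdist_imp_topology:
  assumes U: "open U" "p \<in> U"
  shows "\<exists>e>0. \<forall>q. rdist M p q < ennreal e \<longrightarrow> q \<in> U"
proof -
  define c where "c = ref_chart M p"
  have c: "c \<in> atlas M" and pc: "p \<in> chart_dom c" unfolding c_def using ref_chart by auto
  define u0 where "u0 = chart_map c p"
  have u0: "u0 \<in> chart_img c" unfolding u0_def by (rule chart_props(5)[OF c pc])
  obtain k0 where k0: "k0 > 0" "\<And>u. k0 * (norm u)\<^sup>2 \<le> bil (metric M c u0) u u" using metric_coercive[OF c u0] by blast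
  obtain r0 where r0: "r0 > 0" "cball u0 r0 \<subseteq> chart_img c"
    "\<forall>x\<in>cball u0 r0. \<forall>w. bil (metric M c x) w w \<le> (1 + 1) * bil (metric M c u0) w w \<and>
    bil (metric M c u0) w w \<le> (1 + 1) * bil (metric M c x) w w"
    using metric_near[OF c u0 zero_less_one] by blast
  define k where "k = k0 / 2"
  have k: "k > 0" unfolding k_def using k0 by simp
  have coer: "k * (norm u)\<^sup>2 \<le> bil (metric M c x) u u" if "x \<in> cball u0 r0" for x u
  proof -
    have "bil (metric M c u0) u u \<le> (1 + 1) * bil (metric M c x) u u" using r0(3) that by blast
    then have "k0 * (norm u)\<^sup>2 \<le> (1 + 1) * bil (metric M c x) u u" using k0(2)[of u] by linarith
    then show ?thesis unfolding k_def by simp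
  qed
  have "open {x \<in> chart_img c. chart_inv c x \<in> U}" by (rule open_chart_inv_preimage[OF c U(1)])
  moreover have "u0 \<in> {x \<in> chart_img c. chart_inv c x \<in> U}"
    using u0 U(2) chart_props(6)[OF c pc] unfolding u0_def by simp
  ultimately obtain r1 where r1: "r1 > 0" "cball u0 r1 \<subseteq> {x \<in> chart_img c. chart_inv c x \<in> U}"
    using open_contains_cball by blast
  define r where "r = min r0 r1"
  have r: "r > 0" unfolding r_def using r0 r1 by simp
  define V where "V = {m \<in> chart_dom c. chart_map c m \<in> ball u0 r}"
  have Vo: "open V" unfolding V_def by (rule open_chart_preimage[OF c open_ball])
  have VU: "V \<subseteq> U"
  proof
    fix m assume m: "m \<in> V"
    then have "chart_map c m \<in> cball u0 r1" unfolding V_def r_def by auto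
    then have "chart_inv c (chart_map c m) \<in> U" using r1(2) by blast
    then show "m \<in> U" using chart_props(6)[OF c] m unfolding V_def by simp
  qed
  \<comment> \<open>On the ball the metric is at least \<open>k\<close> times the squared norm, so a
    curve shorter than \<open>sqrt k * r\<close> moves its coordinates by less than \<open>r\<close>
    as long as it stays there.\<close>
  have "q \<in> V" if q: "rdist M p q < ennreal (sqrt k * r)" for q
  proof (rule ccontr)
    assume qV: "q \<notin> V"
    obtain \<gamma> where pw: "pw 0 1 \<gamma>" and g0: "\<gamma> 0 = p" and g1: "\<gamma> 1 = q"
      and len: "ennreal (integral {0..1} (speed \<gamma>)) < ennreal (sqrt k * r)"
      using q by (rule rdist_less)
    have L: "integral {0..1} (speed \<gamma>) < sqrt k * r"
      using len integral_speed_nonneg by (simp add: ennreal_less_iff)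
    have cont: "continuous_on {0..1} \<gamma>" using pw unfolding pw_def by blast
    define I where "I t = integral {0..t} (speed \<gamma>)" for t
    have int: "speed \<gamma> integrable_on {0..1}" by (rule pw_speed_integrable[OF pw]) simp
    have Ic: "continuous_on {0..1} I" unfolding I_def by (rule indefinite_integral_continuous_1[OF int])
    \<comment> \<open>The times spent outside \<open>V\<close>; this set is closed, so its infimum
      is a first exit time.\<close>
    define T where "T = {0..1} \<inter> \<gamma> -` (- V)"
    have "closed T" unfolding T_def
      by (rule continuous_closed_preimage[OF cont]) (use Vo in auto)
    moreover have "1 \<in> T" unfolding T_def using g1 qV by simp
    moreover have "bdd_below T" unfolding T_def by (rule bdd_belowI[of _ 0]) auto
    ultimately have tT: "Inf T \<in> T" by (intro closed_contains_Inf) auto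
    define \<tau> where "\<tau> = Inf T"
    have \<tau>: "\<tau> \<in> {0..1}" "\<gamma> \<tau> \<notin> V" using tT unfolding \<tau>_def T_def by auto
    have before: "\<gamma> t \<in> V" if "0 \<le> t" "t < \<tau>" for t
    proof (rule ccontr)
      assume "\<gamma> t \<notin> V"
      then have "t \<in> T" unfolding T_def using that \<tau>(1) by auto
      then have "\<tau> \<le> t" unfolding \<tau>_def by (intro cInf_lower \<open>bdd_below T\<close>)
      then show False using that by simp
    qed
    have "p \<in> V" unfolding V_def using pc r by (simp add: u0_def)
    then have \<tau>0: "\<tau> > 0" using \<tau> g0 by (cases "\<tau> = 0") auto
    have inb: "\<gamma> t \<in> chart_dom c" "chart_map c (\<gamma> t) \<in> cball u0 r0" if "0 \<le> t" "t < \<tau>" for t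
      using before[OF that] unfolding V_def r_def by auto
    have disp: "norm (chart_map c (\<gamma> t) - chart_map c (\<gamma> s)) \<le> (I t - I s) / sqrt k" if st: "0 \<le> s" "s \<le> t" "t < \<tau>" for s t
    proof -
      have disp0: "norm (chart_map c (\<gamma> t) - chart_map c (\<gamma> s)) \<le> integral {s..t} (speed \<gamma>) / sqrt k"
      proof (rule pw_chart_displacement[OF pw_subset[OF pw] st(2) c k])
        show "t \<le> 1" using st \<tau> by simp
        fix a assume "a \<in> {s..t}"
        then have "0 \<le> a" "a < \<tau>" using st by auto
        then show "\<gamma> a \<in> chart_dom c \<and> (\<forall>u. k * (norm u)\<^sup>2 \<le> bil (metric M c (chart_map c (\<gamma> a))) u u)"
          using inb coer by blast
      qed (use st in simp)
      have I: "I s + integral {s..t} (speed \<gamma>) = I t"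
        unfolding I_def by (rule Henstock_Kurzweil_Integration.integral_combine)
          (use st \<tau> in \<open>auto intro: pw_speed_integrable[OF pw_subset[OF pw]]\<close>)
      from I have "integral {s..t} (speed \<gamma>) = I t - I s" by simp
      with disp0 show ?thesis by simp
    qed
    \<comment> \<open>Times tending to the exit time but strictly before it, because
      \<open>\<gamma> \<tau>\<close> might lie outside the chart domain.\<close>
    define s where "s n = \<tau> * (1 - 1 / real (n + 2))" for n
    have s: "0 \<le> s n" "s n < \<tau>" for n
      using \<tau>0 unfolding s_def by (auto simp: field_simps)
    have "(\<lambda>n. \<tau> * (1 - 1 / real (n + 2))) \<longlonglongrightarrow> \<tau> * (1 - 0)"
      by (intro tendsto_intros LIMSEQ_ignore_initial_segment[OF lim_1_over_n])
    then have slim: "s \<longlonglongrightarrow> \<tau>" unfolding s_def by simp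
    have s01: "\<forall>\<^sub>F n in sequentially. s n \<in> {0..1}" by (rule always_eventually) (use s \<tau> in \<open>auto intro: less_imp_le less_le_trans\<close>)
    have "(\<lambda>n. I (s n)) \<longlonglongrightarrow> I \<tau>" by (rule continuous_on_tendsto_compose[OF Ic slim \<tau>(1) s01])
    then have CI: "Cauchy (\<lambda>n. I (s n))" by (rule LIMSEQ_imp_Cauchy)
    define x where "x n = chart_map c (\<gamma> (s n))" for n
    \<comment> \<open>The coordinates inherit the Cauchy property from the continuous length
      function \<open>I\<close>.\<close>
    have xd: "norm (x n - x m) \<le> \<bar>I (s n) - I (s m)\<bar> / sqrt k" for n m
    proof (cases "s m \<le> s n")
      case True
      have "norm (x n - x m) \<le> (I (s n) - I (s m)) / sqrt k" unfolding x_def by (rule disp[OF s(1) True s(2)])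
      also have "\<dots> \<le> \<bar>I (s n) - I (s m)\<bar> / sqrt k" using k by (intro divide_right_mono) auto
      finally show ?thesis .
    next
      case False
      then have "norm (x m - x n) \<le> (I (s m) - I (s n)) / sqrt k" unfolding x_def by (intro disp s) simp
      also have "\<dots> \<le> \<bar>I (s n) - I (s m)\<bar> / sqrt k" using k by (intro divide_right_mono) auto
      finally show ?thesis by (simp add: norm_minus_commute)
    qed
    have "Cauchy x"
    proof (rule metric_CauchyI)
      fix e :: real assume "e > 0"
      then have "sqrt k * e > 0" using k by simp
      from metric_CauchyD[OF CI this] obtain N where N: "\<And>m n. m \<ge> N \<Longrightarrow> n \<ge> N \<Longrightarrow> dist (I (s m)) (I (s n)) < sqrt k * e" by blast
      have "dist (x m) (x n) < e" if "m \<ge> N" "n \<ge> N" for m n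
      proof -
        have "\<bar>I (s m) - I (s n)\<bar> / sqrt k < e" using N[OF that] k by (simp add: dist_real_def field_simps)
        then show ?thesis using xd[of m n] by (simp add: dist_norm)
      qed
      then show "\<exists>M. \<forall>m\<ge>M. \<forall>n\<ge>M. dist (x m) (x n) < e" by blast
    qed
    then obtain w where w: "x \<longlonglongrightarrow> w" using Cauchy_convergent_iff convergent_def by blast
    have "norm (x n - u0) \<le> integral {0..1} (speed \<gamma>) / sqrt k" for n
    proof -
      have "norm (x n - u0) \<le> (I (s n) - I 0) / sqrt k"
        using disp[of 0 "s n"] s[of n] unfolding x_def u0_def g0 by simp
      also have "I (s n) - I 0 \<le> integral {0..1} (speed \<gamma>)"
      proof -
        have "I (s n) + integral {s n..1} (speed \<gamma>) = integral {0..1} (speed \<gamma>)"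
          unfolding I_def by (rule Henstock_Kurzweil_Integration.integral_combine[OF _ _ int])
            (use s[of n] \<tau> in auto)
        moreover have "integral {s n..1} (speed \<gamma>) \<ge> 0" "I 0 \<ge> 0" unfolding I_def by (rule integral_speed_nonneg)+
        ultimately show ?thesis by linarith
      qed
      finally show ?thesis using k by (simp add: divide_right_mono)
    qed
    then have "norm (w - u0) \<le> integral {0..1} (speed \<gamma>) / sqrt k"
      by (intro LIMSEQ_le_const2[OF tendsto_norm[OF tendsto_diff[OF w tendsto_const]]]) auto
    also have "\<dots> < r" using L k by (simp add: field_simps)
    finally have wr: "norm (w - u0) < r" .
    then have wimg: "w \<in> chart_img c" using r0(2) unfolding r_def by (auto simp: dist_norm norm_minus_commute)
    have "isCont (chart_inv c) w"
      using chart_props(2,4)[OF c] wimg by (simp add: continuous_on_eq_continuous_at)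
    then have "(\<lambda>n. chart_inv c (x n)) \<longlonglongrightarrow> chart_inv c w" by (rule isCont_tendsto_compose[OF _ w])
    moreover have "chart_inv c (x n) = \<gamma> (s n)" for n
      unfolding x_def by (rule chart_props(6)[OF c inb(1)[OF s]])
    ultimately have 1: "(\<lambda>n. \<gamma> (s n)) \<longlonglongrightarrow> chart_inv c w" by simp
    have 2: "(\<lambda>n. \<gamma> (s n)) \<longlonglongrightarrow> \<gamma> \<tau>" by (rule continuous_on_tendsto_compose[OF cont slim \<tau>(1) s01])
    have "\<gamma> \<tau> = chart_inv c w" by (rule LIMSEQ_unique[OF 2 1])
    then have "\<gamma> \<tau> \<in> V"
      using chart_props(7,8)[OF c wimg] wr unfolding V_def by (simp add: dist_norm norm_minus_commute)
    then show False using \<tau>(2) by simp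
  qed
  moreover have "sqrt k * r > 0" using k r by simp
  ultimately show ?thesis using VU by blast
qed

section \<open>Geodesics and the exponential map\<close>

definition geodesic_eq :: "('m, 'h) chart \<Rightarrow> real set \<Rightarrow> (real \<Rightarrow> 'h) \<Rightarrow> (real \<Rightarrow> 'h) \<Rightarrow> bool" where
  "geodesic_eq c J x w \<longleftrightarrow> (\<forall>t\<in>J. x t \<in> chart_img c \<and> (x has_vector_derivative w t) (at t within J) \<and>
     (w has_vector_derivative - christoffel M c (x t) (w t) (w t)) (at t within J))"

text \<open>\<open>geodesic_on\<close> speaks of every chart at once. In another chart the velocity
  is \<open>tr1 c c' (x t) (w t)\<close>, and the product rule produces a \<open>tr2\<close> term
  that \<open>christoffel_transform\<close> absorbs.\<close>

lemma geodesic_of_chart: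
  assumes c: "c \<in> atlas M" and eq: "geodesic_eq c J x w"
  shows "geodesic_on M J (\<lambda>t. chart_inv c (x t))"
  unfolding geodesic_on_def
proof (intro conjI ballI)
  have x: "x t \<in> chart_img c" and xd: "(x has_vector_derivative w t) (at t within J)"
    and wd: "(w has_vector_derivative - christoffel M c (x t) (w t) (w t)) (at t within J)" if "t \<in> J" for t
    using eq that unfolding geodesic_eq_def by auto
  have "continuous_on J x" by (rule continuous_on_vector_derivative[OF xd])
  then show "continuous_on J (\<lambda>t. chart_inv c (x t))"
    by (rule continuous_on_compose2[OF chart_props(4)[OF c]]) (use x in blast)
  fix c' assume c': "c' \<in> atlas M"
  have e: "chart_map c' \<circ> (\<lambda>t. chart_inv c (x t)) = (\<lambda>t. transition c c' (x t))" unfolding transition_def by auto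
  have "((\<lambda>t. transition c c' (x t)) has_vector_derivative tr1 c c' (x t) (w t)) (at t within J) \<and>
        ((\<lambda>t. tr1 c c' (x t) (w t)) has_vector_derivative
          - christoffel M c' (chart_map c' (chart_inv c (x t))) (tr1 c c' (x t) (w t)) (tr1 c c' (x t) (w t))) (at t within J)"
    if t: "t \<in> J" "chart_inv c (x t) \<in> chart_dom c'" for t
  proof
    have ov: "x t \<in> overlap c c'"
      using in_overlap[OF chart_props(7)[OF c x[OF t(1)]] t(2)] chart_props(8)[OF c x[OF t(1)]] by simp
    note C2 = transition_C2[OF c c']
    show "((\<lambda>t. transition c c' (x t)) has_vector_derivative tr1 c c' (x t) (w t)) (at t within J)"
      by (rule has_vector_derivative_compose_deriv[OF C2_dataD(1)[OF C2 ov] xd[OF t(1)]])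
    have T: "((\<lambda>t. tr1 c c' (x t)) has_vector_derivative tr2 c c' (x t) (w t)) (at t within J)"
      by (rule has_vector_derivative_compose_deriv[OF C2_dataD(2)[OF C2 ov] xd[OF t(1)]])
    have "((\<lambda>t. blinfun_apply (tr1 c c' (x t)) (w t)) has_vector_derivative
        blinfun_apply (tr1 c c' (x t)) (- christoffel M c (x t) (w t) (w t)) + blinfun_apply (tr2 c c' (x t) (w t)) (w t)) (at t within J)"
      by (rule bounded_bilinear.has_vector_derivative[OF bounded_bilinear_blinfun_apply T wd[OF t(1)]])
    moreover have "chart_map c' (chart_inv c (x t)) = transition c c' (x t)" unfolding transition_def by simp
    ultimately show "((\<lambda>t. tr1 c c' (x t) (w t)) has_vector_derivative
          - christoffel M c' (chart_map c' (chart_inv c (x t))) (tr1 c c' (x t) (w t)) (tr1 c c' (x t) (w t))) (at t within J)"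
      using christoffel_transform[OF c c' ov, of "w t"] by (simp add: blinfun.minus_right)
  qed
  then show "\<exists>v. \<forall>t\<in>J. chart_inv c (x t) \<in> chart_dom c' \<longrightarrow>
        ((chart_map c' \<circ> (\<lambda>t. chart_inv c (x t))) has_vector_derivative v t) (at t within J) \<and>
        (v has_vector_derivative - christoffel M c' (chart_map c' (chart_inv c (x t))) (v t) (v t)) (at t within J)"
    unfolding e by (intro exI[of _ "\<lambda>t. tr1 c c' (x t) (w t)"]) blast
qed


section \<open>Uniqueness of geodesics\<close>

text \<open>By continuity \<open>\<gamma>\<close> stays in the chart for a short time after
  \<open>m\<close>, and there both curves solve the same equation with the same initial
  data.\<close>

lemma geodesic_unique_step:
  assumes c: "c \<in> atlas M" and eq: "geodesic_eq c {0..1} x w"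
    and geo: "continuous_on {0..1} \<gamma>" "\<And>t. t \<in> {0..1} \<Longrightarrow> \<gamma> t \<in> chart_dom c \<Longrightarrow>
        ((chart_map c \<circ> \<gamma>) has_vector_derivative v t) (at t within {0..1}) \<and>
        (v has_vector_derivative - christoffel M c (chart_map c (\<gamma> t)) (v t) (v t)) (at t within {0..1})"
    and m: "0 \<le> m" "m < 1" and init: "\<gamma> m = chart_inv c (x m)" "v m = w m"
  shows "\<exists>h>0. m + h \<le> 1 \<and> (\<forall>t\<in>{m..m+h}. \<gamma> t = chart_inv c (x t))"
proof -
  let ?J = "{0..1::real}"
  have mJ: "m \<in> ?J" using m by simp
  have x: "x t \<in> chart_img c" and xd: "(x has_vector_derivative w t) (at t within ?J)"
    and wd: "(w has_vector_derivative - christoffel M c (x t) (w t) (w t)) (at t within ?J)" if "t \<in> ?J" for t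
    using eq that unfolding geodesic_eq_def by auto
  have gm: "\<gamma> m \<in> chart_dom c" "chart_map c (\<gamma> m) = x m"
    unfolding init(1) using chart_props(7,8)[OF c x[OF mJ]] by auto
  let ?y = "\<lambda>t. chart_map c (\<gamma> t)"
  obtain r C where r: "r > 0" "ball (x m) r \<subseteq> chart_img c"
    and Q: "quadratic_lipschitz C (ball (x m) r) (\<lambda>x w. - christoffel M c x w w)"
    using christoffel_quadratic_lipschitz[OF c x[OF mJ]] by blast
  have C: "C \<ge> 0" using Q unfolding quadratic_lipschitz_def by blast
  define W where "W = norm (w m) + 1"
  have W: "W > norm (w m)" unfolding W_def by simp
  have limx: "(x \<longlongrightarrow> x m) (at m within ?J)" "(w \<longlongrightarrow> w m) (at m within ?J)" "(v \<longlongrightarrow> w m) (at m within ?J)"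
    using has_vector_derivative_continuous[OF xd[OF mJ]] has_vector_derivative_continuous[OF wd[OF mJ]]
      has_vector_derivative_continuous[OF conjunct2[OF geo(2)[OF mJ gm(1)]]] init(2)
    by (simp_all add: continuous_within)
  have limy: "(?y \<longlongrightarrow> x m) (at m within ?J)"
    using has_vector_derivative_continuous[OF conjunct1[OF geo(2)[OF mJ gm(1)]]] gm(2)
    by (simp add: continuous_within o_def)
  have limg: "(\<gamma> \<longlongrightarrow> \<gamma> m) (at m within ?J)" using geo(1) mJ unfolding continuous_on_def by blast
  have "\<forall>\<^sub>F t in at m within ?J. \<gamma> t \<in> chart_dom c \<and> dist (x t) (x m) < r \<and> dist (?y t) (x m) < r \<and> norm (w t) < W \<and> norm (v t) < W"
    using topological_tendstoD[OF limg chart_props(1)[OF c] gm(1)] tendstoD[OF limx(1) r(1)] tendstoD[OF limy r(1)]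
      order_tendstoD(2)[OF tendsto_norm[OF limx(2)] W] order_tendstoD(2)[OF tendsto_norm[OF limx(3)] W]
    by eventually_elim simp
  then obtain d where d: "d > 0" and near0: "\<And>t. t \<in> ?J \<Longrightarrow> t \<noteq> m \<Longrightarrow> dist t m < d \<Longrightarrow>
      \<gamma> t \<in> chart_dom c \<and> dist (x t) (x m) < r \<and> dist (?y t) (x m) < r \<and> norm (w t) < W \<and> norm (v t) < W"
    unfolding eventually_at by blast
  have near: "\<gamma> t \<in> chart_dom c \<and> x t \<in> ball (x m) r \<and> ?y t \<in> ball (x m) r \<and> norm (w t) \<le> W \<and> norm (v t) \<le> W"
    if "t \<in> ?J" "dist t m < d" for t
  proof (cases "t = m")
    case True
    show ?thesis unfolding True using gm r W init(2) by simp
  next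
    case False
    show ?thesis using near0[OF that(1) False that(2)] by (simp add: dist_commute)
  qed
  define K where "K = 1 + C * (2 * W + W\<^sup>2)"
  have "0 \<le> W" using W norm_ge_zero[of "w m"] by linarith
  then have K: "K \<ge> 1" unfolding K_def using C by simp
  \<comment> \<open>The bounds keep both curves in the ball where the Lipschitz estimate holds, keep
    the time below 1, and give the smallness \<open>h * K < 1\<close> required for
    uniqueness.\<close>
  define h where "h = min (d / 2) (min (1 - m) (1 / (2 * K)))"
  have h: "h > 0" "h < d" "m + h \<le> 1" "h * K < 1"
  proof -
    show "h > 0" "h < d" "m + h \<le> 1" unfolding h_def using d m K by auto
    have "h * K \<le> 1 / (2 * K) * K" unfolding h_def using K by (intro mult_right_mono) auto
    also have "\<dots> < 1" using K by simp
    finally show "h * K < 1" .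
  qed
  let ?I = "{m..m+h}"
  have I: "?I \<subseteq> ?J" using m h by auto
  have In: "dist t m < d" if "t \<in> ?I" for t using that h by (auto simp: dist_real_def)
  have ab: "m \<le> m + h" using h by simp
  have X: "x t \<in> ball (x m) r \<and> norm (w t) \<le> W \<and> (x has_vector_derivative w t) (at t within ?I) \<and>
      (w has_vector_derivative - christoffel M c (x t) (w t) (w t)) (at t within ?I)" if t: "t \<in> ?I" for t
    using near[OF subsetD[OF I t] In[OF t]]
    by (intro conjI has_vector_derivative_within_subset[OF xd[OF subsetD[OF I t]] I]
        has_vector_derivative_within_subset[OF wd[OF subsetD[OF I t]] I]) (elim conjE, assumption)+
  have Y: "?y t \<in> ball (x m) r \<and> norm (v t) \<le> W \<and> (?y has_vector_derivative v t) (at t within ?I) \<and>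
      (v has_vector_derivative - christoffel M c (?y t) (v t) (v t)) (at t within ?I)" if t: "t \<in> ?I" for t
  proof -
    note n = near[OF subsetD[OF I t] In[OF t]]
    note g = geo(2)[OF subsetD[OF I t] conjunct1[OF n]]
    show ?thesis
      using n by (intro conjI has_vector_derivative_within_subset[OF conjunct1[OF g, unfolded o_def] I]
        has_vector_derivative_within_subset[OF conjunct2[OF g] I]) (elim conjE, assumption)+
  qed
  have "x t = ?y t" if t: "t \<in> ?I" for t
    by (rule second_order_ode_unique(1)[OF Q ab X Y _ _ _ t]) (use gm(2) init(2) h(4) in \<open>simp_all add: K_def\<close>)
  then have "\<gamma> t = chart_inv c (x t)" if t: "t \<in> ?I" for t
    using near[OF subsetD[OF I t] In[OF t]] chart_props(6)[OF c, of "\<gamma> t"] t by simp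
  then show ?thesis using h by blast
qed

text \<open>\<open>riem_exp\<close> is a definite description over all geodesics, so competitors
  that might leave the chart must be excluded too. The supremum \<open>m\<close> of the times of
  agreement is attained by the Hausdorff property, and one more step contradicts maximality unless
  \<open>m = 1\<close>.\<close>

lemma geodesic_unique:
  assumes c: "c \<in> atlas M" and eq: "geodesic_eq c {0..1} x w"
    and geo: "geodesic_on M {0..1} \<gamma>" and g0: "\<gamma> 0 = chart_inv c (x 0)"
    and v0: "((chart_map c \<circ> \<gamma>) has_vector_derivative w 0) (at 0 within {0..1})"
    and t: "t \<in> {0..1}"
  shows "\<gamma> t = chart_inv c (x t)"
proof -
  let ?J = "{0..1::real}"
  have cont: "continuous_on ?J \<gamma>" using geo unfolding geodesic_on_def by blast
  obtain v where v: "\<And>t. t \<in> ?J \<Longrightarrow> \<gamma> t \<in> chart_dom c \<Longrightarrow>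
        ((chart_map c \<circ> \<gamma>) has_vector_derivative v t) (at t within ?J) \<and>
        (v has_vector_derivative - christoffel M c (chart_map c (\<gamma> t)) (v t) (v t)) (at t within ?J)"
    using geo c unfolding geodesic_on_def by blast
  have x: "x t \<in> chart_img c" and xd: "(x has_vector_derivative w t) (at t within ?J)" if "t \<in> ?J" for t
    using eq that unfolding geodesic_eq_def by auto
  have xc: "continuous_on ?J x" by (rule continuous_on_vector_derivative[OF xd])
  define \<beta> where "\<beta> t = chart_inv c (x t)" for t
  have \<beta>c: "continuous_on ?J \<beta>"
    unfolding \<beta>_def by (rule continuous_on_compose2[OF chart_props(4)[OF c] xc]) (use x in blast)
  have \<beta>: "\<beta> t \<in> chart_dom c" "chart_map c (\<beta> t) = x t" if "t \<in> ?J" for t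
    unfolding \<beta>_def using chart_props(7,8)[OF c x[OF that]] by auto
  define E where "E = {t \<in> ?J. \<forall>s\<in>{0..t}. \<gamma> s = \<beta> s}"
  have E0: "0 \<in> E" unfolding E_def \<beta>_def using g0 by simp
  have Eb: "bdd_above E" by (rule bdd_aboveI[of _ 1]) (simp add: E_def)
  define m where "m = Sup E"
  have mJ: "m \<in> ?J"
  proof -
    have "0 \<le> m" unfolding m_def by (rule cSup_upper[OF E0 Eb])
    moreover have "m \<le> 1"
      unfolding m_def
    proof (rule cSup_least)
      show "E \<noteq> {}" using E0 by blast
      show "t \<le> 1" if "t \<in> E" for t using that unfolding E_def by simp
    qed
    ultimately show ?thesis by simp
  qed
  have below: "\<gamma> s = \<beta> s" if sm: "0 \<le> s" "s < m" for s
  proof -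
    obtain t where "t \<in> E" "s < t" using less_cSupE[of s E] sm(2) E0 unfolding m_def by blast
    then have "\<forall>s\<in>{0..t}. \<gamma> s = \<beta> s" "s \<in> {0..t}" using sm(1) unfolding E_def by auto
    then show ?thesis by (rule bspec)
  qed
  have gm: "\<gamma> m = \<beta> m"
  proof (cases "m = 0")
    case True then show ?thesis using g0 unfolding \<beta>_def by simp
  next
    case False
    then have m0: "m > 0" using mJ by simp
    have sub: "{0..<m} \<subseteq> ?J" using mJ by auto
    have 1: "(\<gamma> \<longlongrightarrow> \<gamma> m) (at m within {0..<m})" "(\<beta> \<longlongrightarrow> \<beta> m) (at m within {0..<m})"
      using cont \<beta>c mJ tendsto_within_subset[OF _ sub] unfolding continuous_on_def by blast+
    have "\<forall>\<^sub>F s in at m within {0..<m}. \<gamma> s = \<beta> s"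
      unfolding eventually_at_filter by (rule always_eventually) (use below in auto)
    then have 2: "(\<beta> \<longlongrightarrow> \<gamma> m) (at m within {0..<m})" using 1(1) tendsto_cong by blast
    have "at m within {0..<m} \<noteq> bot"
      using m0 by (simp add: trivial_limit_within islimpt_Ico)
    then show ?thesis by (rule tendsto_unique[OF _ 2 1(2)])
  qed
  have upto: "\<gamma> s = \<beta> s" if "s \<in> {0..m}" for s
  proof (cases "s = m")
    case True then show ?thesis using gm by simp
  next
    case False then show ?thesis using that by (intro below) auto
  qed
  have dm: "\<gamma> m \<in> chart_dom c" unfolding gm by (rule \<beta>(1)[OF mJ])
  \<comment> \<open>For \<open>m > 0\<close> both are derivatives from the left of the same
    coordinate curve; for \<open>m = 0\<close> this is the initial condition
    \<open>v0\<close>.\<close>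
  have vm: "v m = w m"
  proof (cases "m = 0")
    case True
    have "((chart_map c \<circ> \<gamma>) has_vector_derivative v 0) (at 0 within ?J)" using v[OF mJ dm] True by simp
    moreover have "at (0::real) within ?J \<noteq> bot" by (rule at_within_interval_nonbot) auto
    ultimately have "v 0 = w 0" using vector_derivative_unique_within v0 by blast
    then show ?thesis using True by simp
  next
    case False
    then have m0: "m > 0" using mJ by simp
    have sub: "{0..m} \<subseteq> ?J" using mJ by auto
    have mm: "m \<in> {0..m}" using m0 by simp
    have 1: "((chart_map c \<circ> \<gamma>) has_vector_derivative v m) (at m within {0..m})"
      by (rule has_vector_derivative_within_subset[OF conjunct1[OF v[OF mJ dm]] sub])
    have "((chart_map c \<circ> \<gamma>) has_vector_derivative w m) (at m within {0..m})"
    proof (rule has_vector_derivative_transform[OF mm _ has_vector_derivative_within_subset[OF xd[OF mJ] sub]])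
      show "(chart_map c \<circ> \<gamma>) s = x s" if "s \<in> {0..m}" for s
        using upto[OF that] \<beta>(2)[OF subsetD[OF sub that]] by simp
    qed
    then show ?thesis by (rule vector_derivative_unique_within[OF at_within_interval_nonbot[OF m0 mm] 1])
  qed
  have "m = 1"
  proof (rule ccontr)
    assume "m \<noteq> 1"
    then have m: "0 \<le> m" "m < 1" using mJ by auto
    have "\<exists>h>0. m + h \<le> 1 \<and> (\<forall>t\<in>{m..m+h}. \<gamma> t = chart_inv c (x t))"
    proof (rule geodesic_unique_step[where v = v and w = w, OF c eq cont])
      show "\<gamma> m = chart_inv c (x m)" using gm unfolding \<beta>_def .
    qed (use v m vm in blast)+
    then obtain h where h0: "h > 0" "m + h \<le> 1" "\<forall>t\<in>{m..m+h}. \<gamma> t = chart_inv c (x t)"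
      by (elim exE conjE)
    note h = h0(1,2) bspec[OF h0(3)]
    have "m + h \<in> E"
      unfolding E_def
    proof (intro CollectI conjI ballI)
      show "m + h \<in> ?J" using m h(1,2) by simp
      show "\<gamma> s = \<beta> s" if "s \<in> {0..m+h}" for s
      proof (cases "s \<le> m")
        case True
        show ?thesis by (rule upto) (use True that in simp)
      next
        case False
        show ?thesis unfolding \<beta>_def by (rule h(3)) (use False that in simp)
      qed
    qed
    then have "m + h \<le> m" unfolding m_def by (rule cSup_upper[OF _ Eb])
    then show False using h(1) by linarith
  qed
  then have "t \<in> {0..m}" using t by simp
  then have "\<gamma> t = \<beta> t" by (rule upto)
  then show ?thesis unfolding \<beta>_def .
qed

text \<open>This is all the regularity of \<open>exp\<close> that proximal subdifferentials need.\<close>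

lemma riem_exp_expansion:
  fixes p :: 'm
  defines "c \<equiv> ref_chart M p"
  shows "\<exists>\<rho>>0. \<exists>C\<ge>0. \<forall>v. norm v < \<rho> \<longrightarrow> (\<exists>u\<in>chart_img c. riem_exp M p v = chart_inv c u \<and>
     norm (u - chart_map c p - v) \<le> C * (norm v)\<^sup>2)"
proof -
  have c: "c \<in> atlas M" and pc: "p \<in> chart_dom c" unfolding c_def using ref_chart by auto
  define u0 where "u0 = chart_map c p"
  have u0: "u0 \<in> chart_img c" unfolding u0_def by (rule chart_props(5)[OF c pc])
  have pu0: "chart_inv c u0 = p" unfolding u0_def by (rule chart_props(6)[OF c pc])
  obtain r C where r: "r > 0" "ball u0 r \<subseteq> chart_img c"
    and Q: "quadratic_lipschitz C (ball u0 r) (\<lambda>x w. - christoffel M c x w w)"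
    using christoffel_quadratic_lipschitz[OF c u0] by blast
  have C: "C \<ge> 0" using Q unfolding quadratic_lipschitz_def by blast
  from second_order_ode_hilbert[OF Q r(1)] obtain \<rho> where \<rho>: "\<rho> > 0"
    and sol: "\<forall>v. norm v < \<rho> \<longrightarrow> (\<exists>x w. x 0 = u0 \<and> w 0 = v \<and>
    (\<forall>t\<in>{0..1::real}. x t \<in> ball u0 r \<and> norm (w t) \<le> 2 * norm v \<and>
       (x has_vector_derivative w t) (at t within {0..1}) \<and>
       (w has_vector_derivative - christoffel M c (x t) (w t) (w t)) (at t within {0..1})))"
    by (elim exE conjE)
  \<comment> \<open>The speed is at most \<open>2 * norm v\<close>, so the acceleration is at most
    \<open>4 * C * (norm v)\<^sup>2\<close>. Over unit time the velocity, and then the position,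
    deviates from uniform motion by no more than that.\<close>
  have "\<exists>u\<in>chart_img c. riem_exp M p v = chart_inv c u \<and> norm (u - u0 - v) \<le> (4 * C) * (norm v)\<^sup>2"
    if v: "norm v < \<rho>" for v
  proof -
    from sol[rule_format, OF v] obtain x w where x0: "x 0 = u0" "w 0 = v"
      and xw': "\<forall>t\<in>{0..1::real}. x t \<in> ball u0 r \<and> norm (w t) \<le> 2 * norm v \<and>
       (x has_vector_derivative w t) (at t within {0..1}) \<and>
       (w has_vector_derivative - christoffel M c (x t) (w t) (w t)) (at t within {0..1})"
      by (elim exE conjE)
    note xw = bspec[OF xw']
    have ximg: "x t \<in> chart_img c" if "t \<in> {0..1}" for t using xw[OF that] r(2) by blast
    have eq: "geodesic_eq c {0..1} x w"
      unfolding geodesic_eq_def by (intro ballI conjI ximg) (use xw in simp_all)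
    define \<beta> where "\<beta> t = chart_inv c (x t)" for t
    have geo: "geodesic_on M {0..1} \<beta>" unfolding \<beta>_def by (rule geodesic_of_chart[OF c eq])
    have \<beta>0: "\<beta> 0 = p" unfolding \<beta>_def x0 by (rule pu0)
    have \<beta>d: "((chart_map c \<circ> \<beta>) has_vector_derivative v) (at 0 within {0..1})"
    proof (rule has_vector_derivative_transform[of 0])
      show "(x has_vector_derivative v) (at 0 within {0..1})" using xw[of 0] x0 by simp
      show "(chart_map c \<circ> \<beta>) t = x t" if "t \<in> {0..1}" for t
        unfolding \<beta>_def using chart_props(8)[OF c ximg[OF that]] by simp
    qed simp
    have "riem_exp M p v = \<beta> 1"
      unfolding riem_exp_def
    proof (rule the_equality)
      show "\<exists>\<gamma>. geodesic_on M {0..1} \<gamma> \<and> \<gamma> 0 = p \<and>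
        ((chart_map (ref_chart M p) \<circ> \<gamma>) has_vector_derivative v) (at 0 within {0..1}) \<and> \<gamma> 1 = \<beta> 1"
        using geo \<beta>0 \<beta>d unfolding c_def by blast
      fix q assume "\<exists>\<gamma>. geodesic_on M {0..1} \<gamma> \<and> \<gamma> 0 = p \<and>
        ((chart_map (ref_chart M p) \<circ> \<gamma>) has_vector_derivative v) (at 0 within {0..1}) \<and> \<gamma> 1 = q"
      then obtain \<gamma> where g: "geodesic_on M {0..1} \<gamma>" "\<gamma> 0 = p"
        "((chart_map c \<circ> \<gamma>) has_vector_derivative v) (at 0 within {0..1})" "\<gamma> 1 = q"
        unfolding c_def by blast
      have "\<gamma> 1 = chart_inv c (x 1)"
        by (rule geodesic_unique[OF c eq g(1)]) (use g x0 pu0 in simp_all)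
      then show "q = \<beta> 1" unfolding \<beta>_def using g(4) by simp
    qed
    then have 1: "riem_exp M p v = chart_inv c (x 1)" unfolding \<beta>_def .
    have acc: "norm (- christoffel M c (x t) (w t) (w t)) \<le> 4 * C * (norm v)\<^sup>2" if t: "t \<in> {0..1}" for t
    proof -
      have "norm (- christoffel M c (x t) (w t) (w t)) \<le> C * (norm (w t))\<^sup>2"
        using Q xw[OF t] unfolding quadratic_lipschitz_def by blast
      also have "\<dots> \<le> C * (2 * norm v)\<^sup>2" using xw[OF t] C by (intro mult_left_mono power_mono) auto
      finally show ?thesis by (simp add: power2_eq_square)
    qed
    have wv: "norm (w t - v) \<le> 4 * C * (norm v)\<^sup>2" if t: "t \<in> {0..1}" for t
    proof -
      have "norm (w t - w 0) \<le> (4 * C * (norm v)\<^sup>2) * \<bar>t - 0\<bar>"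
        by (rule vector_derivative_norm_bound[where a = 0 and b = 1 and f = w and f' = "\<lambda>t. - christoffel M c (x t) (w t) (w t)"])
          (use xw acc t in auto)
      also have "\<dots> \<le> (4 * C * (norm v)\<^sup>2) * 1" using t C by (intro mult_left_mono) auto
      finally show ?thesis using x0 by simp
    qed
    have "norm ((x 1 - 1 *\<^sub>R v) - (x 0 - 0 *\<^sub>R v)) \<le> (4 * C * (norm v)\<^sup>2) * \<bar>1 - 0\<bar>"
    proof (rule vector_derivative_norm_bound[where a = 0 and b = 1 and f = "\<lambda>t. x t - t *\<^sub>R v" and f' = "\<lambda>t. w t - v"])
      fix t :: real assume t: "t \<in> {0..1}"
      show "((\<lambda>t. x t - t *\<^sub>R v) has_vector_derivative w t - v) (at t within {0..1})"
      proof (rule has_vector_derivative_diff)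
        show "((\<lambda>t. t *\<^sub>R v) has_vector_derivative v) (at t within {0..1})"
          unfolding has_vector_derivative_def
          by (rule bounded_linear_imp_has_derivative[OF bounded_linear_scaleR_left])
      qed (use xw[OF t] in blast)
    qed (use wv in auto)
    then have 2: "norm (x 1 - u0 - v) \<le> (4 * C) * (norm v)\<^sup>2" using x0 by (simp add: algebra_simps)
    show ?thesis using 1 2 ximg[of 1] by auto
  qed
  moreover have "4 * C \<ge> 0" using C by simp
  ultimately show ?thesis using \<rho> unfolding u0_def by blast
qed

end

section \<open>Proximal subgradients\<close>

lemma bil_cauchy_schwarz:
  fixes B :: "'h::real_normed_vector \<Rightarrow>\<^sub>L 'h \<Rightarrow>\<^sub>L real"
  assumes sym: "\<And>u v. bil B u v = bil B v u" and k: "k > 0" "\<And>u. k * (norm u)\<^sup>2 \<le> bil B u u"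
  shows "\<bar>bil B u v\<bar> \<le> sqrt (bil B u u) * sqrt (bil B v v)"
proof (cases "v = 0")
  case True then show ?thesis by (simp add: blinfun.zero_right)
next
  case False
  define a b c where "a = bil B u u" and "b = bil B u v" and "c = bil B v v"
  have "0 < k * (norm v)\<^sup>2" using k(1) False by simp
  then have c: "c > 0" unfolding c_def using k(2)[of v] by linarith
  define t where "t = b / c"
  have "0 \<le> k * (norm (u - t *\<^sub>R v))\<^sup>2" using k(1) by simp
  then have "0 \<le> bil B (u - t *\<^sub>R v) (u - t *\<^sub>R v)" using k(2)[of "u - t *\<^sub>R v"] by linarith
  also have "\<dots> = a - t * b - t * (b - t * c)"
    unfolding a_def b_def c_def using sym[of v u]
    by (simp add: blinfun.diff_left blinfun.diff_right blinfun.scaleR_left blinfun.scaleR_right right_diff_distrib)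
  also have "b - t * c = 0" unfolding t_def using c by simp
  finally have "b * b / c \<le> a" unfolding t_def by simp
  then have "b\<^sup>2 \<le> a * c" using c by (simp add: field_simps power2_eq_square)
  then have "sqrt (b\<^sup>2) \<le> sqrt (a * c)" by (rule real_sqrt_le_mono)
  then show ?thesis unfolding a_def b_def c_def by (simp add: real_sqrt_mult)
qed

text \<open>Supplies the closed epigraph that the variational principle starts from. The continuous
  summand is moved to the right side, so \<open>G\<close> may take the value infinity.\<close>

lemma closed_epigraph:
  fixes G :: "'a::metric_space \<Rightarrow> ereal"
  assumes K: "closed K" and G: "\<And>u t. u \<in> K \<Longrightarrow> t < G u \<Longrightarrow> \<forall>\<^sub>F y in at u within K. t < G y"
    and \<psi>: "continuous_on UNIV \<psi>"
  shows "closed {(u, c :: real). u \<in> K \<and> G u \<le> ereal (c - \<psi> u)}"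
  unfolding closed_sequential_limits
proof (intro allI impI, elim conjE)
  fix z :: "nat \<Rightarrow> 'a \<times> real" and l
  assume mem: "\<forall>n. z n \<in> {(u, c). u \<in> K \<and> G u \<le> ereal (c - \<psi> u)}" and lim: "z \<longlonglongrightarrow> l"
  obtain u c where l: "l = (u, c)" by force
  have zu: "(\<lambda>n. fst (z n)) \<longlonglongrightarrow> u" and zc: "(\<lambda>n. snd (z n)) \<longlonglongrightarrow> c"
    using tendsto_fst[OF lim] tendsto_snd[OF lim] unfolding l by simp_all
  have zK: "fst (z n) \<in> K" and zG: "G (fst (z n)) \<le> ereal (snd (z n) - \<psi> (fst (z n)))" for n
    using mem[rule_format, of n] by (auto simp: case_prod_unfold)
  have uK: "u \<in> K" by (rule closed_sequentially[OF K zK zu])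
  have "G u \<le> ereal (c - \<psi> u)"
  proof (rule ccontr)
    assume "\<not> G u \<le> ereal (c - \<psi> u)"
    then have "ereal (c - \<psi> u) < G u" by (simp only: not_le)
    from ereal_dense2[OF this] obtain t where t: "ereal (c - \<psi> u) < ereal t" "ereal t < G u" by blast
    have "isCont \<psi> u" using \<psi> by (simp add: continuous_on_eq_continuous_at)
    then have "(\<lambda>n. snd (z n) - \<psi> (fst (z n))) \<longlonglongrightarrow> c - \<psi> u"
      by (intro tendsto_diff zc isCont_tendsto_compose[OF _ zu])
    then have e1: "\<forall>\<^sub>F n in sequentially. snd (z n) - \<psi> (fst (z n)) < t"
      by (rule order_tendstoD(2)) (use t(1) in simp)
    obtain d where d: "d > 0" "\<And>y. y \<in> K \<Longrightarrow> y \<noteq> u \<Longrightarrow> dist y u < d \<Longrightarrow> ereal t < G y"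
      using G[OF uK t(2)] unfolding eventually_at by blast
    have e2: "\<forall>\<^sub>F n in sequentially. dist (fst (z n)) u < d" by (rule tendstoD[OF zu d(1)])
    obtain n where n: "snd (z n) - \<psi> (fst (z n)) < t" "dist (fst (z n)) u < d"
      using eventually_happens[OF eventually_conj[OF e1 e2]] by auto
    have "ereal t < G (fst (z n))"
      using d(2)[OF zK _ n(2)] t(2) by (cases "fst (z n) = u") auto
    also have "\<dots> \<le> ereal (snd (z n) - \<psi> (fst (z n)))" by (rule zG)
    finally show False using n(1) by simp
  qed
  then show "l \<in> {(u, c). u \<in> K \<and> G u \<le> ereal (c - \<psi> u)}" using uK unfolding l by simp
qed

text \<open>Add the smooth function \<open>am * sqrt (|u - u0|\<^sup>2 + s\<^sup>2)\<close> with \<open>am\<close> between \<open>a1\<close> and \<open>a2\<close>, and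
  minimise the sum up to a small quadratic perturbation.\<close>

lemma proximal_subgradient_near:
  fixes B :: "'h::{real_inner, complete_space} \<Rightarrow>\<^sub>L 'h \<Rightarrow>\<^sub>L real" and f :: "'h \<Rightarrow> ereal"
  assumes sym: "\<And>u v. bil B u v = bil B v u" and k: "k > 0" "\<And>u. k * (norm u)\<^sup>2 \<le> bil B u u"
    and r: "r > 0" and lam: "0 \<le> a1" "a1 < a2"
    and f0: "\<And>u. u \<in> cball u0 r \<Longrightarrow> 0 \<le> f u" and fin: "f u0 \<noteq> \<infinity>"
    and lsc: "\<And>u t. u \<in> cball u0 r \<Longrightarrow> t < f u \<Longrightarrow> \<forall>\<^sub>F y in at u within cball u0 r. t < f y"
    and slope: "\<And>u. u \<in> cball u0 r \<Longrightarrow> ereal (real_of_ereal (f u0) - a1 * sqrt (bil B (u - u0) (u - u0))) \<le> f u"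
  shows "\<exists>u\<in>ball u0 r. f u \<noteq> \<infinity> \<and> (\<exists>l :: 'h \<Rightarrow>\<^sub>L real. (\<forall>w. \<bar>l w\<bar> \<le> a2 * sqrt (bil B w w)) \<and>
    (\<exists>\<sigma>\<ge>0. \<exists>\<rho>>0. ball u \<rho> \<subseteq> ball u0 r \<and> (\<forall>v\<in>ball u \<rho>. f u + ereal (l (v - u) - \<sigma> * (norm (v - u))\<^sup>2) \<le> f v)))"
proof -
  \<comment> \<open>The gap from \<open>a1\<close> to \<open>am\<close> keeps the minimiser inside
    the ball; the gap from \<open>am\<close> to \<open>a2\<close> pays for the linear term of the
    perturbation.\<close>
  define am where "am = (a1 + a2) / 2"
  have am: "a1 < am" "am < a2" "am > 0" unfolding am_def using lam by auto
  define N where "N w = sqrt (bil B w w)" for w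
  have Bpos: "bil B w w \<ge> 0" for w
  proof -
    have "0 \<le> k * (norm w)\<^sup>2" using k(1) by simp
    then show ?thesis using k(2)[of w] by linarith
  qed
  have N0: "N w \<ge> 0" for w unfolding N_def using Bpos by simp
  have Nk: "sqrt k * norm w \<le> N w" for w
    unfolding N_def using real_sqrt_le_mono[OF k(2)[of w]] by (simp add: real_sqrt_mult)
  have NN: "N w * N w = bil B w w" for w unfolding N_def using Bpos by simp
  \<comment> \<open>Smoothing puts the value \<open>am * s\<close> at \<open>u0\<close>, which is
    half of what the slope gap gains at \<open>N\<close>-distance \<open>sqrt k * r\<close>; this is
    what keeps the minimiser off the boundary.\<close>
  define s where "s = (am - a1) * (sqrt k * r) / (2 * am)"
  have s: "s > 0" "2 * (am * s) = (am - a1) * (sqrt k * r)" unfolding s_def using am k r by auto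
  define T where "T u = sqrt (bil B (u - u0) (u - u0) + s\<^sup>2)" for u
  have Ts: "T u \<ge> s" "T u \<ge> N (u - u0)" "T u * T u = bil B (u - u0) (u - u0) + s\<^sup>2" "T u > 0" for u
  proof -
    show "T u \<ge> s" unfolding T_def using Bpos[of "u - u0"] s(1) by (intro real_le_rsqrt) simp
    then show "T u > 0" using s(1) by linarith
    show "T u \<ge> N (u - u0)" unfolding T_def N_def by (intro real_sqrt_le_mono) simp
    show "T u * T u = bil B (u - u0) (u - u0) + s\<^sup>2" unfolding T_def using Bpos[of "u - u0"] by simp
  qed
  have Tc: "continuous_on UNIV (\<lambda>u. am * T u)" unfolding T_def by (intro continuous_intros)
  define fr where "fr u = real_of_ereal (f u)" for u
  define D where "D = {u \<in> cball u0 r. f u \<noteq> \<infinity>}"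
  have fr: "f u = ereal (fr u)" "fr u \<ge> 0" if "u \<in> D" for u
  proof -
    have "f u \<noteq> \<infinity>" "0 \<le> f u" using that f0 unfolding D_def by auto
    then show "f u = ereal (fr u)" "fr u \<ge> 0" unfolding fr_def by (cases "f u"; simp)+
  qed
  define H where "H u = fr u + am * T u" for u
  have u0D: "u0 \<in> D" unfolding D_def using fin r by simp
  have "{(u, c). u \<in> D \<and> H u \<le> c} = {(u, c). u \<in> cball u0 r \<and> f u \<le> ereal (c - am * T u)}"
  proof -
    have "u \<in> D \<and> H u \<le> c \<longleftrightarrow> u \<in> cball u0 r \<and> f u \<le> ereal (c - am * T u)" for u c
    proof (cases "u \<in> D")
      case True
      then have "u \<in> cball u0 r" unfolding D_def by blast
      then show ?thesis using True fr(1)[OF True] unfolding H_def by auto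
    next
      case False
      then show ?thesis unfolding D_def by auto
    qed
    then show ?thesis by simp
  qed
  then have clos: "closed {(u, c). u \<in> D \<and> H u \<le> c}"
    using closed_epigraph[OF closed_cball lsc Tc] by simp
  have R: "norm (u - v) \<le> 2 * r" if "u \<in> D" "v \<in> D" for u v
    using that dist_triangle2[of u v u0] unfolding D_def by (auto simp: dist_norm norm_minus_commute)
  have H0: "0 \<le> H u" if "u \<in> D" for u
    unfolding H_def using fr(2)[OF that] Ts(4)[of u] am(3) by simp
  \<comment> \<open>Scaled so that a vector \<open>b\<close> of norm at most \<open>\<tau>\<close>
    contributes at most \<open>a2 - am\<close> relative to the norm \<open>N\<close>.\<close>
  define \<tau> where "\<tau> = (a2 - am) * sqrt k"
  have \<tau>: "\<tau> > 0" unfolding \<tau>_def using am k by simp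
  obtain u b where u: "u \<in> D" "H u \<le> H u0" and b: "norm b \<le> \<tau>"
    and min: "\<And>v. v \<in> D \<Longrightarrow> H v \<ge> H u + inner b (v - u) - \<tau> * (norm (v - u))\<^sup>2"
    using quadratic_variational_principle[OF clos u0D R H0 \<tau>] by blast
  have uball: "u \<in> ball u0 r"
  proof -
    have "fr u0 - a1 * N (u - u0) \<le> fr u"
      unfolding fr_def[of u0] N_def using slope[of u] u(1) fr(1)[OF u(1)] by (simp add: D_def)
    moreover have "fr u + am * T u \<le> fr u0 + am * s"
    proof -
      have "T u0 = s" unfolding T_def using s(1) by (simp add: blinfun.zero_right)
      then show ?thesis using u(2) unfolding H_def by simp
    qed
    moreover have "am * N (u - u0) \<le> am * T u" using Ts(2) am(3) by (intro mult_left_mono) auto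
    ultimately have "(am - a1) * N (u - u0) \<le> am * s" unfolding left_diff_distrib by linarith
    moreover have "am * s > 0" using am s by simp
    ultimately have "(am - a1) * N (u - u0) < (am - a1) * (sqrt k * r)" using s(2) by linarith
    then have "N (u - u0) < sqrt k * r" using am(1) by simp
    then have "sqrt k * norm (u - u0) < sqrt k * r" using Nk[of "u - u0"] by linarith
    then show ?thesis using k(1) by (simp add: dist_norm norm_minus_commute)
  qed
  \<comment> \<open>The linear part of the perturbation minus the derivative of
    \<open>am * T\<close> at \<open>u\<close>.\<close>
  define l where "l = blinfun_inner_right b - (am / T u) *\<^sub>R blinfun_apply B (u - u0)"
  have lw: "l w = inner b w - am / T u * bil B (u - u0) w" for w
    unfolding l_def by (simp add: blinfun.diff_left blinfun.scaleR_left blinfun_inner_right.rep_eq)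
  have lb: "\<bar>l w\<bar> \<le> a2 * sqrt (bil B w w)" for w
  proof -
    have "\<bar>inner b w\<bar> \<le> norm b * norm w" by (rule Cauchy_Schwarz_ineq2)
    also have "\<dots> \<le> \<tau> * norm w" using b by (intro mult_right_mono) auto
    also have "\<dots> = (a2 - am) * (sqrt k * norm w)" unfolding \<tau>_def by simp
    also have "\<dots> \<le> (a2 - am) * N w" using Nk am by (intro mult_left_mono) auto
    finally have 1: "\<bar>inner b w\<bar> \<le> (a2 - am) * N w" .
    have "\<bar>bil B (u - u0) w\<bar> \<le> N (u - u0) * N w" unfolding N_def by (rule bil_cauchy_schwarz[OF sym k])
    also have "\<dots> \<le> T u * N w" using Ts(2) N0 by (intro mult_right_mono) auto
    finally have "am / T u * \<bar>bil B (u - u0) w\<bar> \<le> am / T u * (T u * N w)"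
      using am(3) Ts(4)[of u] by (intro mult_left_mono) auto
    also have "\<dots> = am * N w" using Ts(4)[of u] by simp
    finally have "\<bar>am / T u * bil B (u - u0) w\<bar> \<le> am * N w"
      using am(3) Ts(4)[of u] by (simp add: abs_mult)
    then have "\<bar>l w\<bar> \<le> (a2 - am) * N w + am * N w" unfolding lw using 1 by linarith
    then show ?thesis unfolding N_def[symmetric] by (simp add: left_diff_distrib)
  qed
  \<comment> \<open>\<open>\<tau>\<close> comes from the quadratic perturbation; the second term
    bounds the second-order part of \<open>am * T\<close>, using \<open>T u \<ge> s\<close>.\<close>
  define \<sigma> where "\<sigma> = \<tau> + am * norm B / (2 * s)"
  have \<sigma>: "\<sigma> \<ge> 0" unfolding \<sigma>_def using \<tau> am s by (intro add_nonneg_nonneg divide_nonneg_nonneg mult_nonneg_nonneg) auto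
  define \<rho> where "\<rho> = r - dist u0 u"
  have \<rho>: "\<rho> > 0" "ball u \<rho> \<subseteq> ball u0 r"
    using uball unfolding \<rho>_def by (auto simp: subset_iff) (smt (verit) dist_triangle)
  have "f u + ereal (l (v - u) - \<sigma> * (norm (v - u))\<^sup>2) \<le> f v" if v: "v \<in> ball u \<rho>" for v
  proof (cases "f v = \<infinity>")
    case False
    have "v \<in> ball u0 r" using v \<rho>(2) by blast
    then have vD: "v \<in> D" unfolding D_def using False by auto
    let ?n = "(norm (v - u))\<^sup>2"
    \<comment> \<open>This bounds the increment of the square root by that of its square, and the
      latter is an exact quadratic polynomial in \<open>v - u\<close>.\<close>
    have "0 \<le> (T v - T u)\<^sup>2" by simp
    then have "2 * (T v * T u) \<le> T v * T v + T u * T u" by (simp add: power2_eq_square algebra_simps)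
    then have "2 * T u * (T v - T u) \<le> T v * T v - T u * T u" by (simp add: algebra_simps)
    also have "\<dots> = 2 * bil B (u - u0) (v - u) + bil B (v - u) (v - u)"
    proof -
      have e: "v - u0 = (u - u0) + (v - u)" by simp
      show ?thesis unfolding Ts(3) e blinfun.add_left blinfun.add_right using sym[of "v - u" "u - u0"] by simp
    qed
    also have "bil B (v - u) (v - u) \<le> norm B * ?n"
      using norm_bil[of B "v - u" "v - u"] by (simp add: power2_eq_square mult.assoc)
    finally have "2 * T u * (T v - T u) \<le> 2 * bil B (u - u0) (v - u) + norm B * ?n" by simp
    then have "T v - T u \<le> bil B (u - u0) (v - u) / T u + norm B * ?n / (2 * T u)"
      using Ts(4)[of u] by (simp add: field_simps)
    also have "norm B * ?n / (2 * T u) \<le> norm B * ?n / (2 * s)"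
      using Ts(1)[of u] s(1) by (intro divide_left_mono mult_pos_pos) auto
    finally have "am * (T v - T u) \<le> am * (bil B (u - u0) (v - u) / T u + norm B * ?n / (2 * s))"
      using am(3) by (intro mult_left_mono) auto
    then have "am * T v - am * T u \<le> am / T u * bil B (u - u0) (v - u) + am * norm B / (2 * s) * ?n"
      by (simp add: distrib_left right_diff_distrib mult.assoc)
    then have "fr u + (l (v - u) - \<sigma> * ?n) \<le> fr v"
      using min[OF vD] unfolding H_def lw \<sigma>_def distrib_right by linarith
    then show ?thesis unfolding fr(1)[OF u(1)] fr(1)[OF vD] by simp
  qed simp
  then show ?thesis using uball u(1) lb \<sigma> \<rho> unfolding D_def by blast
qed

section \<open>From coordinates to proximal subgradients on the manifold\<close>

context riemannian begin

text \<open>Up to a linear map, \<open>riem_exp M p\<close> and a chart differ by an error quadratic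
  in \<open>v\<close>, which merely enlarges the constant of a proximal inequality. The reference
  chart of \<open>p\<close> may differ from \<open>c\<close>, so a transition map intervenes, and
  \<open>\<zeta>\<close> represents \<open>l\<close> composed with its derivative.\<close>

lemma prox_subdiff_of_chart:
  fixes l :: "'h \<Rightarrow>\<^sub>L real"
  assumes c: "c \<in> atlas M" "p \<in> chart_dom c" and G: "G p \<noteq> \<infinity>" "G p \<ge> 0"
    and D: "\<And>w. \<bar>l w\<bar> \<le> D * sqrt (bil (metric M c (chart_map c p)) w w)" "D \<ge> 0"
    and \<sigma>: "\<sigma> \<ge> 0" and r: "r > 0"
    and loc: "\<And>u. u \<in> ball (chart_map c p) r \<Longrightarrow>
       G p + ereal (blinfun_apply l (u - chart_map c p) - \<sigma> * (norm (u - chart_map c p))\<^sup>2) \<le> G (chart_inv c u)"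
  shows "\<exists>\<zeta>\<in>riem_prox_subdiff M G p. tangent_norm M p \<zeta> \<le> D"
proof -
  define c' where "c' = ref_chart M p"
  have c': "c' \<in> atlas M" "p \<in> chart_dom c'" unfolding c'_def by (rule ref_chart)+
  define x where "x = chart_map c' p"
  define y where "y = chart_map c p"
  have x: "x \<in> chart_img c'" unfolding x_def by (rule chart_props(5)[OF c'])
  have xo: "x \<in> overlap c' c" unfolding x_def by (rule in_overlap[OF c'(2) c(2)])
  have xy: "transition c' c x = y" unfolding x_def y_def by (rule transition_map[OF c'])
  let ?S = "tr1 c' c x" and ?g = "metric M c' x"
  have ti: "tangent_inner M p = (\<lambda>u v. bil ?g u v)"
    unfolding tangent_inner_def c'_def x_def by (simp add: fun_eq_iff)
  obtain k where k: "k > 0" "\<And>u. k * (norm u)\<^sup>2 \<le> bil ?g u u" using metric_coercive[OF c'(1) x] by blast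
  obtain \<zeta> where \<zeta>: "\<And>w. bil ?g \<zeta> w = (l o\<^sub>L ?S) w"
    using riesz_coercive[OF metric_sym[OF c'(1) x] k, of "l o\<^sub>L ?S"] by blast
  have gS: "bil (metric M c y) (?S w) (?S w) = bil ?g w w" for w
    using metric_transform[OF c'(1) c(1) xo, of w w] unfolding xy by simp
  have gpos: "bil ?g w w \<ge> 0" for w by (rule metric_nonneg[OF c'(1) x])
  have "sqrt (bil ?g \<zeta> \<zeta>) \<le> D"
  proof -
    let ?n = "sqrt (bil ?g \<zeta> \<zeta>)"
    have "?n * ?n = l (?S \<zeta>)" using gpos[of \<zeta>] \<zeta>[of \<zeta>] by simp
    also have "\<dots> \<le> D * ?n" using D(1)[of "?S \<zeta>"] unfolding y_def[symmetric] gS by linarith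
    finally have le: "?n * ?n \<le> D * ?n" .
    show ?thesis
    proof (cases "?n > 0")
      case True
      then show ?thesis using le by (simp only: mult_le_cancel_right_pos)
    next
      case False
      then show ?thesis using D(2) by linarith
    qed
  qed
  then have nD: "tangent_norm M p \<zeta> \<le> D" unfolding tangent_norm_def ti .
  obtain \<rho>1 C where \<rho>1: "\<rho>1 > 0" "C \<ge> 0" and ex: "\<And>v. norm v < \<rho>1 \<Longrightarrow> \<exists>u\<in>chart_img c'. riem_exp M p v = chart_inv c' u \<and>
     norm (u - x - v) \<le> C * (norm v)\<^sup>2"
    using riem_exp_expansion[of p] unfolding c'_def[symmetric] x_def[symmetric] by blast
  note T2 = transition_C2[OF c'(1) c(1)]
  obtain \<rho>2 K where \<rho>2: "\<rho>2 > 0" "K \<ge> 0" "ball x \<rho>2 \<subseteq> overlap c' c"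
    and K: "\<And>u. u \<in> ball x \<rho>2 \<Longrightarrow> norm (transition c' c u - transition c' c x - ?S (u - x)) \<le> K * (norm (u - x))\<^sup>2"
    using C2_taylor[OF overlap(1)[OF c'(1) c(1)] xo C2_dataD(1)[OF T2] C2_dataD(2)[OF T2] C2_dataD(3)[OF T2]] by blast
  \<comment> \<open>The Taylor remainder of the transition map, plus the error of the exponential
    map carried over by \<open>?S\<close>.\<close>
  define C1 where "C1 = K * (1 + C)\<^sup>2 + norm ?S * C"
  have C1: "C1 \<ge> 0" unfolding C1_def using \<rho>1 \<rho>2 by simp
  define L where "L = norm ?S + C1"
  have L: "L \<ge> 0" unfolding L_def using C1 by simp
  \<comment> \<open>The bounds secure, in turn, \<open>?n\<^sup>2 \<le> ?n\<close>, the expansion of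
    the exponential map, \<open>u\<close> in the Taylor ball, and \<open>z\<close> within
    \<open>r\<close> of \<open>y\<close>.\<close>
  define \<rho> where "\<rho> = min (min 1 \<rho>1) (min (\<rho>2 / (2 + C)) (r / (1 + L)))"
  have \<rho>: "\<rho> > 0" unfolding \<rho>_def using \<rho>1 \<rho>2 r L by simp
  \<comment> \<open>\<open>l\<close> applied to the quadratic error, plus the original quadratic
    term under the bound \<open>norm (z - y) \<le> L * norm v\<close>.\<close>
  define C2 where "C2 = norm l * C1 + \<sigma> * L\<^sup>2"
  have C2: "C2 \<ge> 0" unfolding C2_def using C1 \<sigma> by simp
  have est: "G p + ereal (bil ?g \<zeta> v - C2 * (norm v)\<^sup>2) \<le> G (riem_exp M p v)" if v: "norm v < \<rho>" for v
  proof -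
    let ?n = "norm v"
    have n: "?n < 1" "?n < \<rho>1" "?n < \<rho>2 / (2 + C)" "?n < r / (1 + L)" using v unfolding \<rho>_def by auto
    have nn: "?n\<^sup>2 \<le> ?n" using n(1) by (simp add: power2_eq_square mult_left_le)
    obtain u where u: "u \<in> chart_img c'" "riem_exp M p v = chart_inv c' u" "norm (u - x - v) \<le> C * ?n\<^sup>2"
      using ex[OF n(2)] by blast
    have "norm (u - x) \<le> norm (u - x - v) + ?n" using norm_triangle_sub[of "u - x" v] by simp
    also have "\<dots> \<le> C * ?n + ?n" using u(3) mult_left_mono[OF nn \<rho>1(2)] by linarith
    finally have ux: "norm (u - x) \<le> (1 + C) * ?n" by (simp add: algebra_simps)
    also have "\<dots> \<le> (2 + C) * ?n" by (intro mult_right_mono) auto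
    also have "\<dots> < \<rho>2" using n(3) \<rho>1(2) by (simp add: field_simps)
    finally have ub: "u \<in> ball x \<rho>2" by (simp add: dist_norm norm_minus_commute)
    define z where "z = transition c' c u"
    have zi: "chart_inv c z = riem_exp M p v"
    proof -
      have "chart_inv c' u \<in> chart_dom c" using overlap(4)[OF c'(1) c(1)] \<rho>2(3) ub by blast
      then show ?thesis unfolding z_def transition_def u(2) using chart_props(6)[OF c(1)] by simp
    qed
    have "norm (z - y - ?S v) \<le> C1 * ?n\<^sup>2"
    proof -
      have "z - y - ?S v = (z - y - ?S (u - x)) + ?S (u - x - v)" by (simp add: blinfun.diff_right)
      then have "norm (z - y - ?S v) \<le> norm (z - y - ?S (u - x)) + norm (?S (u - x - v))" by (metis norm_triangle_ineq)
      also have "norm (z - y - ?S (u - x)) \<le> K * (norm (u - x))\<^sup>2" using K[OF ub] unfolding xy z_def .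
      also have "\<dots> \<le> K * ((1 + C) * ?n)\<^sup>2" using ux \<rho>2(2) by (intro mult_left_mono power_mono) auto
      also have "norm (?S (u - x - v)) \<le> norm ?S * norm (u - x - v)" by (rule norm_blinfun)
      also have "\<dots> \<le> norm ?S * (C * ?n\<^sup>2)" using u(3) by (intro mult_left_mono) auto
      finally have "norm (z - y - ?S v) \<le> K * ((1 + C) * ?n)\<^sup>2 + norm ?S * (C * ?n\<^sup>2)" by simp
      moreover have "K * ((1 + C) * ?n)\<^sup>2 + norm ?S * (C * ?n\<^sup>2) = C1 * ?n\<^sup>2"
        unfolding C1_def by algebra
      ultimately show ?thesis by simp
    qed
    then have zs: "norm (z - y - ?S v) \<le> C1 * ?n\<^sup>2" .
    have "norm (z - y) \<le> norm (z - y - ?S v) + norm (?S v)" using norm_triangle_sub[of "z - y" "?S v"] by simp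
    also have "\<dots> \<le> C1 * ?n + norm ?S * ?n"
      using zs mult_left_mono[OF nn C1] norm_blinfun[of ?S v] by linarith
    finally have zy: "norm (z - y) \<le> L * ?n" unfolding L_def by (simp add: algebra_simps)
    also have "\<dots> \<le> (1 + L) * ?n" by (intro mult_right_mono) auto
    also have "\<dots> < r" using n(4) L by (simp add: field_simps)
    finally have zb: "z \<in> ball y r" by (simp add: dist_norm norm_minus_commute)
    have "bil ?g \<zeta> v - C2 * ?n\<^sup>2 \<le> l (z - y) - \<sigma> * (norm (z - y))\<^sup>2"
    proof -
      have "\<bar>l (z - y - ?S v)\<bar> \<le> norm l * norm (z - y - ?S v)" using norm_blinfun[of l "z - y - ?S v"] by simp
      also have "\<dots> \<le> norm l * (C1 * ?n\<^sup>2)" using zs by (intro mult_left_mono) auto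
      finally have 1: "l (?S v) - norm l * (C1 * ?n\<^sup>2) \<le> l (z - y)" by (simp add: blinfun.diff_right)
      have "\<sigma> * (norm (z - y))\<^sup>2 \<le> \<sigma> * (L * ?n)\<^sup>2" using zy \<sigma> by (intro mult_left_mono power_mono) auto
      then have 2: "\<sigma> * (norm (z - y))\<^sup>2 \<le> \<sigma> * L\<^sup>2 * ?n\<^sup>2" by (simp add: power_mult_distrib mult.assoc)
      have "bil ?g \<zeta> v = l (?S v)" using \<zeta>[of v] by simp
      moreover have "C2 * ?n\<^sup>2 = norm l * (C1 * ?n\<^sup>2) + \<sigma> * L\<^sup>2 * ?n\<^sup>2" unfolding C2_def by (simp add: algebra_simps)
      ultimately show ?thesis using 1 2 by linarith
    qed
    then have "G p + ereal (bil ?g \<zeta> v - C2 * ?n\<^sup>2) \<le> G p + ereal (l (z - y) - \<sigma> * (norm (z - y))\<^sup>2)"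
      by (intro add_left_mono) simp
    also have "\<dots> \<le> G (riem_exp M p v)" using loc[of z] zb unfolding y_def[symmetric] zi by simp
    finally show ?thesis .
  qed
  have e0: "riem_exp M p 0 = p"
  proof -
    obtain u where u: "riem_exp M p 0 = chart_inv c' u" "norm (u - x - 0) \<le> C * (norm (0::'h))\<^sup>2"
      using ex[of 0] \<rho>1(1) by auto
    have "u = x" using u(2) by simp
    then show ?thesis using u(1) chart_props(6)[OF c'] unfolding x_def by simp
  qed
  \<comment> \<open>Division by \<open>k\<close> passes from the norm of the model space to the
    tangent norm; the added 1 makes the constant strictly positive, as \<open>prox_subdiff\<close>
    demands.\<close>
  have pos: "C2 / k + 1 > 0" "sqrt k * \<rho> > 0" using C2 k \<rho> by (simp_all add: add_nonneg_pos)
  have loc0: "(G \<circ> riem_exp M p) 0 + ereal (bil ?g \<zeta> (v - 0) - (C2 / k + 1) * (sqrt (bil ?g (v - 0) (v - 0)))\<^sup>2)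
        \<le> (G \<circ> riem_exp M p) v" if v: "sqrt (bil ?g (v - 0) (v - 0)) < sqrt k * \<rho>" for v
  proof -
    have "sqrt k * norm v \<le> sqrt (bil ?g v v)"
      using real_sqrt_le_mono[OF k(2)[of v]] by (simp add: real_sqrt_mult)
    then have "sqrt k * norm v < sqrt k * \<rho>" using v by simp
    then have nv: "norm v < \<rho>" using k by simp
    have "(norm v)\<^sup>2 \<le> bil ?g v v / k" using k(2)[of v] k(1) by (simp add: field_simps)
    then have "C2 * (norm v)\<^sup>2 \<le> C2 * (bil ?g v v / k)" using C2 by (rule mult_left_mono)
    also have "\<dots> \<le> (C2 / k + 1) * bil ?g v v" using gpos[of v] by (simp add: distrib_right)
    finally have "bil ?g \<zeta> v - (C2 / k + 1) * bil ?g v v \<le> bil ?g \<zeta> v - C2 * (norm v)\<^sup>2" by simp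
    then have "G p + ereal (bil ?g \<zeta> v - (C2 / k + 1) * bil ?g v v) \<le> G p + ereal (bil ?g \<zeta> v - C2 * (norm v)\<^sup>2)"
      by (intro add_left_mono) simp
    also have "\<dots> \<le> G (riem_exp M p v)" by (rule est[OF nv])
    finally show ?thesis using e0 gpos[of v] by simp
  qed
  moreover have "(G \<circ> riem_exp M p) 0 < \<infinity>" using e0 G by simp
  ultimately have "\<zeta> \<in> prox_subdiff (tangent_inner M p) (G \<circ> riem_exp M p) 0"
    unfolding prox_subdiff_def ti using pos by blast
  then have "\<zeta> \<in> riem_prox_subdiff M G p" unfolding riem_prox_subdiff_def using G(1) by simp
  then show ?thesis using nD by blast
qed


text \<open>Lower semicontinuity refers to the given topology; it passes to the distance because
  small distance implies topological nearness.\<close>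

lemma lsc_rdist:
  assumes "lower_semicontinuous G" "t < G p"
  shows "\<exists>e>0. \<forall>q. rdist M p q < ennreal e \<longrightarrow> t < G q"
proof -
  have "\<forall>\<^sub>F y in nhds p. t < G y" using assms unfolding lower_semicontinuous_def by blast
  then obtain U where U: "open U" "p \<in> U" "\<And>y. y \<in> U \<Longrightarrow> t < G y" unfolding eventually_nhds by blast
  then show ?thesis using rdist_imp_topology[OF U(1,2)] by blast
qed

text \<open>Distances and values may be infinite, so the principle is applied on the set
  \<open>X\<close> of points of finite value at finite distance from \<open>x\<close>. A point
  \<open>z\<close> of infinite value satisfies the last inequality trivially.\<close>

lemma ekeland_manifold:
  assumes comp: "complete_manifold M" and lsc: "lower_semicontinuous G" and G0: "\<And>q. 0 \<le> G q"
    and x: "G x \<noteq> \<infinity>" and lam: "lam > 0"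
  shows "\<exists>y. G y \<noteq> \<infinity> \<and> rdist M y x < \<infinity> \<and>
    real_of_ereal (G y) + lam * enn2real (rdist M y x) \<le> real_of_ereal (G x) \<and>
    (\<forall>z. rdist M z y < \<infinity> \<longrightarrow> ereal (real_of_ereal (G y) - lam * enn2real (rdist M z y)) \<le> G z)"
proof -
  define X where "X = {q. G q \<noteq> \<infinity> \<and> rdist M q x < \<infinity>}"
  define d where "d p q = enn2real (rdist M p q)" for p q
  define f where "f q = real_of_ereal (G q)" for q
  have fG: "G q = ereal (f q)" if "G q \<noteq> \<infinity>" for q
    unfolding f_def using that G0[of q] by (cases "G q") auto
  have fin: "rdist M p q < \<infinity>" if "rdist M p x < \<infinity>" "rdist M q x < \<infinity>" for p q
  proof -
    have "rdist M p q \<le> rdist M p x + rdist M q x" unfolding rdist_sym[of q x] by (rule rdist_triangle)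
    also have "\<dots> < \<infinity>" using that by simp
    finally show ?thesis .
  qed
  have finX: "rdist M p q < \<infinity>" if "p \<in> X" "q \<in> X" for p q
    by (rule fin) (use that in \<open>simp_all add: X_def\<close>)
  have dr: "rdist M p q = ennreal (d p q)" if "rdist M p q < \<infinity>" for p q
    unfolding d_def using that by simp
  have "\<exists>y\<in>X. f y + lam * d y x \<le> f x \<and> (\<forall>z\<in>X. f y \<le> f z + lam * d z y)"
  proof (rule ekeland_pseudometric)
    show "d p p = 0" for p unfolding d_def by (simp add: rdist_refl)
    show "d p q \<ge> 0" for p q unfolding d_def by simp
    show "d p q = d q p" for p q unfolding d_def by (subst rdist_sym) (rule refl)
    show "d p r \<le> d p q + d q r" if "p \<in> X" "q \<in> X" "r \<in> X" for p q r
    proof -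
      have "rdist M p q < \<infinity>" "rdist M q r < \<infinity>" "rdist M p r < \<infinity>" by (intro finX that)+
      then have "ennreal (d p r) \<le> ennreal (d p q + d q r)"
        using rdist_triangle[of p r q] dr by (simp add: d_def)
      moreover have "d p q + d q r \<ge> 0" unfolding d_def by simp
      ultimately show ?thesis by (simp only: ennreal_le_iff)
    qed
    show "f p \<ge> 0" for p unfolding f_def using G0[of p] by (simp add: real_of_ereal_pos)
    show "x \<in> X" unfolding X_def using x rdist_refl by simp
    show "lam > 0" by (rule lam)
    fix s :: "nat \<Rightarrow> 'm"
    assume sX: "\<And>n. s n \<in> X" and C: "\<And>e. e > 0 \<Longrightarrow> \<exists>N. \<forall>m\<ge>N. \<forall>n\<ge>N. d (s m) (s n) < e"
      and dec: "decseq (\<lambda>n. f (s n))"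
    have sfin: "rdist M (s m) (s n) < \<infinity>" for m n by (rule finX[OF sX sX])
    have "\<exists>N. \<forall>m\<ge>N. \<forall>n\<ge>N. rdist M (s m) (s n) < e" if e: "e > 0" for e
    proof (cases e)
      case (real r)
      then have "r > 0" using e by simp
      from C[OF this] obtain N where N: "\<forall>m\<ge>N. \<forall>n\<ge>N. d (s m) (s n) < r" ..
      have "rdist M (s m) (s n) < e" if "m \<ge> N" "n \<ge> N" for m n
        unfolding dr[OF sfin] real(2) using N that by (simp add: ennreal_less_iff d_def)
      then show ?thesis by blast
    next
      case top
      then show ?thesis using sfin by simp
    qed
    then have cauchy: "\<forall>e>0. \<exists>N. \<forall>m\<ge>N. \<forall>n\<ge>N. rdist M (s m) (s n) < e"
      by (intro allI impI)
    have "\<exists>p. \<forall>e>0. \<exists>N. \<forall>n\<ge>N. rdist M (s n) p < e"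
      using comp[unfolded complete_manifold_def, THEN spec[of _ s]] cauchy by (rule mp)
    then obtain p where p0: "\<forall>e>0. \<exists>N. \<forall>n\<ge>N. rdist M (s n) p < e" by (rule exE)
    have p: "\<exists>N. \<forall>n\<ge>N. rdist M (s n) p < e" if "e > 0" for e by (rule mp[OF spec[OF p0] that])
    have sG: "G (s n) = ereal (f (s n))" for n by (rule fG) (use sX[of n] in \<open>simp add: X_def\<close>)
    \<comment> \<open>If the limit had a larger value than \<open>s n\<close>, lower semicontinuity
      would give late terms \<open>s k\<close> a larger value as well, while \<open>f\<close>
      decreases along the sequence.\<close>
    have le: "G p \<le> G (s n)" for n
    proof (rule ccontr)
      assume "\<not> G p \<le> G (s n)"
      then have "G (s n) < G p" by (simp only: not_le)
      from lsc_rdist[OF lsc this] obtain e where e: "e > 0" "\<forall>q. rdist M p q < ennreal e \<longrightarrow> G (s n) < G q" by blast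
      have "ennreal e > 0" using e(1) by simp
      then obtain N where N: "\<forall>k\<ge>N. rdist M (s k) p < ennreal e" by (rule exE[OF p])
      define k where "k = max n N"
      have "rdist M p (s k) < ennreal e" using N unfolding rdist_sym[of p] k_def by simp
      then have "G (s n) < G (s k)" using e(2) by blast
      moreover have "f (s k) \<le> f (s n)" using dec unfolding decseq_def k_def by simp
      ultimately show False unfolding sG by simp
    qed
    have "G p \<noteq> \<infinity>" using le[of 0] unfolding sG by auto
    obtain N where N: "\<forall>n\<ge>N. rdist M (s n) p < 1" by (rule exE[OF p[OF zero_less_one]])
    have "rdist M p x \<le> rdist M p (s N) + rdist M (s N) x" by (rule rdist_triangle)
    also have "\<dots> < \<infinity>"
    proof -
      have "rdist M (s N) p < 1" using N by simp
      then have "rdist M p (s N) < \<infinity>" unfolding rdist_sym[of p] by (rule less_trans) simp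
      moreover have "rdist M (s N) x < \<infinity>" using sX unfolding X_def by blast
      ultimately show ?thesis by simp
    qed
    finally have pX: "p \<in> X" unfolding X_def using \<open>G p \<noteq> \<infinity>\<close> by blast
    have "(\<lambda>n. d (s n) p) \<longlonglongrightarrow> 0"
    proof (rule metric_LIMSEQ_I)
      fix r :: real assume r: "r > 0"
      have "ennreal r > 0" using r by simp
      then obtain N where N: "\<forall>n\<ge>N. rdist M (s n) p < ennreal r" by (rule exE[OF p])
      have "dist (d (s n) p) 0 < r" if "n \<ge> N" for n
      proof -
        have "rdist M (s n) p < ennreal r" using N that by blast
        then have "ennreal (d (s n) p) < ennreal r" unfolding dr[OF finX[OF sX pX]] .
        moreover have d0: "d (s n) p \<ge> 0" unfolding d_def by simp
        ultimately have "d (s n) p < r" by (simp only: ennreal_less_iff)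
        then show ?thesis using d0 by simp
      qed
      then show "\<exists>N. \<forall>n\<ge>N. dist (d (s n) p) 0 < r" by blast
    qed
    moreover have "f p \<le> f (s n)" for n using le[of n] unfolding sG fG[OF \<open>G p \<noteq> \<infinity>\<close>] by simp
    ultimately show "\<exists>p\<in>X. (\<lambda>n. d (s n) p) \<longlonglongrightarrow> 0 \<and> (\<forall>n. f p \<le> f (s n))" using pX by blast
  qed
  then obtain y where y: "y \<in> X" "f y + lam * d y x \<le> f x" and ymin: "\<And>z. z \<in> X \<Longrightarrow> f y \<le> f z + lam * d z y" by blast
  have "ereal (f y - lam * d z y) \<le> G z" if z: "rdist M z y < \<infinity>" for z
  proof (cases "G z = \<infinity>")
    case False
    have "rdist M z x \<le> rdist M z y + rdist M y x" by (rule rdist_triangle)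
    also have "\<dots> < \<infinity>" using z y(1) unfolding X_def by simp
    finally have "z \<in> X" unfolding X_def using False by blast
    then have "f y - lam * d z y \<le> f z" using ymin[of z] by simp
    then show ?thesis unfolding fG[OF False] by simp
  qed simp
  then show ?thesis using y unfolding X_def d_def f_def by blast
qed

text \<open>Near an Ekeland point \<open>y\<close>, segments in a chart bound the distance to \<open>y\<close> by a multiple close
  to 1 of the norm of the tangent space at \<open>y\<close>, so \<open>G\<close> has small slope there in the chart.\<close>

lemma small_prox_subgradient:
  assumes comp: "complete_manifold M" and lsc: "lower_semicontinuous G" and G0: "\<And>q. 0 \<le> G q"
    and \<epsilon>: "\<epsilon> > 0" and \<delta>: "\<delta> > 0" and x: "rdist M x x0 < ennreal \<epsilon>" "G x < ereal (\<epsilon> * \<delta>)"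
  shows "\<exists>p \<zeta>. rdist M p x0 < ennreal (2 * \<epsilon>) \<and> \<zeta> \<in> riem_prox_subdiff M G p \<and> tangent_norm M p \<zeta> < \<delta>"
proof -
  have xinf: "G x \<noteq> \<infinity>" using x(2) by auto
  define fx where "fx = real_of_ereal (G x)"
  have fx: "G x = ereal fx" "fx \<ge> 0" "fx < \<epsilon> * \<delta>"
    using x(2) G0[of x] xinf unfolding fx_def by (cases "G x"; simp)+
  \<comment> \<open>Slopes strictly between \<open>q\<close> and \<open>\<delta>\<close> are
    admissible: \<open>lam > q\<close> forces the Ekeland point to lie within
    \<open>\<epsilon>\<close> of \<open>x\<close>.\<close>
  define q where "q = fx / \<epsilon>"
  define lam where "lam = (q + \<delta>) / 2"
  have fd: "q < \<delta>" "q \<ge> 0" unfolding q_def using fx \<epsilon> by (auto simp: field_simps)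
  have lam: "q < lam" "lam < \<delta>" "lam > 0" unfolding lam_def using fd \<delta> by auto
  have fl: "fx < lam * \<epsilon>" using lam(1) \<epsilon> unfolding q_def by (simp add: field_simps)
  obtain y where yG: "G y \<noteq> \<infinity>" and yx: "rdist M y x < \<infinity>"
    and yle: "real_of_ereal (G y) + lam * enn2real (rdist M y x) \<le> fx"
    and ymin: "\<And>z. rdist M z y < \<infinity> \<Longrightarrow> ereal (real_of_ereal (G y) - lam * enn2real (rdist M z y)) \<le> G z"
    using ekeland_manifold[OF comp lsc G0 xinf lam(3)] unfolding fx_def by blast
  have "real_of_ereal (G y) \<ge> 0" using G0[of y] by (simp add: real_of_ereal_pos)
  then have "lam * enn2real (rdist M y x) < lam * \<epsilon>" using yle fl by linarith
  then have "enn2real (rdist M y x) < \<epsilon>" using lam(3) by simp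
  then have "rdist M y x < ennreal \<epsilon>"
    using yx \<epsilon> by (cases "rdist M y x") (auto simp: ennreal_less_iff)
  then have "rdist M y x + rdist M x x0 < ennreal \<epsilon> + ennreal \<epsilon>" using x(1) by (rule add_strict_mono)
  then have "rdist M y x0 < ennreal \<epsilon> + ennreal \<epsilon>" using rdist_triangle[of y x0 x] by (rule le_less_trans[rotated])
  also have "\<dots> = ennreal (2 * \<epsilon>)" using \<epsilon> by (simp flip: ennreal_plus)
  finally have yx0: "rdist M y x0 < ennreal (2 * \<epsilon>)" .
  \<comment> \<open>The room left in the ball, since the subgradient will be found at a point near
    \<open>y\<close> rather than at \<open>y\<close>.\<close>
  define gap where "gap = 2 * \<epsilon> - enn2real (rdist M y x0)"
  have gap: "gap > 0" "rdist M y x0 + ennreal gap = ennreal (2 * \<epsilon>)"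
  proof -
    obtain a where a: "rdist M y x0 = ennreal a" "a \<ge> 0" "a < 2 * \<epsilon>"
      using yx0 by (cases "rdist M y x0") (auto simp: ennreal_less_iff)
    show "gap > 0" unfolding gap_def a(1) using a by simp
    show "rdist M y x0 + ennreal gap = ennreal (2 * \<epsilon>)" unfolding gap_def a(1) using a by (simp flip: ennreal_plus)
  qed
  \<comment> \<open>Makes \<open>lam * (1 + \<eta>)\<close> the midpoint of \<open>lam\<close> and
    \<open>\<delta>\<close>. The factor \<open>R = sqrt (1 + \<eta>)\<close> is lost twice: from the
    distance to the norm at \<open>y\<close>, and from the norm at \<open>y\<close> to the norm at
    \<open>p\<close>.\<close>
  define \<eta> where "\<eta> = (\<delta> / lam - 1) / 2"
  have \<eta>: "\<eta> > 0" "lam * (1 + \<eta>) < \<delta>"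
    unfolding \<eta>_def using lam by (auto simp: field_simps)
  define R where "R = sqrt (1 + \<eta>)"
  have R: "R > 0" "R * R = 1 + \<eta>" unfolding R_def using \<eta> by auto
  define a1 where "a1 = lam * R"
  define b where "b = \<delta> / R"
  define a2 where "a2 = (a1 + b) / 2"
  have "a1 * R < \<delta>" unfolding a1_def using \<eta>(2) R(2) by (simp add: mult.assoc)
  then have "a1 < b" unfolding b_def using R(1) by (simp add: field_simps)
  then have "a1 < a2" "a2 < b" unfolding a2_def by auto
  moreover have "0 \<le> a1" unfolding a1_def using lam R by simp
  ultimately have a12: "0 \<le> a1" "a1 < a2" "a2 < \<delta> / R" unfolding b_def by blast+
  have a2R: "a2 * R < \<delta>" using a12(3) R(1) by (simp add: field_simps)
  define c where "c = ref_chart M y"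
  have c: "c \<in> atlas M" and yc: "y \<in> chart_dom c" unfolding c_def by (rule ref_chart)+
  define u0 where "u0 = chart_map c y"
  have u0: "u0 \<in> chart_img c" "chart_inv c u0 = y" unfolding u0_def by (rule chart_props(5,6)[OF c yc])+
  let ?B = "metric M c u0"
  obtain k where k: "k > 0" "\<And>u. k * (norm u)\<^sup>2 \<le> bil ?B u u" using metric_coercive[OF c u0(1)] by blast
  obtain r0 where r0: "r0 > 0" "cball u0 r0 \<subseteq> chart_img c"
    and near: "\<And>x w. x \<in> cball u0 r0 \<Longrightarrow> bil (metric M c x) w w \<le> (1 + \<eta>) * bil ?B w w \<and>
      bil ?B w w \<le> (1 + \<eta>) * bil (metric M c x) w w"
    using metric_near[OF c u0(1) \<eta>(1)] by blast
  \<comment> \<open>Bounds the distance to \<open>y\<close> by \<open>K\<close> times the coordinate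
    distance to \<open>u0\<close>, so \<open>K * r < gap\<close> keeps \<open>p\<close> in the ball
    of radius \<open>2 * \<epsilon>\<close>.\<close>
  define K where "K = R * sqrt (norm ?B + 1)"
  have K: "K > 0" unfolding K_def by (intro mult_pos_pos R(1) real_sqrt_gt_zero add_nonneg_pos) auto
  define r where "r = min r0 (gap / (2 * K))"
  have r: "r > 0" "r \<le> r0" "K * r < gap"
  proof -
    show "r > 0" "r \<le> r0" unfolding r_def using r0 gap K by auto
    have "K * r \<le> K * (gap / (2 * K))" unfolding r_def using K by (intro mult_left_mono) auto
    also have "\<dots> < gap" using K gap by simp
    finally show "K * r < gap" .
  qed
  have sub: "cball u0 r \<subseteq> chart_img c" using r(2) r0(2) by auto
  have Bpos: "bil ?B w w \<ge> 0" for w by (rule metric_nonneg[OF c u0(1)])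
  have seg: "rdist M (chart_inv c u) y \<le> ennreal (R * sqrt (bil ?B (u - u0) (u - u0)))" if u: "u \<in> cball u0 r" for u
  proof -
    have cs: "closed_segment u0 u \<subseteq> cball u0 r0" using u r by (intro closed_segment_subset) auto
    have "rdist M (chart_inv c u0) (chart_inv c u) \<le> ennreal (R * sqrt (bil ?B (u - u0) (u - u0)))"
    proof (rule rdist_chart_segment[OF c])
      show "closed_segment u0 u \<subseteq> chart_img c" using cs r0(2) by blast
      show "R * sqrt (bil ?B (u - u0) (u - u0)) \<ge> 0" using R(1) Bpos by simp
      fix z assume "z \<in> closed_segment u0 u"
      then have "bil (metric M c z) (u - u0) (u - u0) \<le> (1 + \<eta>) * bil ?B (u - u0) (u - u0)" using near cs by blast
      also have "\<dots> = (R * sqrt (bil ?B (u - u0) (u - u0)))\<^sup>2"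
        unfolding power_mult_distrib using R(2) Bpos by (simp add: power2_eq_square)
      finally show "bil (metric M c z) (u - u0) (u - u0) \<le> (R * sqrt (bil ?B (u - u0) (u - u0)))\<^sup>2" .
    qed
    then show ?thesis unfolding u0(2) rdist_sym[of "chart_inv c u" y] .
  qed
  define f where "f u = G (chart_inv c u)" for u
  have near_lsc: "\<forall>\<^sub>F v in at u within cball u0 r. t < f v" if u: "u \<in> cball u0 r" and t: "t < f u" for u t
  proof -
    have "\<forall>\<^sub>F q in nhds (chart_inv c u). t < G q" using lsc t unfolding lower_semicontinuous_def f_def by blast
    moreover have "(chart_inv c \<longlongrightarrow> chart_inv c u) (at u within cball u0 r)"
      using continuous_on_subset[OF chart_props(4)[OF c] sub] u unfolding continuous_on_def by blast
    ultimately show ?thesis unfolding f_def by (rule eventually_compose_filterlim)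
  qed
  have slope: "ereal (real_of_ereal (f u0) - a1 * sqrt (bil ?B (u - u0) (u - u0))) \<le> f u" if u: "u \<in> cball u0 r" for u
  proof -
    have fin: "rdist M (chart_inv c u) y < \<infinity>" using seg[OF u] by (rule le_less_trans) simp
    have "enn2real (rdist M (chart_inv c u) y) \<le> R * sqrt (bil ?B (u - u0) (u - u0))"
      using enn2real_mono[OF seg[OF u]] R(1) Bpos by simp
    then have "lam * enn2real (rdist M (chart_inv c u) y) \<le> lam * (R * sqrt (bil ?B (u - u0) (u - u0)))"
      using lam by (intro mult_left_mono) auto
    then have "ereal (real_of_ereal (f u0) - a1 * sqrt (bil ?B (u - u0) (u - u0)))
        \<le> ereal (real_of_ereal (G y) - lam * enn2real (rdist M (chart_inv c u) y))"
      unfolding a1_def f_def u0(2) by (simp add: mult.assoc)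
    also have "\<dots> \<le> f u" unfolding f_def by (rule ymin[OF fin])
    finally show ?thesis .
  qed
  have f0: "0 \<le> f u" for u unfolding f_def by (rule G0)
  have fin0: "f u0 \<noteq> \<infinity>" unfolding f_def u0(2) by (rule yG)
  have "\<exists>u\<in>ball u0 r. f u \<noteq> \<infinity> \<and> (\<exists>l :: 'h \<Rightarrow>\<^sub>L real. (\<forall>w. \<bar>l w\<bar> \<le> a2 * sqrt (bil ?B w w)) \<and>
    (\<exists>\<sigma>\<ge>0. \<exists>\<rho>>0. ball u \<rho> \<subseteq> ball u0 r \<and> (\<forall>v\<in>ball u \<rho>. f u + ereal (l (v - u) - \<sigma> * (norm (v - u))\<^sup>2) \<le> f v)))"
  proof (rule proximal_subgradient_near[where k = k and ?a1.0 = a1])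
    show "bil ?B v w = bil ?B w v" for v w by (rule metric_sym[OF c u0(1)])
    show "k * (norm v)\<^sup>2 \<le> bil ?B v v" for v by (rule k(2))
    show "\<forall>\<^sub>F v in at u within cball u0 r. t < f v" if "u \<in> cball u0 r" "t < f u" for u t
      by (rule near_lsc[OF that])
    show "0 \<le> f v" for v by (rule f0)
    show "f u0 \<noteq> \<infinity>" by (rule fin0)
    show "ereal (real_of_ereal (f u0) - a1 * sqrt (bil ?B (u - u0) (u - u0))) \<le> f u" if "u \<in> cball u0 r" for u
      by (rule slope[OF that])
  qed (fact k(1) r(1) a12(1) a12(2))+
  then obtain u and l :: "'h \<Rightarrow>\<^sub>L real" and \<sigma> \<rho> where u: "u \<in> ball u0 r" "f u \<noteq> \<infinity>"
    and l: "\<forall>w. \<bar>l w\<bar> \<le> a2 * sqrt (bil ?B w w)" and \<sigma>: "\<sigma> \<ge> 0" "\<rho> > 0"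
    and loc: "\<forall>v\<in>ball u \<rho>. f u + ereal (l (v - u) - \<sigma> * (norm (v - u))\<^sup>2) \<le> f v"
    by (elim bexE exE conjE)
  have uc: "u \<in> cball u0 r" using u(1) by simp
  then have ui: "u \<in> chart_img c" using sub by blast
  define p where "p = chart_inv c u"
  have p: "p \<in> chart_dom c" "chart_map c p = u" unfolding p_def using chart_props(7,8)[OF c ui] by auto
  have D: "\<bar>blinfun_apply l w\<bar> \<le> (a2 * R) * sqrt (bil (metric M c (chart_map c p)) w w)" for w
  proof -
    have "bil ?B w w \<le> (1 + \<eta>) * bil (metric M c u) w w" using near[of u w] uc r(2) by auto
    then have "sqrt (bil ?B w w) \<le> sqrt ((1 + \<eta>) * bil (metric M c u) w w)" by (rule real_sqrt_le_mono)
    also have "\<dots> = R * sqrt (bil (metric M c u) w w)" unfolding R_def by (rule real_sqrt_mult)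
    finally have "a2 * sqrt (bil ?B w w) \<le> a2 * (R * sqrt (bil (metric M c u) w w))"
      using a12 by (intro mult_left_mono) auto
    then show ?thesis using spec[OF l, of w] unfolding p(2) by (simp add: mult.assoc)
  qed
  have "\<exists>\<zeta>\<in>riem_prox_subdiff M G p. tangent_norm M p \<zeta> \<le> a2 * R"
  proof (rule prox_subdiff_of_chart[OF c p(1) _ G0 D _ \<sigma>])
    show "G p \<noteq> \<infinity>" using u(2) unfolding f_def p_def .
    show "a2 * R \<ge> 0" using a12 R by simp
    show "G p + ereal (blinfun_apply l (v - chart_map c p) - \<sigma> * (norm (v - chart_map c p))\<^sup>2) \<le> G (chart_inv c v)"
      if "v \<in> ball (chart_map c p) \<rho>" for v
      using bspec[OF loc that[unfolded p(2)]] unfolding p(2) f_def p_def[symmetric] .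
  qed
  then obtain \<zeta> where \<zeta>: "\<zeta> \<in> riem_prox_subdiff M G p" "tangent_norm M p \<zeta> \<le> a2 * R" by blast
  have "rdist M p x0 < ennreal (2 * \<epsilon>)"
  proof -
    have "bil ?B (u - u0) (u - u0) \<le> norm ?B * norm (u - u0) * norm (u - u0)" using norm_bil[of ?B "u - u0" "u - u0"] by simp
    also have "\<dots> \<le> (norm ?B + 1) * (norm (u - u0))\<^sup>2" by (simp add: power2_eq_square distrib_right)
    finally have "sqrt (bil ?B (u - u0) (u - u0)) \<le> sqrt ((norm ?B + 1) * (norm (u - u0))\<^sup>2)" by (rule real_sqrt_le_mono)
    also have "\<dots> = sqrt (norm ?B + 1) * norm (u - u0)" by (simp add: real_sqrt_mult)
    also have "\<dots> \<le> sqrt (norm ?B + 1) * r" using uc by (intro mult_left_mono) (auto simp: dist_norm norm_minus_commute)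
    finally have "R * sqrt (bil ?B (u - u0) (u - u0)) \<le> R * (sqrt (norm ?B + 1) * r)" using R(1) by (intro mult_left_mono) auto
    also have "\<dots> = K * r" unfolding K_def by simp
    also have "\<dots> < gap" by (rule r(3))
    finally have "rdist M p y < ennreal gap"
      using seg[OF uc] gap(1) unfolding p_def[symmetric] by (auto elim!: le_less_trans intro!: ennreal_lessI)
    moreover have "rdist M y x0 < top" using yx0 by (rule less_trans) simp
    ultimately have "rdist M p y + rdist M y x0 < ennreal gap + rdist M y x0"
      by (simp add: ennreal_add_left_cancel_less add.commute less_top)
    also have "\<dots> = ennreal (2 * \<epsilon>)" using gap(2) by (simp add: add.commute)
    finally show ?thesis using rdist_triangle[of p x0 y] by (rule le_less_trans[rotated])
  qed
  moreover have "tangent_norm M p \<zeta> < \<delta>" using \<zeta>(2) a2R by linarith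
  ultimately show ?thesis using \<zeta>(1) by blast
qed

end

theorem corollary26:
  fixes M :: "('m::t2_space, 'h::{real_inner, complete_space}) manifold"
    and A :: "'i set"
    and F :: "'m \<Rightarrow> 'i \<Rightarrow> ereal"
    and x0 :: 'm
    and \<epsilon> \<delta> :: real
  assumes "riemannian_manifold M"
    and "complete_manifold M"
    and "\<And>x \<alpha>. \<alpha> \<in> A \<Longrightarrow> 0 \<le> F x \<alpha>"
    and "\<And>\<alpha>. \<alpha> \<in> A \<Longrightarrow> lower_semicontinuous (\<lambda>x. F x \<alpha>)"
    and "\<And>\<alpha>. \<alpha> \<in> A \<Longrightarrow> \<exists>x. F x \<alpha> \<noteq> \<infinity>"
    and "\<epsilon> > 0" and "\<delta> > 0"
    and "\<And>\<alpha> x \<zeta>. \<alpha> \<in> A \<Longrightarrow> rdist M x x0 < ennreal (2 * \<epsilon>) \<Longrightarrow> F x \<alpha> > 0 \<Longrightarrow>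
           \<zeta> \<in> riem_prox_subdiff M (\<lambda>y. F y \<alpha>) x \<Longrightarrow> tangent_norm M x \<zeta> \<ge> \<delta>"
  shows "\<forall>\<alpha>\<in>A. (\<exists>x\<in>rball M x0 \<epsilon>. F x \<alpha> < ereal (\<epsilon> * \<delta>)) \<longrightarrow>
           (\<exists>z\<in>rball M x0 (2 * \<epsilon>). F z \<alpha> = 0)"
proof (intro ballI impI)
  fix \<alpha> assume \<alpha>: "\<alpha> \<in> A" and "\<exists>x\<in>rball M x0 \<epsilon>. F x \<alpha> < ereal (\<epsilon> * \<delta>)"
  then obtain x where x: "rdist M x x0 < ennreal \<epsilon>" "F x \<alpha> < ereal (\<epsilon> * \<delta>)" unfolding rball_def by blast
  interpret riemannian M by (rule riemannian.intro[OF assms(1)])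
  obtain p \<zeta> where p: "rdist M p x0 < ennreal (2 * \<epsilon>)" and \<zeta>: "\<zeta> \<in> riem_prox_subdiff M (\<lambda>y. F y \<alpha>) p" "tangent_norm M p \<zeta> < \<delta>"
    using small_prox_subgradient[OF assms(2) assms(4)[OF \<alpha>] assms(3)[OF \<alpha>] assms(6,7) x] by blast
  \<comment> \<open>The hypothesis on subgradients is tested at \<open>p\<close> alone: a positive
    value there would force norm at least \<open>\<delta>\<close>, so nonnegativity leaves only the
    value 0.\<close>
  have "\<not> F p \<alpha> > 0"
  proof
    assume "F p \<alpha> > 0"
    then have "\<delta> \<le> tangent_norm M p \<zeta>" by (rule assms(8)[OF \<alpha> p _ \<zeta>(1)])
    then show False using \<zeta>(2) by simp
  qed
  then have "F p \<alpha> = 0" using assms(3)[OF \<alpha>, of p] by simp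
  moreover have "p \<in> rball M x0 (2 * \<epsilon>)" using p unfolding rball_def by simp
  ultimately show "\<exists>z\<in>rball M x0 (2 * \<epsilon>). F z \<alpha> = 0" by (rule bexI)
qed

end
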